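(* Let Assumption A hold and $z\in\overline\Pi\setminus\{0\}$. Let $u(x,z)$ be the unique bounded solution on $[x_1(z),\infty)$ of $u(x,z)=1+\int_x^\infty G(x,y,z)r(y,z)u(y,z)dy$, and let $\theta(x,z)=a(x,z)u(x,z)$ for $x\ge x_1(z)$, extended to all $x\ge0$ as a solution of \[ -\big(p(x)\theta'(x,z)\big)'+q(x)\theta(x,z)=z\,\theta(x,z). \] Then $\theta$ satisfies this equation on $\mathbb R_+$ and \[ \theta(x,z)=a(x,z)\big(1+O(\varepsilon(x))\big),\qquad x\to\infty, \] uniformly in $z$ from compact subsets of $\overline\Pi\setminus\{0\}$. For every $x\ge0$, $\theta(x,z)$ is analytic in $z\in\Pi$ and continuous up to the cut along $\mathbb R$ with the possible exception of $z=0$.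
   Context: Assumption A: $p>0$ absolutely continuous on $\mathbb R_+$, $p'\in L^1(\mathbb R_+)$, $p(x)\to p_0>0$; $q$ real, $q\in L^1(0,x_0)$, absolutely continuous on $[x_0,\infty)$, $q'\in L^1(x_0,\infty)$, $q(x)\to0$ as $x\to\infty$. $\Pi=\mathbb C\setminus\mathbb R$; $\overline\Pi\setminus\{0\}$ is $\Pi$ together with boundary values $\lambda\pm i0$, $\lambda\in\mathbb R\setminus\{0\}$. $\omega(x,z)=\sqrt{(q(x)-z)/p(x)}$ with $\Re\omega>0$ for $z\in\Pi$ and boundary values on the cut; $\Omega(x,z)=\int_0^x\omega(y,z)dy$; $a(x,z)=e^{-\Omega(x,z)}$; $r(x,z)=(p(x)\omega(x,z))'$; $G(x,y,z)=a(y,z)^2\int_x^y p(s)^{-1}a(s,z)^{-2}ds$; $\varepsilon(x)=\int_x^\infty(|p'|+|q'|)dy$; $x_1(z)\ge x_0$ with $|q(x)|\le|z|/2$ for $x\ge x_1(z)$. The function $\theta$ is called the (modified) Jost solution. *)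

theory Defs
  imports "HOL-Analysis.Analysis"
begin

text \<open>The set overline(Pi) minus 0 is the disjoint union of two sheets:
 the closed upper half-plane (real points = boundary values lambda + i0, side True)
 and the closed lower half-plane (real points = lambda - i0, side False), both without 0.\<close>
definition cutdom :: "bool \<Rightarrow> complex set" where
  "cutdom s = (if s then {z. 0 \<le> Im z} else {z. Im z \<le> 0}) - {0}"

text \<open>omega(x,z) = sqrt((q(x)-z)/p(x)) with Re omega > 0 on Pi, continuously
 extended to the cut from the side s.\<close>
definition omega :: "(real \<Rightarrow> real) \<Rightarrow> (real \<Rightarrow> real) \<Rightarrow> bool \<Rightarrow> real \<Rightarrow> complex \<Rightarrow> complex" where
  "omega p q s x z =
     (if s then - \<i> * csqrt ((z - of_real (q x)) / of_real (p x))
      else cnj (- \<i> * csqrt ((cnj z - of_real (q x)) / of_real (p x))))"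

definition Omega :: "(real \<Rightarrow> real) \<Rightarrow> (real \<Rightarrow> real) \<Rightarrow> bool \<Rightarrow> real \<Rightarrow> complex \<Rightarrow> complex" where
  "Omega p q s x z = integral {0..x} (\<lambda>y. omega p q s y z)"

definition jost_a :: "(real \<Rightarrow> real) \<Rightarrow> (real \<Rightarrow> real) \<Rightarrow> bool \<Rightarrow> real \<Rightarrow> complex \<Rightarrow> complex" where
  "jost_a p q s x z = exp (- Omega p q s x z)"

text \<open>r(x,z) = (p(x) omega(x,z))', written out by the chain rule using the
 (a.e.) derivatives dp = p', dq = q' (valid for x >= x1(z), where q(x) - z is nonzero).\<close>
definition rfun :: "(real \<Rightarrow> real) \<Rightarrow> (real \<Rightarrow> real) \<Rightarrow> (real \<Rightarrow> real) \<Rightarrow> (real \<Rightarrow> real)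
                    \<Rightarrow> bool \<Rightarrow> real \<Rightarrow> complex \<Rightarrow> complex" where
  "rfun p q dp dq s x z =
     (of_real (dp x) * (of_real (q x) - z) + of_real (p x) * of_real (dq x))
       / (2 * of_real (p x) * omega p q s x z)"

definition Gfun :: "(real \<Rightarrow> real) \<Rightarrow> (real \<Rightarrow> real) \<Rightarrow> bool \<Rightarrow> real \<Rightarrow> real \<Rightarrow> complex \<Rightarrow> complex" where
  "Gfun p q s x y z =
     (jost_a p q s y z)\<^sup>2 * integral {x..y} (\<lambda>t. inverse (of_real (p t) * (jost_a p q s t z)\<^sup>2))"

definition epsf :: "(real \<Rightarrow> real) \<Rightarrow> (real \<Rightarrow> real) \<Rightarrow> real \<Rightarrow> real" where
  "epsf dp dq x = integral {x..} (\<lambda>y. \<bar>dp y\<bar> + \<bar>dq y\<bar>)"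

text \<open>theta solves -(p theta')' + q theta = z theta on [0,oo) (Caratheodory sense:
 theta and p theta' absolutely continuous; written in integrated form).\<close>
definition sl_solution :: "(real \<Rightarrow> real) \<Rightarrow> (real \<Rightarrow> real) \<Rightarrow> complex \<Rightarrow> (real \<Rightarrow> complex) \<Rightarrow> bool" where
  "sl_solution p q z \<theta> \<longleftrightarrow>
     (\<exists>\<theta>'. (\<forall>x\<ge>0. (\<theta> has_vector_derivative \<theta>' x) (at x within {0..})) \<and>
          (\<forall>x\<ge>0. ((\<lambda>t. (of_real (q t) - z) * \<theta> t) has_integral
                    (of_real (p x) * \<theta>' x - of_real (p 0) * \<theta>' 0)) {0..x}))"

definition jost_family ::
  "(real \<Rightarrow> real) \<Rightarrow> (real \<Rightarrow> real) \<Rightarrow> (real \<Rightarrow> real) \<Rightarrow> (real \<Rightarrow> real) \<Rightarrow> (complex \<Rightarrow> real)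
    \<Rightarrow> (bool \<Rightarrow> real \<Rightarrow> complex \<Rightarrow> complex) \<Rightarrow> bool" where
  "jost_family p q dp dq x1 \<theta> \<longleftrightarrow>
     (\<forall>s z. z \<in> cutdom s \<longrightarrow>
        sl_solution p q z (\<lambda>x. \<theta> s x z) \<and>
        (\<exists>u :: real \<Rightarrow> complex.
           bounded (u ` {x1 z..}) \<and>
           (\<forall>x\<ge>x1 z.
              (\<lambda>y. Gfun p q s x y z * rfun p q dp dq s y z * u y) integrable_on {x..} \<and>
              u x = 1 + integral {x..} (\<lambda>y. Gfun p q s x y z * rfun p q dp dq s y z * u y)) \<and>
           (\<forall>x\<ge>x1 z. \<theta> s x z = jost_a p q s x z * u x)))"

end

theory Submission
  imports Defs "HOL-Complex_Analysis.Complex_Analysis"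
begin

text \<open>
  Both the Jost equation on \<open>[x\<^sub>1, \<infinity>)\<close> and the initial value problem that continues its solution
  back to \<open>0\<close> are Volterra equations \<open>u(x) = u\<^sub>0(x) + \<integral>\<^sub>x\<^sup>\<infinity> (S(y) - S(x)) g(y) u(y) dy\<close> whose kernel is
  dominated by an integrable \<open>\<rho>(y)\<close>: in the first case \<open>S' = 1 / (p a\<^sup>2)\<close> and \<open>g = a\<^sup>2 r\<close>, in the second
  \<open>S' = 1 / p\<close> and \<open>g = q - z\<close> cut off at the starting point. The iterates are bounded by
  \<open>M m(x)\<^sup>n / n!\<close> with \<open>m(x) = \<integral>\<^sub>x\<^sup>\<infinity> \<rho>\<close>, uniformly in \<open>z\<close>, so the Neumann series gives existence,
  uniqueness among bounded functions, the asymptotics, and regularity in \<open>z\<close>. Since \<open>u\<close> is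
  determined by its values near infinity, the solution does not depend on the choice of \<open>x\<^sub>1(z)\<close>,
  and regularity may be checked on compact pieces of the domain with a common starting point.
\<close>

section \<open>Absolutely continuous functions\<close>

text \<open>Derivatives are therefore carried as densities by \<open>ac_deriv\<close>, whose rules
  are statements about integrals. The analytic obstacle is the cut: there Re omega may vanish, so a
  need not decay, and the obvious estimate of G grows like y - x. Only the monotonicity of |a|
  survives; boundedness of G must come from integration by parts, and it stays uniform up to the
  real axis because z keeps away from 0 and hence p omega does too. For nonreal z the factor S grows
  while g decays, so the estimate is imposed on the product (S(y) - S(x)) g(y), with a second one on
  g alone to control p theta'. The pair (theta, p theta') at the starting point is the data of the
  backward problem; its regularity in z is what makes the continuation to 0 regular.\<close>

definition ac_deriv :: "real \<Rightarrow> (real \<Rightarrow> 'a::euclidean_space) \<Rightarrow> (real \<Rightarrow> 'a) \<Rightarrow> bool" where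
  "ac_deriv X f f' \<longleftrightarrow> (\<forall>a b. X \<le> a \<longrightarrow> a \<le> b \<longrightarrow>
     f' absolutely_integrable_on {a..b} \<and> (f' has_integral f b - f a) {a..b})"

lemma at_within_atLeast_Icc:
  fixes x :: real
  assumes "x < b"
  shows "at x within {X..} = at x within {X..b}"
  by (rule at_within_nhd[of x "{..<b}"]) (use assms in auto)

lemma continuous_on_atLeastI:
  fixes f :: "real \<Rightarrow> 'a::topological_space"
  assumes "\<And>b. continuous_on {X..b} f"
  shows "continuous_on {X..} f"
  unfolding continuous_on_eq_continuous_within
proof
  fix x assume "x \<in> {X..}"
  then have "continuous (at x within {X..x+1}) f"
    using assms[of "x+1"] by (auto simp: continuous_on_eq_continuous_within)
  then show "continuous (at x within {X..}) f"
    using at_within_atLeast_Icc[of x "x+1" X] by simp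
qed

lemma ac_deriv_abs: "ac_deriv X f f' \<Longrightarrow> X \<le> a \<Longrightarrow> f' absolutely_integrable_on {a..b}"
  by (cases "a \<le> b") (auto simp: ac_deriv_def)

lemma ac_deriv_has_integral: "ac_deriv X f f' \<Longrightarrow> X \<le> a \<Longrightarrow> a \<le> b \<Longrightarrow> (f' has_integral f b - f a) {a..b}"
  by (auto simp: ac_deriv_def)

lemma ac_deriv_integral: "ac_deriv X f f' \<Longrightarrow> X \<le> a \<Longrightarrow> a \<le> b \<Longrightarrow> integral {a..b} f' = f b - f a"
  by (meson ac_deriv_has_integral integral_unique)

lemma ac_deriv_mono: "ac_deriv X f f' \<Longrightarrow> X \<le> Y \<Longrightarrow> ac_deriv Y f f'"
  unfolding ac_deriv_def by (meson order_trans)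

lemma ac_derivI:
  assumes "\<And>b. X \<le> b \<Longrightarrow> f' absolutely_integrable_on {X..b}"
    and "\<And>b. X \<le> b \<Longrightarrow> (f' has_integral f b - f X) {X..b}"
  shows "ac_deriv X f f'"
  unfolding ac_deriv_def
proof (intro allI impI conjI)
  fix a b assume ab: "X \<le> a" "a \<le> b"
  show ai: "f' absolutely_integrable_on {a..b}"
    using absolutely_integrable_on_subinterval[OF assms(1)[of b]] ab by auto
  then have "f' integrable_on {a..b}"
    using absolutely_integrable_on_def by blast
  moreover have "integral {X..a} f' + integral {a..b} f' = integral {X..b} f'"
    by (rule Henstock_Kurzweil_Integration.integral_combine) (use ab assms(2)[of b] in auto)
  moreover have "integral {X..a} f' = f a - f X" "integral {X..b} f' = f b - f X"
    using assms(2) ab by (auto intro!: integral_unique)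
  ultimately show "(f' has_integral f b - f a) {a..b}"
    by (smt (verit, ccfv_threshold) add_diff_cancel_left' diff_add_cancel diff_diff_eq2 integrable_integral add.commute)
qed

lemma ac_deriv_continuous:
  assumes "ac_deriv X f f'"
  shows "continuous_on {X..} f"
proof (rule continuous_on_atLeastI)
  fix b
  show "continuous_on {X..b} f"
  proof (cases "X \<le> b")
    case True
    have "f' integrable_on {X..b}"
      using assms True by (auto simp: ac_deriv_def)
    then have "continuous_on {X..b} (\<lambda>u. f X + integral {X..u} f')"
      by (intro continuous_intros indefinite_integral_continuous_1)
    then show ?thesis
      by (rule continuous_on_eq) (use assms in \<open>auto simp: ac_deriv_integral\<close>)
  qed auto
qed

lemma ac_deriv_cong:
  assumes "ac_deriv X f f'" "\<And>x. X \<le> x \<Longrightarrow> f x = g x" "\<And>x. X \<le> x \<Longrightarrow> f' x = g' x"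
  shows "ac_deriv X g g'"
  unfolding ac_deriv_def
proof (intro allI impI conjI)
  fix a b assume ab: "X \<le> a" "a \<le> b"
  have "f' absolutely_integrable_on {a..b}" using assms ab by (simp add: ac_deriv_def)
  then show "g' absolutely_integrable_on {a..b}"
    by (rule set_integrable_cong[THEN iffD1, rotated -1]) (use ab assms in auto)
  have "(f' has_integral g b - g a) {a..b}"
    using ac_deriv_has_integral[OF assms(1) ab] assms(2)[of a] assms(2)[of b] ab by simp
  then show "(g' has_integral g b - g a) {a..b}"
    by (rule has_integral_eq[rotated]) (use ab assms in auto)
qed

lemma ac_deriv_add:
  assumes "ac_deriv X f f'" "ac_deriv X g g'"
  shows "ac_deriv X (\<lambda>x. f x + g x) (\<lambda>x. f' x + g' x)"
  using assms unfolding ac_deriv_def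
  by (auto simp: add_diff_add intro: has_integral_add set_integral_add)

lemma ac_deriv_minus:
  assumes "ac_deriv X f f'"
  shows "ac_deriv X (\<lambda>x. - f x) (\<lambda>x. - f' x)"
  unfolding ac_deriv_def
proof (intro allI impI conjI)
  fix a b assume ab: "X \<le> a" "a \<le> b"
  show "(\<lambda>x. - f' x) absolutely_integrable_on {a..b}"
    using assms ab absolutely_integrable_scaleR_left[where f=f' and c="-1"] by (auto simp: ac_deriv_def)
  have "((\<lambda>x. - f' x) has_integral - (f b - f a)) {a..b}"
    using assms ab by (intro has_integral_neg) (auto simp: ac_deriv_def)
  then show "((\<lambda>x. - f' x) has_integral - f b - - f a) {a..b}"
    by simp
qed

lemma ac_deriv_diff:
  assumes "ac_deriv X f f'" "ac_deriv X g g'"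
  shows "ac_deriv X (\<lambda>x. f x - g x) (\<lambda>x. f' x - g' x)"
  using ac_deriv_add[OF assms(1) ac_deriv_minus[OF assms(2)]] by simp

lemma ac_deriv_const: "ac_deriv X (\<lambda>x. c) (\<lambda>x. 0)"
  by (auto simp: ac_deriv_def)

lemma ac_deriv_of_real:
  assumes "ac_deriv X f f'"
  shows "ac_deriv X (\<lambda>x. complex_of_real (f x)) (\<lambda>x. complex_of_real (f' x))"
  unfolding ac_deriv_def
proof (intro allI impI conjI)
  fix a b assume ab: "X \<le> a" "a \<le> b"
  have "f' absolutely_integrable_on {a..b}" using assms ab by (simp add: ac_deriv_def)
  from absolutely_integrable_linear[OF this bounded_linear_of_real]
  show "(\<lambda>x. complex_of_real (f' x)) absolutely_integrable_on {a..b}" by (simp add: o_def)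
  show "((\<lambda>x. complex_of_real (f' x)) has_integral complex_of_real (f b) - complex_of_real (f a)) {a..b}"
    using has_integral_linear[OF ac_deriv_has_integral[OF assms ab] bounded_linear_of_real]
    by (simp add: o_def)
qed

lemma ac_deriv_C1:
  assumes "\<And>x. X \<le> x \<Longrightarrow> (f has_vector_derivative f' x) (at x within {X..})"
    and "continuous_on {X..} f'"
  shows "ac_deriv X f f'"
  unfolding ac_deriv_def
proof (intro allI impI conjI)
  fix a b assume ab: "X \<le> a" "a \<le> b"
  show "f' absolutely_integrable_on {a..b}"
    by (rule absolutely_integrable_continuous_real) (use assms ab in \<open>auto intro: continuous_on_subset\<close>)
  show "(f' has_integral f b - f a) {a..b}"
    by (rule fundamental_theorem_of_calculus)
      (use ab in \<open>auto intro!: has_vector_derivative_within_subset[OF assms(1), of _ "{a..b}"]\<close>)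
qed

lemma ac_deriv_imp_vector_derivative:
  assumes "ac_deriv X f f'" "continuous_on {X..} f'" "X \<le> x"
  shows "(f has_vector_derivative f' x) (at x within {X..})"
proof -
  have "continuous_on {X..x+1} f'" using assms(2) by (rule continuous_on_subset) auto
  then have "((\<lambda>u. integral {X..u} f') has_vector_derivative f' x) (at x within {X..x+1})"
    by (rule integral_has_vector_derivative) (use assms in auto)
  then have "((\<lambda>u. f X + integral {X..u} f') has_vector_derivative f' x) (at x within {X..x+1})"
    using has_vector_derivative_add[OF has_vector_derivative_const, of _ "f' x" _ "f X"] by simp
  then have "(f has_vector_derivative f' x) (at x within {X..x+1})"
    by (rule has_vector_derivative_transform[rotated 2])
      (use assms in \<open>auto simp: ac_deriv_integral\<close>)
  then show ?thesis
    using at_within_atLeast_Icc[of x "x+1" X] by simp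
qed

text \<open>The local error estimate, relative to an integrable density, is additive over adjacent
  intervals, so bisection makes it global; letting \<open>e\<close> tend to 0 removes the error.\<close>

lemma ac_deriv_local:
  fixes F g :: "real \<Rightarrow> 'a::euclidean_space" and \<rho> :: "real \<Rightarrow> real"
  assumes g: "\<And>a b. X \<le> a \<Longrightarrow> g absolutely_integrable_on {a..b}"
    and \<rho>: "\<And>a b. X \<le> a \<Longrightarrow> \<rho> integrable_on {a..b}" "\<And>x. X \<le> x \<Longrightarrow> 0 \<le> \<rho> x"
    and loc: "\<And>x e. X \<le> x \<Longrightarrow> 0 < e \<Longrightarrow> \<exists>d>0. \<forall>a b. X \<le> a \<and> a \<le> x \<and> x \<le> b \<and> b - a < d \<longrightarrow>
        norm (F b - F a - integral {a..b} g) \<le> e * integral {a..b} \<rho>"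
  shows "ac_deriv X F g"
proof -
  have "F b - F a = integral {a..b} g" if ab: "X \<le> a" "a \<le> b" for a b
  proof -
    have gi: "g integrable_on {s..t}" if "X \<le> s" for s t
      using g[OF that] absolutely_integrable_on_def by blast
    have *: "norm (F b - F a - integral {a..b} g) \<le> e * integral {a..b} \<rho>" if "0 < e" for e
    proof -
      have "X \<le> a \<longrightarrow> norm (F b - F a - integral {a..b} g) \<le> e * integral {a..b} \<rho>"
      proof (rule Bolzano[OF ab(2)])
        fix a b c
        assume P: "X \<le> a \<longrightarrow> norm (F b - F a - integral {a..b} g) \<le> e * integral {a..b} \<rho>"
          "X \<le> b \<longrightarrow> norm (F c - F b - integral {b..c} g) \<le> e * integral {b..c} \<rho>"
          and o: "a \<le> b" "b \<le> c"
        show "X \<le> a \<longrightarrow> norm (F c - F a - integral {a..c} g) \<le> e * integral {a..c} \<rho>"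
        proof
          assume "X \<le> a"
          have 1: "integral {a..b} g + integral {b..c} g = integral {a..c} g"
            by (rule Henstock_Kurzweil_Integration.integral_combine) (use o gi \<open>X \<le> a\<close> in auto)
          have 2: "integral {a..b} \<rho> + integral {b..c} \<rho> = integral {a..c} \<rho>"
            by (rule Henstock_Kurzweil_Integration.integral_combine) (use o \<rho> \<open>X \<le> a\<close> in auto)
          have "norm (F c - F a - integral {a..c} g)
              = norm ((F b - F a - integral {a..b} g) + (F c - F b - integral {b..c} g))"
            using 1 by (simp add: algebra_simps)
          also have "\<dots> \<le> norm (F b - F a - integral {a..b} g) + norm (F c - F b - integral {b..c} g)"
            by (rule norm_triangle_ineq)
          also have "\<dots> \<le> e * integral {a..b} \<rho> + e * integral {b..c} \<rho>"
            using P \<open>X \<le> a\<close> o by (intro add_mono) auto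
          finally show "norm (F c - F a - integral {a..c} g) \<le> e * integral {a..c} \<rho>"
            using 2 by (simp flip: distrib_left)
        qed
      next
        fix x assume "a \<le> x" "x \<le> b"
        then show "\<exists>d>0. \<forall>a b. a \<le> x \<and> x \<le> b \<and> b - a < d \<longrightarrow>
          X \<le> a \<longrightarrow> norm (F b - F a - integral {a..b} g) \<le> e * integral {a..b} \<rho>"
          using loc[of x e] ab \<open>0 < e\<close> by fastforce
      qed
      then show ?thesis using ab by simp
    qed
    have "norm (F b - F a - integral {a..b} g) \<le> 0"
    proof (rule field_le_epsilon)
      fix e :: real assume "0 < e"
      have nn: "0 \<le> integral {a..b} \<rho>"
        by (rule Henstock_Kurzweil_Integration.integral_nonneg) (use \<rho> ab in auto)
      have "norm (F b - F a - integral {a..b} g) \<le> e / (1 + integral {a..b} \<rho>) * integral {a..b} \<rho>"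
        using *[of "e / (1 + integral {a..b} \<rho>)"] \<open>0 < e\<close> nn by simp
      also have "\<dots> \<le> e"
        using \<open>0 < e\<close> nn by (simp add: field_simps)
      finally show "norm (F b - F a - integral {a..b} g) \<le> 0 + e" by simp
    qed
    then show ?thesis by simp
  qed
  then show ?thesis
    unfolding ac_deriv_def using g absolutely_integrable_on_def
    by (metis integrable_integral)
qed

lemma absolutely_integrable_mult_continuous:
  fixes f g :: "real \<Rightarrow> 'a::{euclidean_space,real_normed_field}"
  assumes "continuous_on {a..b} f" "g absolutely_integrable_on {a..b}"
  shows "(\<lambda>x. f x * g x) absolutely_integrable_on {a..b}"
proof (rule absolutely_integrable_bounded_measurable_product[of "(*)"])
  show "bilinear ((*) :: 'a \<Rightarrow> 'a \<Rightarrow> 'a)"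
    by (rule bilinear_times)
  show "bounded (f ` {a..b})"
    using assms(1) compact_continuous_image compact_imp_bounded by blast
qed (use assms in \<open>auto intro: continuous_imp_measurable_on_sets_lebesgue\<close>)

lemma continuous_on_atLeast_small:
  fixes f :: "real \<Rightarrow> 'a::real_normed_vector"
  assumes "continuous_on {X..} f" "X \<le> x" "0 < e"
  obtains d where "d > 0" "\<And>s t. X \<le> s \<Longrightarrow> X \<le> t \<Longrightarrow> \<bar>s - x\<bar> < d \<Longrightarrow> \<bar>t - x\<bar> < d \<Longrightarrow> norm (f s - f t) \<le> e"
proof -
  from assms obtain d where d: "d > 0" "\<And>s. X \<le> s \<Longrightarrow> dist s x < d \<Longrightarrow> dist (f s) (f x) < e/2"
    unfolding continuous_on_iff by (metis atLeast_iff half_gt_zero)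
  show ?thesis
  proof (rule that[OF d(1)])
    fix s t assume "X \<le> s" "X \<le> t" "\<bar>s - x\<bar> < d" "\<bar>t - x\<bar> < d"
    then have "dist (f s) (f x) < e/2" "dist (f t) (f x) < e/2"
      using d(2) by (auto simp: dist_real_def)
    then show "norm (f s - f t) \<le> e"
      using dist_triangle2[of "f s" "f t" "f x"] by (simp add: dist_norm)
  qed
qed

text \<open>On a short interval the error of the product rule is exactly the integral of
  \<open>f' t * (g b - g t) + (f a - f t) * g' t\<close>, and continuity makes both differences at
  most \<open>e\<close>; double integrals do not occur.\<close>

lemma ac_deriv_mult:
  fixes f g :: "real \<Rightarrow> 'a::{euclidean_space,real_normed_field}"
  assumes f: "ac_deriv X f f'" and g: "ac_deriv X g g'"
  shows "ac_deriv X (\<lambda>x. f x * g x) (\<lambda>x. f' x * g x + f x * g' x)"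
proof (rule ac_deriv_local[where \<rho> = "\<lambda>x. norm (f' x) + norm (g' x)"])
  have cont: "continuous_on {a..b} f" "continuous_on {a..b} g" if "X \<le> a" for a b
    using ac_deriv_continuous[OF f] ac_deriv_continuous[OF g] that
    by (auto intro: continuous_on_subset)
  have fa: "f' absolutely_integrable_on {a..b}" "g' absolutely_integrable_on {a..b}" if "X \<le> a" for a b
    using f g that by (auto intro: ac_deriv_abs)
  have 1: "(\<lambda>x. f' x * g x) absolutely_integrable_on {a..b}" if "X \<le> a" for a b
    using absolutely_integrable_mult_continuous[OF cont(2) fa(1)] that by (simp add: mult.commute)
  have 2: "(\<lambda>x. f x * g' x) absolutely_integrable_on {a..b}" if "X \<le> a" for a b
    using absolutely_integrable_mult_continuous[OF cont(1) fa(2)] that by simp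
  show "(\<lambda>x. f' x * g x + f x * g' x) absolutely_integrable_on {a..b}" if "X \<le> a" for a b
    using 1 2 that by (intro set_integral_add) auto
  have n: "(\<lambda>x. norm (f' x)) integrable_on {a..b}" "(\<lambda>x. norm (g' x)) integrable_on {a..b}" if "X \<le> a" for a b
    using fa[OF that] by (auto simp: absolutely_integrable_on_def)
  show "(\<lambda>x. norm (f' x) + norm (g' x)) integrable_on {a..b}" if "X \<le> a" for a b
    using n that by (intro integrable_add) auto
  fix x e :: real assume x: "X \<le> x" "0 < e"
  obtain d1 where d1: "d1 > 0"
    "\<And>s t. X \<le> s \<Longrightarrow> X \<le> t \<Longrightarrow> \<bar>s - x\<bar> < d1 \<Longrightarrow> \<bar>t - x\<bar> < d1 \<Longrightarrow> norm (f s - f t) \<le> e"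
    using continuous_on_atLeast_small[OF ac_deriv_continuous[OF f] x] by blast
  obtain d2 where d2: "d2 > 0"
    "\<And>s t. X \<le> s \<Longrightarrow> X \<le> t \<Longrightarrow> \<bar>s - x\<bar> < d2 \<Longrightarrow> \<bar>t - x\<bar> < d2 \<Longrightarrow> norm (g s - g t) \<le> e"
    using continuous_on_atLeast_small[OF ac_deriv_continuous[OF g] x] by blast
  show "\<exists>d>0. \<forall>a b. X \<le> a \<and> a \<le> x \<and> x \<le> b \<and> b - a < d \<longrightarrow>
     norm (f b * g b - f a * g a - integral {a..b} (\<lambda>x. f' x * g x + f x * g' x))
       \<le> e * integral {a..b} (\<lambda>x. norm (f' x) + norm (g' x))"
  proof (intro exI[of _ "min d1 d2"] conjI allI impI)
    fix a b assume ab: "X \<le> a \<and> a \<le> x \<and> x \<le> b \<and> b - a < min d1 d2"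
    have X: "X \<le> a" "a \<le> b" using ab by auto
    have "((\<lambda>t. f' t * g b - f' t * g t + (f a * g' t - f t * g' t)) has_integral
        (f b - f a) * g b - integral {a..b} (\<lambda>x. f' x * g x)
        + (f a * (g b - g a) - integral {a..b} (\<lambda>x. f x * g' x))) {a..b}"
      using 1[OF X(1), of b] 2[OF X(1), of b]
      by (intro has_integral_add has_integral_diff has_integral_mult_left has_integral_mult_right
            ac_deriv_has_integral[OF f] ac_deriv_has_integral[OF g] integrable_integral X)
        (auto simp: absolutely_integrable_on_def)
    moreover have "integral {a..b} (\<lambda>x. f' x * g x + f x * g' x)
       = integral {a..b} (\<lambda>x. f' x * g x) + integral {a..b} (\<lambda>x. f x * g' x)"
      using 1[OF X(1), of b] 2[OF X(1), of b]
      by (intro Henstock_Kurzweil_Integration.integral_add) (auto simp: absolutely_integrable_on_def)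
    ultimately have *: "((\<lambda>t. f' t * (g b - g t) + (f a - f t) * g' t) has_integral
        f b * g b - f a * g a - integral {a..b} (\<lambda>x. f' x * g x + f x * g' x)) {a..b}"
      by (simp add: algebra_simps)
    have "norm (integral {a..b} (\<lambda>t. f' t * (g b - g t) + (f a - f t) * g' t))
       \<le> integral {a..b} (\<lambda>t. e * (norm (f' t) + norm (g' t)))"
    proof (rule Henstock_Kurzweil_Integration.integral_norm_bound_integral)
      show "(\<lambda>t. f' t * (g b - g t) + (f a - f t) * g' t) integrable_on {a..b}"
        using * by blast
      show "(\<lambda>t. e * (norm (f' t) + norm (g' t))) integrable_on {a..b}"
        using n[OF X(1)] by (intro integrable_on_mult_right integrable_add)
      fix t assume t: "t \<in> {a..b}"
      have "norm (f' t * (g b - g t) + (f a - f t) * g' t)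
         \<le> norm (f' t) * norm (g b - g t) + norm (f a - f t) * norm (g' t)"
        by (metis norm_mult norm_triangle_ineq)
      also have "\<dots> \<le> norm (f' t) * e + e * norm (g' t)"
        using t ab X by (intro add_mono mult_left_mono mult_right_mono d1(2) d2(2)) auto
      finally show "norm (f' t * (g b - g t) + (f a - f t) * g' t) \<le> e * (norm (f' t) + norm (g' t))"
        by (simp add: algebra_simps)
    qed
    then show "norm (f b * g b - f a * g a - integral {a..b} (\<lambda>x. f' x * g x + f x * g' x))
       \<le> e * integral {a..b} (\<lambda>x. norm (f' x) + norm (g' x))"
      using integral_unique[OF *] by simp
  qed (use d1 d2 in auto)
qed auto

text \<open>A chain rule phrased through difference quotients: it covers both the reciprocal
  and the square root without complex differentiation.\<close>

lemma ac_deriv_chain: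
  fixes f F \<phi> :: "real \<Rightarrow> 'a::{euclidean_space,real_normed_field}"
  assumes f: "ac_deriv X f f'" and \<phi>: "continuous_on {X..} \<phi>"
    and k: "\<And>x e. X \<le> x \<Longrightarrow> 0 < e \<Longrightarrow> \<exists>d>0. \<forall>a b. X \<le> a \<and> a \<le> x \<and> x \<le> b \<and> b - a < d \<longrightarrow>
        F b - F a = k a b * (f b - f a) \<and> norm (k a b - \<phi> x) \<le> e"
  shows "ac_deriv X F (\<lambda>x. \<phi> x * f' x)"
proof (rule ac_deriv_local[where \<rho> = "\<lambda>x. norm (f' x)"])
  have cont: "continuous_on {a..b} \<phi>" if "X \<le> a" for a b
    using \<phi> by (rule continuous_on_subset) (use that in auto)
  show 1: "(\<lambda>x. \<phi> x * f' x) absolutely_integrable_on {a..b}" if "X \<le> a" for a b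
    using absolutely_integrable_mult_continuous[OF cont ac_deriv_abs[OF f]] that by simp
  show n: "(\<lambda>x. norm (f' x)) integrable_on {a..b}" if "X \<le> a" for a b
    using ac_deriv_abs[OF f that] by (auto simp: absolutely_integrable_on_def)
  fix x e :: real assume x: "X \<le> x" "0 < e"
  then have e2: "e/2 > 0" by simp
  obtain d1 where d1: "d1 > 0"
    "\<And>s t. X \<le> s \<Longrightarrow> X \<le> t \<Longrightarrow> \<bar>s - x\<bar> < d1 \<Longrightarrow> \<bar>t - x\<bar> < d1 \<Longrightarrow> norm (\<phi> s - \<phi> t) \<le> e/2"
    using continuous_on_atLeast_small[OF \<phi> x(1) e2] by blast
  obtain d2 where d2: "d2 > 0" "\<And>a b. X \<le> a \<and> a \<le> x \<and> x \<le> b \<and> b - a < d2 \<Longrightarrow>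
        F b - F a = k a b * (f b - f a) \<and> norm (k a b - \<phi> x) \<le> e/2"
    using k[OF x(1) e2] by metis
  show "\<exists>d>0. \<forall>a b. X \<le> a \<and> a \<le> x \<and> x \<le> b \<and> b - a < d \<longrightarrow>
     norm (F b - F a - integral {a..b} (\<lambda>x. \<phi> x * f' x)) \<le> e * integral {a..b} (\<lambda>x. norm (f' x))"
  proof (intro exI[of _ "min d1 d2"] conjI allI impI)
    fix a b assume ab: "X \<le> a \<and> a \<le> x \<and> x \<le> b \<and> b - a < min d1 d2"
    have X: "X \<le> a" "a \<le> b" using ab by auto
    have ka: "F b - F a = k a b * (f b - f a)" "norm (k a b - \<phi> x) \<le> e/2" using d2(2)[of a b] ab by auto
    have "((\<lambda>t. k a b * f' t - \<phi> t * f' t) has_integral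
        k a b * (f b - f a) - integral {a..b} (\<lambda>x. \<phi> x * f' x)) {a..b}"
      using 1[OF X(1), of b]
      by (intro has_integral_diff has_integral_mult_right
            ac_deriv_has_integral[OF f] integrable_integral X)
        (auto simp: absolutely_integrable_on_def)
    then have *: "((\<lambda>t. (k a b - \<phi> t) * f' t) has_integral
        F b - F a - integral {a..b} (\<lambda>x. \<phi> x * f' x)) {a..b}"
      by (simp add: algebra_simps ka)
    have "norm (integral {a..b} (\<lambda>t. (k a b - \<phi> t) * f' t))
       \<le> integral {a..b} (\<lambda>t. e * norm (f' t))"
    proof (rule Henstock_Kurzweil_Integration.integral_norm_bound_integral)
      show "(\<lambda>t. (k a b - \<phi> t) * f' t) integrable_on {a..b}"
        using * by blast
      show "(\<lambda>t. e * norm (f' t)) integrable_on {a..b}"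
        using n[OF X(1)] by (intro integrable_on_mult_right)
      fix t assume t: "t \<in> {a..b}"
      have "norm (\<phi> x - \<phi> t) \<le> e/2"
        using t ab X by (intro d1(2)) auto
      then have "norm (k a b - \<phi> t) \<le> e"
        using ka(2) norm_triangle_ineq[of "k a b - \<phi> x" "\<phi> x - \<phi> t"] by simp
      then show "norm ((k a b - \<phi> t) * f' t) \<le> e * norm (f' t)"
        by (simp add: norm_mult mult_right_mono)
    qed
    then show "norm (F b - F a - integral {a..b} (\<lambda>x. \<phi> x * f' x)) \<le> e * integral {a..b} (\<lambda>x. norm (f' x))"
      using integral_unique[OF *] by simp
  qed (use d1 d2 in auto)
qed auto

text \<open>In the applications of \<open>ac_deriv_chain\<close> the difference quotient of the
  outer function is a function \<open>H\<close> of the two endpoint values; continuity of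
  \<open>H\<close> on the diagonal yields its limit at \<open>x\<close>.\<close>

lemma continuous_two_point:
  fixes f :: "real \<Rightarrow> 'a::real_normed_field" and H :: "'a \<times> 'a \<Rightarrow> 'a"
  assumes f: "continuous_on {X..} f" and x: "X \<le> x" and H: "isCont H (f x, f x)" and e: "0 < e"
  shows "\<exists>d>0. \<forall>a b. X \<le> a \<and> a \<le> x \<and> x \<le> b \<and> b - a < d \<longrightarrow> norm (H (f a, f b) - H (f x, f x)) \<le> e"
proof -
  obtain \<eta> where \<eta>: "\<eta> > 0" "\<And>y. dist y (f x, f x) < \<eta> \<Longrightarrow> dist (H y) (H (f x, f x)) < e"
    using H e unfolding continuous_at by (metis continuous_at_eps_delta H)
  obtain d where d: "d > 0" "\<And>s. X \<le> s \<Longrightarrow> dist s x < d \<Longrightarrow> dist (f s) (f x) < \<eta>/2"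
    using f x \<eta>(1) unfolding continuous_on_iff by (metis atLeast_iff half_gt_zero)
  show ?thesis
  proof (intro exI[of _ d] conjI allI impI)
    fix a b assume ab: "X \<le> a \<and> a \<le> x \<and> x \<le> b \<and> b - a < d"
    have "dist (f a) (f x) < \<eta>/2" "dist (f b) (f x) < \<eta>/2"
      using ab by (intro d(2); simp add: dist_real_def)+
    moreover have "dist (f a, f b) (f x, f x) \<le> dist (f a) (f x) + dist (f b) (f x)"
      by (simp add: dist_Pair_Pair sqrt_sum_squares_le_sum)
    ultimately have "dist (f a, f b) (f x, f x) < \<eta>" by simp
    then show "norm (H (f a, f b) - H (f x, f x)) \<le> e"
      using \<eta>(2) by (auto simp: dist_norm intro: less_imp_le)
  qed (use d in auto)
qed

lemma ac_deriv_inverse: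
  fixes f :: "real \<Rightarrow> 'a::{euclidean_space,real_normed_field}"
  assumes f: "ac_deriv X f f'" and nz: "\<And>x. X \<le> x \<Longrightarrow> f x \<noteq> 0"
  shows "ac_deriv X (\<lambda>x. inverse (f x)) (\<lambda>x. - inverse ((f x)\<^sup>2) * f' x)"
proof (rule ac_deriv_chain[OF f, where k = "\<lambda>a b. - inverse (f a * f b)"])
  note c = ac_deriv_continuous[OF f]
  show "continuous_on {X..} (\<lambda>x. - inverse ((f x)\<^sup>2))"
    using nz by (intro continuous_intros c) auto
  fix x e :: real assume x: "X \<le> x" "0 < e"
  have "isCont (\<lambda>y. - inverse (fst y * snd y)) (f x, f x)"
    using nz[OF x(1)] by (intro continuous_intros) auto
  from continuous_two_point[OF c x(1) this x(2)] obtain d where d: "d > 0"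
    "\<And>a b. X \<le> a \<and> a \<le> x \<and> x \<le> b \<and> b - a < d \<Longrightarrow> norm (- inverse (f a * f b) - - inverse (f x * f x)) \<le> e"
    by auto
  show "\<exists>d>0. \<forall>a b. X \<le> a \<and> a \<le> x \<and> x \<le> b \<and> b - a < d \<longrightarrow>
      inverse (f b) - inverse (f a) = - inverse (f a * f b) * (f b - f a) \<and>
      norm (- inverse (f a * f b) - - inverse ((f x)\<^sup>2)) \<le> e"
  proof (intro exI[of _ d] conjI allI impI)
    fix a b assume ab: "X \<le> a \<and> a \<le> x \<and> x \<le> b \<and> b - a < d"
    then show "inverse (f b) - inverse (f a) = - inverse (f a * f b) * (f b - f a)"
      using nz[of a] nz[of b] by (auto simp: field_simps)
    show "norm (- inverse (f a * f b) - - inverse ((f x)\<^sup>2)) \<le> e"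
      using d(2)[OF ab] by (simp add: power2_eq_square)
  qed (use d in auto)
qed

text \<open>The square does not determine the branch; continuity of \<open>h\<close> fixes it, and
  the difference quotient is 1 / (h a + h b). The intended \<open>h\<close> is p omega, whose square
  p (q - z) is visibly absolutely continuous.\<close>

lemma ac_deriv_sqrt:
  fixes h :: "real \<Rightarrow> 'a::{euclidean_space,real_normed_field}"
  assumes f: "ac_deriv X (\<lambda>x. (h x)\<^sup>2) f'" and c: "continuous_on {X..} h"
    and nz: "\<And>x. X \<le> x \<Longrightarrow> h x \<noteq> 0"
  shows "ac_deriv X h (\<lambda>x. inverse (2 * h x) * f' x)"
proof (rule ac_deriv_chain[OF f, where k = "\<lambda>a b. inverse (h a + h b)"])
  show "continuous_on {X..} (\<lambda>x. inverse (2 * h x))"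
    using nz by (intro continuous_intros c) auto
  fix x e :: real assume x: "X \<le> x" "0 < e"
  have x2: "h x + h x \<noteq> 0" using nz[OF x(1)] by (metis mult_2 mult_eq_0_iff zero_neq_numeral)
  have "isCont (\<lambda>y. inverse (fst y + snd y)) (h x, h x)"
    using x2 by (intro continuous_intros) auto
  from continuous_two_point[OF c x(1) this x(2)] obtain d where d: "d > 0"
    "\<And>a b. X \<le> a \<and> a \<le> x \<and> x \<le> b \<and> b - a < d \<Longrightarrow> norm (inverse (h a + h b) - inverse (h x + h x)) \<le> e"
    by auto
  have "isCont (\<lambda>y. fst y + snd y) (h x, h x)"
    by (intro continuous_intros)
  \<comment> \<open>Staying within half the modulus of the nonzero limit \<open>h x + h x\<close>
    keeps \<open>h a + h b\<close> away from 0: the two roots cannot have opposite signs.\<close>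
  from continuous_two_point[OF c x(1) this, of "norm (h x + h x) / 2"] x2 obtain d' where d': "d' > 0"
    "\<And>a b. X \<le> a \<and> a \<le> x \<and> x \<le> b \<and> b - a < d' \<Longrightarrow> norm ((h a + h b) - (h x + h x)) \<le> norm (h x + h x) / 2"
    by auto
  show "\<exists>d>0. \<forall>a b. X \<le> a \<and> a \<le> x \<and> x \<le> b \<and> b - a < d \<longrightarrow>
      h b - h a = inverse (h a + h b) * ((h b)\<^sup>2 - (h a)\<^sup>2) \<and>
      norm (inverse (h a + h b) - inverse (2 * h x)) \<le> e"
  proof (intro exI[of _ "min d d'"] conjI allI impI)
    fix a b assume ab: "X \<le> a \<and> a \<le> x \<and> x \<le> b \<and> b - a < min d d'"
    have "h a + h b \<noteq> 0"
      using d'(2)[of a b] ab x2 by (auto simp: norm_minus_commute)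
    then show "h b - h a = inverse (h a + h b) * ((h b)\<^sup>2 - (h a)\<^sup>2)"
      by (simp add: field_simps power2_eq_square)
    show "norm (inverse (h a + h b) - inverse (2 * h x)) \<le> e"
      unfolding mult_2 using d(2)[of a b] ab by linarith
  qed (use d d' in auto)
qed

section \<open>Volterra equations depending on a complex parameter\<close>

text \<open>On a piece \<open>D\<close> of a closed half-plane this is analyticity off the cut together with continuity
  up to it.\<close>

definition regular_on :: "complex set \<Rightarrow> (complex \<Rightarrow> complex) \<Rightarrow> bool" where
  "regular_on D f \<longleftrightarrow> continuous_on D f \<and> f holomorphic_on interior D"

lemma regular_on_const: "regular_on D (\<lambda>z. c)"
  by (simp add: regular_on_def)

lemma regular_on_ident: "regular_on D (\<lambda>z. z)"
  by (simp add: regular_on_def)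

lemma regular_on_add: "regular_on D f \<Longrightarrow> regular_on D g \<Longrightarrow> regular_on D (\<lambda>z. f z + g z)"
  by (auto simp: regular_on_def intro!: continuous_intros holomorphic_intros)

lemma regular_on_minus: "regular_on D f \<Longrightarrow> regular_on D (\<lambda>z. - f z)"
  by (auto simp: regular_on_def intro!: continuous_intros holomorphic_intros)

lemma regular_on_diff: "regular_on D f \<Longrightarrow> regular_on D g \<Longrightarrow> regular_on D (\<lambda>z. f z - g z)"
  by (auto simp: regular_on_def intro!: continuous_intros holomorphic_intros)

lemma regular_on_mult: "regular_on D f \<Longrightarrow> regular_on D g \<Longrightarrow> regular_on D (\<lambda>z. f z * g z)"
  by (auto simp: regular_on_def intro!: continuous_intros holomorphic_intros)

lemma regular_on_power: "regular_on D f \<Longrightarrow> regular_on D (\<lambda>z. f z ^ n)"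
  by (auto simp: regular_on_def intro!: continuous_intros holomorphic_intros)

lemma regular_on_exp: "regular_on D f \<Longrightarrow> regular_on D (\<lambda>z. exp (f z))"
  by (auto simp: regular_on_def intro!: continuous_intros holomorphic_intros)

lemma regular_on_inverse:
  assumes "regular_on D f" "\<And>z. z \<in> D \<Longrightarrow> f z \<noteq> 0"
  shows "regular_on D (\<lambda>z. inverse (f z))"
proof -
  have "\<And>z. z \<in> interior D \<Longrightarrow> f z \<noteq> 0" using assms(2) interior_subset by blast
  then show ?thesis
    using assms by (auto simp: regular_on_def intro!: continuous_intros holomorphic_intros)
qed

lemma regular_on_cong:
  assumes "regular_on D f" "\<And>z. z \<in> D \<Longrightarrow> f z = g z"
  shows "regular_on D g"
  unfolding regular_on_def
proof
  show "continuous_on D g" using assms by (auto simp: regular_on_def intro: continuous_on_eq)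
  show "g holomorphic_on interior D"
    by (rule holomorphic_transform[of f]) (use assms interior_subset in \<open>auto simp: regular_on_def\<close>)
qed

text \<open>Continuity is dominated convergence. For holomorphy the same majorant suffices: Cauchy's
  inequality turns the bound \<open>M y\<close> near \<open>z0\<close> into the bound
  \<open>M y / r\<close> on the derivative, hence on the difference quotients.\<close>

lemma regular_on_integral:
  fixes f :: "complex \<Rightarrow> real \<Rightarrow> complex"
  assumes f: "\<And>z. z \<in> D \<Longrightarrow> f z integrable_on S"
    and M: "M integrable_on S" "\<And>z y. z \<in> D \<Longrightarrow> y \<in> S \<Longrightarrow> norm (f z y) \<le> M y"
    and reg: "\<And>y. y \<in> S \<Longrightarrow> regular_on D (\<lambda>z. f z y)"
  shows "regular_on D (\<lambda>z. integral S (f z))"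
  unfolding regular_on_def
proof
  show "continuous_on D (\<lambda>z. integral S (f z))"
    unfolding continuous_on_sequentially
  proof (intro allI ballI impI, elim conjE)
    fix x a assume a: "a \<in> D" and x: "\<forall>n. x n \<in> D" "x \<longlonglongrightarrow> a"
    have "(\<lambda>k. integral S (f (x k))) \<longlonglongrightarrow> integral S (f a)"
    proof (rule dominated_convergence(2)[OF _ M(1)])
      fix y assume "y \<in> S"
      then have "continuous_on D (\<lambda>z. f z y)" using reg by (auto simp: regular_on_def)
      then show "(\<lambda>k. f (x k) y) \<longlonglongrightarrow> f a y"
        using a x unfolding continuous_on_sequentially by (auto simp: o_def)
    qed (use f M x in auto)
    then show "((\<lambda>z. integral S (f z)) \<circ> x) \<longlonglongrightarrow> integral S (f a)" by (simp add: o_def)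
  qed
  show "(\<lambda>z. integral S (f z)) holomorphic_on interior D"
  proof (rule holomorphic_onI)
    fix z0 assume "z0 \<in> interior D"
    then obtain R where R: "R > 0" "cball z0 R \<subseteq> interior D"
      using open_contains_cball by blast
    define r where "r = R/2"
    have r: "r > 0" using R by (simp add: r_def)
    have sub: "cball w r \<subseteq> interior D" if "w \<in> ball z0 r" for w
    proof -
      have "cball w r \<subseteq> cball z0 R"
        using that by (intro cball_subset_cball_iff[THEN iffD2]) (auto simp: r_def dist_commute)
      then show ?thesis using R by auto
    qed
    have iD: "interior D \<subseteq> D" by (rule interior_subset)
    have z0: "z0 \<in> ball z0 r" using r by simp
    have bD: "ball z0 r \<subseteq> interior D"
      using sub[OF z0] ball_subset_cball by blast
    have holo: "(\<lambda>z. f z y) holomorphic_on interior D" if "y \<in> S" for y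
      using reg[OF that] by (simp add: regular_on_def)
    have db: "norm (deriv (\<lambda>z. f z y) w) \<le> M y / r" if "y \<in> S" "w \<in> ball z0 r" for y w
    proof -
      have "norm ((deriv ^^ 1) (\<lambda>z. f z y) w) \<le> fact 1 * M y / r ^ 1"
      proof (rule Cauchy_inequality)
        show "(\<lambda>z. f z y) holomorphic_on ball w r"
          using holo[OF that(1)] sub[OF that(2)] ball_subset_cball by (meson holomorphic_on_subset subset_trans)
        show "continuous_on (cball w r) (\<lambda>z. f z y)"
          using holo[OF that(1)] sub[OF that(2)] by (meson holomorphic_on_imp_continuous_on holomorphic_on_subset)
        fix x assume "norm (w - x) = r"
        then have "x \<in> cball w r" by (simp add: dist_norm)
        then show "norm (f x y) \<le> M y"
          using sub[OF that(2)] iD M(2) that(1) by blast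
      qed (use r in auto)
      then show ?thesis by simp
    qed
    have lip: "norm (f w y - f z0 y) \<le> M y / r * norm (w - z0)" if "y \<in> S" "w \<in> ball z0 r" for y w
    proof (rule field_differentiable_bound[of "ball z0 r" "\<lambda>z. f z y" "deriv (\<lambda>z. f z y)"])
      fix z assume z: "z \<in> ball z0 r"
      have "((\<lambda>z. f z y) has_field_derivative deriv (\<lambda>z. f z y) z) (at z)"
        by (rule holomorphic_derivI[OF holo[OF that(1)]]) (use z bD in auto)
      then show "((\<lambda>z. f z y) has_field_derivative deriv (\<lambda>z. f z y) z) (at z within ball z0 r)"
        by (rule has_field_derivative_at_within)
    qed (use db that z0 in auto)
    have "((\<lambda>w. (integral S (f w) - integral S (f z0)) / (w - z0)) \<longlongrightarrow>
         integral S (\<lambda>y. deriv (\<lambda>z. f z y) z0)) (at z0 within ball z0 r)"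
      unfolding tendsto_at_iff_sequentially
    proof (intro allI impI)
      fix x assume x: "\<forall>i. x i \<in> ball z0 r - {z0}" "x \<longlonglongrightarrow> z0"
      have xD: "x i \<in> D" "z0 \<in> D" for i using x(1) bD iD z0 by blast+
      have "(\<lambda>k. integral S (\<lambda>y. (f (x k) y - f z0 y) / (x k - z0))) \<longlonglongrightarrow>
        integral S (\<lambda>y. deriv (\<lambda>z. f z y) z0)"
      proof (rule dominated_convergence(2)[where h = "\<lambda>y. M y / r"])
        show "(\<lambda>y. (f (x k) y - f z0 y) / (x k - z0)) integrable_on S" for k
          using f xD by (intro integrable_on_divide integrable_diff) auto
        show "(\<lambda>y. M y / r) integrable_on S" using M(1) by (rule integrable_on_divide)
        fix k y assume "y \<in> S"
        then have "norm (f (x k) y - f z0 y) \<le> M y / r * norm (x k - z0)"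
          using lip x(1) by blast
        then show "norm ((f (x k) y - f z0 y) / (x k - z0)) \<le> M y / r"
          using x(1) by (auto simp: norm_divide pos_divide_le_eq)
      next
        fix y assume "y \<in> S"
        then have "((\<lambda>z. f z y) has_field_derivative deriv (\<lambda>z. f z y) z0) (at z0 within ball z0 r)"
          using holomorphic_derivI[OF holo open_interior] bD z0
          by (blast intro: has_field_derivative_at_within)
        then show "(\<lambda>k. (f (x k) y - f z0 y) / (x k - z0)) \<longlonglongrightarrow> deriv (\<lambda>z. f z y) z0"
          using x unfolding has_field_derivative_iff tendsto_at_iff_sequentially by (auto simp: o_def)
      qed
      moreover have "integral S (\<lambda>y. (f (x k) y - f z0 y) / (x k - z0))
          = (integral S (f (x k)) - integral S (f z0)) / (x k - z0)" for k
        using f xD by (simp add: Henstock_Kurzweil_Integration.integral_diff)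
      ultimately show "((\<lambda>w. (integral S (f w) - integral S (f z0)) / (w - z0)) \<circ> x) \<longlonglongrightarrow>
         integral S (\<lambda>y. deriv (\<lambda>z. f z y) z0)"
        unfolding o_def by (simp only:)
    qed
    then have "((\<lambda>z. integral S (f z)) has_field_derivative integral S (\<lambda>y. deriv (\<lambda>z. f z y) z0)) (at z0)"
      unfolding has_field_derivative_iff at_within_open[OF z0 open_ball] .
    then show "(\<lambda>z. integral S (f z)) field_differentiable at z0 within interior D"
      by (meson field_differentiable_at_within field_differentiable_def)
  qed
qed

lemma regular_on_uniform_limit:
  assumes "\<And>n::nat. regular_on D (f n)" "uniform_limit D f g sequentially"
  shows "regular_on D g"
  unfolding regular_on_def
proof
  show "continuous_on D g"
    by (rule uniform_limit_theorem[OF _ assms(2)]) (use assms(1) in \<open>auto simp: regular_on_def\<close>)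
  show "g holomorphic_on interior D"
  proof (rule holomorphic_uniform_sequence)
    fix x assume "x \<in> interior D"
    then obtain d where "d > 0" "cball x d \<subseteq> interior D"
      using open_contains_cball by blast
    then show "\<exists>d>0. cball x d \<subseteq> interior D \<and> uniform_limit (cball x d) f g sequentially"
      by (meson assms(2) interior_subset subset_trans uniform_limit_on_subset)
  qed (use assms(1) in \<open>auto simp: regular_on_def\<close>)
qed

section \<open>Tail integrals over half-lines\<close>

lemma absolutely_integrable_on_atLeast_subset:
  fixes f :: "real \<Rightarrow> 'a::euclidean_space"
  assumes "f absolutely_integrable_on {X..}" "X \<le> x"
  shows "f absolutely_integrable_on {x..}" "f absolutely_integrable_on {x..b}"
    "f integrable_on {x..}" "f integrable_on {x..b}"
proof -
  show "f absolutely_integrable_on {x..}" "f absolutely_integrable_on {x..b}"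
    using assms by (auto intro: set_integrable_subset)
  then show "f integrable_on {x..}" "f integrable_on {x..b}"
    by (auto simp: absolutely_integrable_on_def)
qed

lemma ac_deriv_tail:
  fixes f :: "real \<Rightarrow> 'a::euclidean_space"
  assumes "f absolutely_integrable_on {X..}"
  shows "ac_deriv X (\<lambda>x. integral {x..} f) (\<lambda>x. - f x)"
proof -
  have 1: "(f has_integral integral {a..} f - integral {b..} f) {a..b}" if "X \<le> a" "a \<le> b" for a b
  proof -
    have "{a..} = {a..b} \<union> {b..}" using that by auto
    moreover have "negligible ({a..b} \<inter> {b..})"
    proof -
      have "{a..b} \<inter> {b..} = {b}" using that by auto
      then show ?thesis by simp
    qed
    ultimately have "integral {a..} f = integral {a..b} f + integral {b..} f"
      using absolutely_integrable_on_atLeast_subset[OF assms] that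
      by (metis Henstock_Kurzweil_Integration.integral_Un order_trans)
    then show ?thesis
      using absolutely_integrable_on_atLeast_subset(4)[OF assms that(1), of b] by (simp add: has_integral_integral)
  qed
  have "ac_deriv X (\<lambda>x. - integral {x..} f) f"
    unfolding ac_deriv_def using 1 absolutely_integrable_on_atLeast_subset[OF assms] by auto
  from ac_deriv_minus[OF this] show ?thesis by simp
qed

lemma absolutely_integrable_mult_bounded:
  fixes v g :: "real \<Rightarrow> complex"
  assumes "continuous_on {x..} v" "\<And>y. x \<le> y \<Longrightarrow> norm (v y) \<le> C" "g absolutely_integrable_on {x..}"
  shows "(\<lambda>y. g y * v y) absolutely_integrable_on {x..}"
proof -
  have "(\<lambda>y. v y * g y) absolutely_integrable_on {x..}"
    by (rule absolutely_integrable_bounded_measurable_product[of "(*)"])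
      (use assms in \<open>auto intro: bilinear_times continuous_imp_measurable_on_sets_lebesgue simp: bounded_iff\<close>)
  then show ?thesis by (simp add: mult.commute)
qed

lemma integral_atLeast_le:
  fixes f :: "real \<Rightarrow> real"
  assumes "f absolutely_integrable_on {a..}" "\<And>b. a \<le> b \<Longrightarrow> integral {a..b} f \<le> C"
  shows "integral {a..} f \<le> C"
proof -
  have "((\<lambda>b. set_lebesgue_integral lebesgue {a..b} f) \<longlongrightarrow> set_lebesgue_integral lebesgue {a..} f) at_top"
    by (rule tendsto_set_lebesgue_integral_at_top[OF _ assms(1)]) auto
  moreover have "\<forall>\<^sub>F b in at_top. set_lebesgue_integral lebesgue {a..b} f \<le> C"
    using eventually_ge_at_top[of a]
  proof eventually_elim
    case (elim b)
    have "f absolutely_integrable_on {a..b}"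
      using absolutely_integrable_on_atLeast_subset(2)[OF assms(1)] by simp
    then show ?case
      using assms(2)[OF elim] by (simp add: set_lebesgue_integral_eq_integral)
  qed
  ultimately have "set_lebesgue_integral lebesgue {a..} f \<le> C"
    by (rule tendsto_upperbound) simp
  then show ?thesis
    using assms(1) by (simp add: set_lebesgue_integral_eq_integral)
qed

lemma integral_tail_nonneg:
  fixes \<rho> :: "real \<Rightarrow> real"
  assumes "\<rho> absolutely_integrable_on {X..}" "\<And>y. X \<le> y \<Longrightarrow> 0 \<le> \<rho> y" "X \<le> x"
  shows "0 \<le> integral {x..} \<rho>"
  by (rule Henstock_Kurzweil_Integration.integral_nonneg)
    (use assms absolutely_integrable_on_atLeast_subset(3)[OF assms(1)] in auto)

lemma integral_tail_antimono:
  fixes \<rho> :: "real \<Rightarrow> real"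
  assumes "\<rho> absolutely_integrable_on {X..}" "\<And>y. X \<le> y \<Longrightarrow> 0 \<le> \<rho> y" "X \<le> x" "x \<le> y"
  shows "integral {y..} \<rho> \<le> integral {x..} \<rho>"
  by (rule integral_subset_le)
    (use assms absolutely_integrable_on_atLeast_subset(3)[OF assms(1)] in auto)

text \<open>Since m' = - rho, the integrand is the density of - m^(n+1) / (n+1). The integral over
  \<open>{x..b}\<close> is thus explicit, and \<open>m b\<close> being nonnegative allows its term
  to be dropped. This is the origin of the n! in the Neumann series.\<close>

lemma integral_tail_power:
  fixes \<rho> :: "real \<Rightarrow> real"
  assumes \<rho>: "\<rho> absolutely_integrable_on {X..}" "\<And>y. X \<le> y \<Longrightarrow> 0 \<le> \<rho> y" and x: "X \<le> x"
  defines "m \<equiv> \<lambda>x. integral {x..} \<rho>"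
  shows "(\<lambda>y. \<rho> y * m y ^ n) absolutely_integrable_on {x..}"
    and "integral {x..} (\<lambda>y. \<rho> y * m y ^ n) \<le> m x ^ Suc n / real (Suc n)"
proof -
  have m: "ac_deriv X m (\<lambda>x. - \<rho> x)" unfolding m_def by (rule ac_deriv_tail[OF \<rho>(1)])
  have mc: "continuous_on {x..} m"
    using ac_deriv_continuous[OF m] x by (auto intro: continuous_on_subset)
  have m0: "0 \<le> m y" if "X \<le> y" for y
    unfolding m_def by (rule integral_tail_nonneg[OF \<rho> that])
  have mle: "m y \<le> m x" if "x \<le> y" for y
    unfolding m_def by (rule integral_tail_antimono[OF \<rho> x that])
  have bm: "bounded ((\<lambda>y. m y ^ n) ` {x..})"
    unfolding bounded_iff
  proof (intro exI[of _ "m x ^ n"] ballI)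
    fix w assume "w \<in> (\<lambda>y. m y ^ n) ` {x..}"
    then obtain y where y: "x \<le> y" "w = m y ^ n" by auto
    then show "norm w \<le> m x ^ n"
      using m0[of y] mle[OF y(1)] x by (simp add: power_mono)
  qed
  show ai: "(\<lambda>y. \<rho> y * m y ^ n) absolutely_integrable_on {x..}"
    using absolutely_integrable_bounded_measurable_product_real[OF _ _ bm, of \<rho>]
      absolutely_integrable_on_atLeast_subset(1)[OF \<rho>(1) x] mc
    by (simp add: mult.commute continuous_imp_measurable_on_sets_lebesgue continuous_on_power)
  have pw: "ac_deriv X (\<lambda>x. m x ^ Suc k) (\<lambda>x. - (real (Suc k) * (\<rho> x * m x ^ k)))" for k
  proof (induction k)
    case 0
    then show ?case using m by simp
  next
    case (Suc k)
    show ?case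
      by (rule ac_deriv_cong[OF ac_deriv_mult[OF m Suc]]) (auto simp: algebra_simps)
  qed
  show "integral {x..} (\<lambda>y. \<rho> y * m y ^ n) \<le> m x ^ Suc n / real (Suc n)"
  proof (rule integral_atLeast_le[OF ai])
    fix b assume b: "x \<le> b"
    have "integral {x..b} (\<lambda>y. - (real (Suc n) * (\<rho> y * m y ^ n))) = m b ^ Suc n - m x ^ Suc n"
      by (rule ac_deriv_integral[OF pw x b])
    then have "real (Suc n) * integral {x..b} (\<lambda>y. \<rho> y * m y ^ n) = m x ^ Suc n - m b ^ Suc n"
      by simp
    also have "\<dots> \<le> m x ^ Suc n"
      using m0[of b] b x by simp
    finally show "integral {x..b} (\<lambda>y. \<rho> y * m y ^ n) \<le> m x ^ Suc n / real (Suc n)"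
      by (simp add: field_simps)
  qed
qed

text \<open>The form (S(y) - S(x)) g(y) of the kernel splits the integral into tail integrals, so it
  can be differentiated in x without differentiating under the integral sign.
  \<open>kernel_le\<close> bounds the product because S may grow; \<open>g_le\<close> serves the
  tail integral of g u, which occurs in the derivative.\<close>

locale volterra =
  fixes X :: real and D :: "complex set" and S S' g :: "complex \<Rightarrow> real \<Rightarrow> complex" and \<rho> :: "real \<Rightarrow> real"
  assumes S: "z \<in> D \<Longrightarrow> ac_deriv X (S z) (S' z)"
    and S'_cont: "z \<in> D \<Longrightarrow> continuous_on {X..} (S' z)"
    and g: "z \<in> D \<Longrightarrow> g z absolutely_integrable_on {X..}"
    and \<rho>: "\<rho> absolutely_integrable_on {X..}" "X \<le> y \<Longrightarrow> 0 \<le> \<rho> y"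
    and kernel_le: "z \<in> D \<Longrightarrow> X \<le> x \<Longrightarrow> x \<le> y \<Longrightarrow> norm ((S z y - S z x) * g z y) \<le> \<rho> y"
    and g_le: "z \<in> D \<Longrightarrow> X \<le> y \<Longrightarrow> norm (g z y) \<le> \<rho> y"
    and S_regular: "X \<le> x \<Longrightarrow> regular_on D (\<lambda>z. S z x)"
    and g_regular: "X \<le> x \<Longrightarrow> regular_on D (\<lambda>z. g z x)"
begin

definition T :: "complex \<Rightarrow> (real \<Rightarrow> complex) \<Rightarrow> real \<Rightarrow> complex" where
  "T z v x = integral {x..} (\<lambda>y. (S z y - S z x) * g z y * v y)"

definition m :: "real \<Rightarrow> real" where
  "m x = integral {x..} \<rho>"

lemma m_nonneg: "X \<le> x \<Longrightarrow> 0 \<le> m x"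
  unfolding m_def by (rule integral_tail_nonneg[OF \<rho>])

lemma m_mono: "X \<le> x \<Longrightarrow> x \<le> y \<Longrightarrow> m y \<le> m x"
  unfolding m_def by (rule integral_tail_antimono[OF \<rho>])

context
  fixes z :: complex and v :: "real \<Rightarrow> complex" and C :: real
  assumes z: "z \<in> D" and v: "continuous_on {X..} v" "\<And>y. X \<le> y \<Longrightarrow> norm (v y) \<le> C"
begin

lemma gv_integrable: "X \<le> x \<Longrightarrow> (\<lambda>y. g z y * v y) absolutely_integrable_on {x..}"
  using v by (intro absolutely_integrable_mult_bounded[where C=C]
      absolutely_integrable_on_atLeast_subset(1)[OF g[OF z]]) (auto intro: continuous_on_subset)

lemma kernel_integrable:
  assumes x: "X \<le> x"
  shows "(\<lambda>y. (S z y - S z x) * g z y * v y) absolutely_integrable_on {x..}"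
proof (rule measurable_bounded_by_integrable_imp_absolutely_integrable[where g = "\<lambda>y. \<rho> y * C"])
  have c: "continuous_on {x..} (S z)" "continuous_on {x..} v"
    using ac_deriv_continuous[OF S[OF z]] v x by (auto intro: continuous_on_subset)
  show "(\<lambda>y. (S z y - S z x) * g z y * v y) \<in> borel_measurable (lebesgue_on {x..})"
    using c absolutely_integrable_on_atLeast_subset(1)[OF g[OF z] x]
    by (intro borel_measurable_times borel_measurable_diff borel_measurable_const
        continuous_imp_measurable_on_sets_lebesgue absolutely_integrable_imp_borel_measurable) auto
  show "(\<lambda>y. \<rho> y * C) integrable_on {x..}"
    by (intro integrable_on_mult_left absolutely_integrable_on_atLeast_subset(3)[OF \<rho>(1) x])
  fix y assume "y \<in> {x..}"
  then show "norm ((S z y - S z x) * g z y * v y) \<le> \<rho> y * C"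
    unfolding norm_mult[of _ "v y"] using z x v(2)[of y] \<rho>(2)[of y]
    by (intro mult_mono kernel_le) auto
qed auto

text \<open>Write T v = A - S B with A and B the tails of S g v and g v. The two terms S g v
  produced by the product rule cancel, and what remains is continuous, so T v is even continuously
  differentiable.\<close>

lemma T_ac_deriv: "ac_deriv X (T z v) (\<lambda>x. - S' z x * integral {x..} (\<lambda>y. g z y * v y))"
proof -
  \<comment> \<open>\<open>S\<close> may be unbounded, so integrability of S g v is obtained from
    the kernel based at \<open>X\<close> plus the constant \<open>S z X\<close> times g v.\<close>
  have "(\<lambda>y. (S z y - S z X) * g z y * v y + S z X * (g z y * v y)) absolutely_integrable_on {X..}"
    using kernel_integrable[of X] gv_integrable[of X]
    by (intro set_integral_add absolutely_integrable_bounded_measurable_product[of "(*)" "\<lambda>_. S z X"])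
      (auto intro: bilinear_times simp: bounded_iff)
  then have Sgv: "(\<lambda>y. S z y * (g z y * v y)) absolutely_integrable_on {X..}"
    by (simp add: algebra_simps)
  define A where "A = (\<lambda>x. integral {x..} (\<lambda>y. S z y * (g z y * v y)))"
  define B where "B = (\<lambda>x. integral {x..} (\<lambda>y. g z y * v y))"
  have "ac_deriv X A (\<lambda>x. - (S z x * (g z x * v x)))"
    unfolding A_def by (rule ac_deriv_tail[OF Sgv])
  moreover have "ac_deriv X B (\<lambda>x. - (g z x * v x))"
    unfolding B_def by (rule ac_deriv_tail[OF gv_integrable]) simp
  ultimately have "ac_deriv X (\<lambda>x. A x - S z x * B x)
     (\<lambda>x. - (S z x * (g z x * v x)) - (S' z x * B x + S z x * - (g z x * v x)))"
    by (intro ac_deriv_diff ac_deriv_mult S z)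
  then show ?thesis
  proof (rule ac_deriv_cong)
    fix x assume x: "X \<le> x"
    have "A x - S z x * B x = integral {x..} (\<lambda>y. S z y * (g z y * v y) - S z x * (g z y * v y))"
      unfolding A_def B_def
      using absolutely_integrable_on_atLeast_subset(3)[OF Sgv x]
        absolutely_integrable_on_atLeast_subset(3)[OF gv_integrable[OF order_refl] x]
      by (subst Henstock_Kurzweil_Integration.integral_diff) (auto intro: integrable_on_mult_right)
    then show "A x - S z x * B x = T z v x"
      by (simp add: T_def algebra_simps)
  qed (simp add: B_def)
qed

lemma T_continuous: "continuous_on {X..} (T z v)"
  by (rule ac_deriv_continuous[OF T_ac_deriv])

lemma T_has_vector_derivative:
  assumes "X \<le> x"
  shows "(T z v has_vector_derivative - S' z x * integral {x..} (\<lambda>y. g z y * v y)) (at x within {X..})"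
  by (rule ac_deriv_imp_vector_derivative[OF T_ac_deriv _ assms])
    (intro continuous_intros S'_cont z ac_deriv_continuous[OF ac_deriv_tail] gv_integrable order_refl)

end

text \<open>One application of T gains a factor m(x) / (n+1). The hypothesis on \<open>v\<close> is
  integrability against the kernel, not continuity, so that the bound also serves the uniqueness
  proof, where a bounded solution comes without regularity.\<close>

lemma kernel_power_bound:
  assumes z: "z \<in> D" and x: "X \<le> x"
    and int: "(\<lambda>y. (S z y - S z x) * g z y * v y) integrable_on {x..}"
    and v: "\<And>y. X \<le> y \<Longrightarrow> norm (v y) \<le> C * m y ^ n" and C: "0 \<le> C"
  shows "norm (T z v x) \<le> C * (m x ^ Suc n / real (Suc n))"
proof -
  note P = integral_tail_power[OF \<rho> x, of n, folded m_def]
  have "norm (T z v x) \<le> integral {x..} (\<lambda>y. C * (\<rho> y * m y ^ n))"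
    unfolding T_def
  proof (rule Henstock_Kurzweil_Integration.integral_norm_bound_integral[OF int])
    show "(\<lambda>y. C * (\<rho> y * m y ^ n)) integrable_on {x..}"
      using P(1) by (intro integrable_on_mult_right) (simp add: absolutely_integrable_on_def)
    fix y assume y: "y \<in> {x..}"
    have "norm ((S z y - S z x) * g z y * v y) \<le> \<rho> y * (C * m y ^ n)"
      unfolding norm_mult[of _ "v y"] using z x y v[of y] \<rho>(2)[of y]
      by (intro mult_mono kernel_le) auto
    then show "norm ((S z y - S z x) * g z y * v y) \<le> C * (\<rho> y * m y ^ n)"
      by (simp add: algebra_simps)
  qed
  also have "\<dots> = C * integral {x..} (\<lambda>y. \<rho> y * m y ^ n)" by simp
  also have "\<dots> \<le> C * (m x ^ Suc n / real (Suc n))"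
    by (rule mult_left_mono[OF P(2) C])
  finally show ?thesis .
qed

text \<open>Inserting w = T w repeatedly improves the constant bound C to C m(x)^n / n! for every n,
  which tends to 0.\<close>

lemma bounded_solution_unique:
  assumes z: "z \<in> D"
    and int: "\<And>x. X \<le> x \<Longrightarrow> (\<lambda>y. (S z y - S z x) * g z y * w y) integrable_on {x..}"
    and eq: "\<And>x. X \<le> x \<Longrightarrow> w x = T z w x"
    and bd: "bounded (w ` {X..})" and x: "X \<le> x"
  shows "w x = 0"
proof -
  obtain C where C: "\<And>y. X \<le> y \<Longrightarrow> norm (w y) \<le> C"
    using bd unfolding bounded_iff by auto
  have C0: "0 \<le> C" using C[of X] norm_ge_zero order_trans by blast
  have *: "norm (w y) \<le> C / fact n * m y ^ n" if "X \<le> y" for n y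
    using that
  proof (induction n arbitrary: y)
    case 0
    then show ?case using C by simp
  next
    case (Suc n)
    have "norm (T z w y) \<le> C / fact n * (m y ^ Suc n / real (Suc n))"
      by (rule kernel_power_bound[OF z Suc.prems int[OF Suc.prems] Suc.IH]) (use C0 in auto)
    then show ?case using eq[OF Suc.prems] by (simp add: mult.commute)
  qed
  have "(\<lambda>n. C * (inverse (fact n) * m x ^ n)) \<longlonglongrightarrow> C * 0"
    by (intro tendsto_mult tendsto_const summable_LIMSEQ_zero summable_exp)
  then have "(\<lambda>n. C / fact n * m x ^ n) \<longlonglongrightarrow> 0"
    by (simp add: field_simps)
  then have "norm (w x) \<le> 0"
    by (rule LIMSEQ_le_const) (use *[OF x] in auto)
  then show ?thesis by simp
qed

lemma T_regular:
  assumes u: "\<And>z. z \<in> D \<Longrightarrow> continuous_on {X..} (u z)"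
    "\<And>z y. z \<in> D \<Longrightarrow> X \<le> y \<Longrightarrow> norm (u z y) \<le> C"
    "\<And>y. X \<le> y \<Longrightarrow> regular_on D (\<lambda>z. u z y)"
    and x: "X \<le> x"
  shows "regular_on D (\<lambda>z. T z (u z) x)"
  unfolding T_def
proof (rule regular_on_integral)
  show "(\<lambda>y. (S z y - S z x) * g z y * u z y) integrable_on {x..}" if "z \<in> D" for z
    using kernel_integrable[OF that u(1,2)[OF that] x] by (simp add: absolutely_integrable_on_def that)
  show "(\<lambda>y. \<rho> y * C) integrable_on {x..}"
    by (intro integrable_on_mult_left absolutely_integrable_on_atLeast_subset(3)[OF \<rho>(1) x])
  show "norm ((S z y - S z x) * g z y * u z y) \<le> \<rho> y * C" if "z \<in> D" "y \<in> {x..}" for z y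
    unfolding norm_mult[of _ "u z y"] using that x u(2)[of z y] \<rho>(2)[of y]
    by (intro mult_mono kernel_le) auto
  show "regular_on D (\<lambda>z. (S z y - S z x) * g z y * u z y)" if "y \<in> {x..}" for y
    using that x by (intro regular_on_mult regular_on_diff S_regular g_regular u) auto
qed

text \<open>The derivative of T u in x is a multiple of this tail; its regularity in z is what makes
  p theta' at the starting point a regular initial value.\<close>

lemma tail_regular:
  assumes u: "\<And>z. z \<in> D \<Longrightarrow> continuous_on {X..} (u z)"
    "\<And>z y. z \<in> D \<Longrightarrow> X \<le> y \<Longrightarrow> norm (u z y) \<le> C"
    "\<And>y. X \<le> y \<Longrightarrow> regular_on D (\<lambda>z. u z y)"
    and x: "X \<le> x"
  shows "regular_on D (\<lambda>z. integral {x..} (\<lambda>y. g z y * u z y))"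
proof (rule regular_on_integral)
  show "(\<lambda>y. g z y * u z y) integrable_on {x..}" if "z \<in> D" for z
    using gv_integrable[OF that u(1,2)[OF that] x] by (simp add: absolutely_integrable_on_def that)
  show "(\<lambda>y. \<rho> y * C) integrable_on {x..}"
    by (intro integrable_on_mult_left absolutely_integrable_on_atLeast_subset(3)[OF \<rho>(1) x])
  show "norm (g z y * u z y) \<le> \<rho> y * C" if "z \<in> D" "y \<in> {x..}" for z y
    unfolding norm_mult[of _ "u z y"] using that x u(2)[of z y] \<rho>(2)[of y]
    by (intro mult_mono g_le) auto
  show "regular_on D (\<lambda>z. g z y * u z y)" if "y \<in> {x..}" for y
    using that x by (intro regular_on_mult g_regular u) auto
qed

text \<open>The majorant series M m(X)^n / n! works for all \<open>z\<close> in \<open>D\<close> and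
  all x from \<open>X\<close> on at once. Convergence is uniform in x for fixed z, which gives
  continuity, and uniform in z for fixed x, which gives regularity.\<close>

theorem solution_exists:
  assumes u0: "\<And>z. z \<in> D \<Longrightarrow> continuous_on {X..} (u0 z)"
    "\<And>z x. z \<in> D \<Longrightarrow> X \<le> x \<Longrightarrow> norm (u0 z x) \<le> M"
    "\<And>x. X \<le> x \<Longrightarrow> regular_on D (\<lambda>z. u0 z x)" and M: "0 \<le> M"
  obtains u where "\<And>z. z \<in> D \<Longrightarrow> continuous_on {X..} (u z)"
    "\<And>z x. z \<in> D \<Longrightarrow> X \<le> x \<Longrightarrow> norm (u z x) \<le> M * exp (m X)"
    "\<And>z x. z \<in> D \<Longrightarrow> X \<le> x \<Longrightarrow> u z x = u0 z x + T z (u z) x"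
    "\<And>x. X \<le> x \<Longrightarrow> regular_on D (\<lambda>z. u z x)"
proof -
  define V where "V = (\<lambda>n z. (T z ^^ n) (u0 z))"
  have VS: "V (Suc n) z = T z (V n z)" for n z by (simp add: V_def)
  have fac: "M / fact n * m x ^ n \<le> M / fact n * m X ^ n" if "X \<le> x" for n x
    using that m_mono[OF order_refl that] m_nonneg[OF that] M by (intro mult_left_mono power_mono) auto
  have V: "continuous_on {X..} (V n z) \<and> (\<forall>x\<ge>X. norm (V n z x) \<le> M / fact n * m x ^ n)" if z: "z \<in> D" for n z
  proof (induction n)
    case 0
    then show ?case using u0 z by (auto simp: V_def)
  next
    case (Suc n)
    have c: "continuous_on {X..} (V n z)" using Suc by blast
    have b: "norm (V n z x) \<le> M / fact n * m X ^ n" if "X \<le> x" for x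
      using Suc fac[OF that, of n] that by (meson order_trans)
    have "norm (T z (V n z) x) \<le> M / fact n * (m x ^ Suc n / real (Suc n))" if x: "X \<le> x" for x
    proof (rule kernel_power_bound[OF z x])
      show "(\<lambda>y. (S z y - S z x) * g z y * V n z y) integrable_on {x..}"
        using kernel_integrable[OF z c b x] by (simp add: absolutely_integrable_on_def)
    qed (use Suc M in auto)
    then have "norm (V (Suc n) z x) \<le> M / fact (Suc n) * m x ^ Suc n" if "X \<le> x" for x
      using that by (simp add: VS mult.commute)
    then show ?case
      using T_continuous[OF z c b] by (simp add: VS)
  qed
  have Vb: "norm (V n z x) \<le> M / fact n * m X ^ n" if "z \<in> D" "X \<le> x" for n z x
    using V[OF that(1), of n] fac[OF that(2), of n] that(2) by (meson order_trans)
  have Vr: "regular_on D (\<lambda>z. V n z x)" if "X \<le> x" for n x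
    using that
  proof (induction n arbitrary: x)
    case 0
    then show ?case using u0 by (simp add: V_def)
  next
    case (Suc n)
    show ?case unfolding VS
      by (rule T_regular[where C = "M / fact n * m X ^ n"]) (use V Vb Suc in auto)
  qed
  have e: "(\<lambda>n. M / fact n * m X ^ n) sums (M * exp (m X))"
    using sums_mult[OF exp_converges[of "m X"], of M] by (simp add: field_simps)
  define u where "u = (\<lambda>z x. \<Sum>n. V n z x)"
  have sm: "summable (\<lambda>n. V n z x)" if "z \<in> D" "X \<le> x" for z x
    by (rule summable_comparison_test[OF _ sums_summable[OF e]]) (use Vb that in auto)
  have unx: "uniform_limit {X..} (\<lambda>n x. \<Sum>i<n. V i z x) (u z) sequentially" if "z \<in> D" for z
    unfolding u_def by (rule Weierstrass_m_test[OF _ sums_summable[OF e]]) (use Vb that in auto)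
  have unz: "uniform_limit D (\<lambda>n z. \<Sum>i<n. V i z x) (\<lambda>z. u z x) sequentially" if "X \<le> x" for x
    unfolding u_def by (rule Weierstrass_m_test[OF _ sums_summable[OF e]]) (use Vb that in auto)
  have uc: "continuous_on {X..} (u z)" if "z \<in> D" for z
    by (rule uniform_limit_theorem[OF _ unx[OF that]]) (use V that in \<open>auto intro!: always_eventually continuous_on_sum\<close>)
  have ub: "norm (u z x) \<le> M * exp (m X)" if "z \<in> D" "X \<le> x" for z x
    unfolding u_def sums_unique[OF e]
    by (rule norm_suminf_le[OF _ sums_summable[OF e]]) (use Vb that in auto)
  have ur: "regular_on D (\<lambda>z. u z x)" if "X \<le> x" for x
  proof (rule regular_on_uniform_limit[OF _ unz[OF that]])
    fix n show "regular_on D (\<lambda>z. \<Sum>i<n. V i z x)"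
      by (induction n) (simp_all add: regular_on_const regular_on_add Vr[OF that])
  qed
  have ue: "u z x = u0 z x + T z (u z) x" if z: "z \<in> D" and x: "X \<le> x" for z x
  proof -
    let ?K = "\<lambda>v y. (S z y - S z x) * g z y * v y"
    \<comment> \<open>The partial sums satisfy the equation up to an index shift, as
      \<open>V (Suc i) z\<close> is T applied to \<open>V i z\<close>; dominated convergence then
      takes the limit inside the integral.\<close>
    have lin: "(\<Sum>i<Suc n. V i z x) = u0 z x + integral {x..} (?K (\<lambda>y. \<Sum>i<n. V i z y))" for n
    proof -
      have "integral {x..} (?K (\<lambda>y. \<Sum>i<n. V i z y)) = integral {x..} (\<lambda>y. \<Sum>i<n. ?K (V i z) y)"
        by (simp add: sum_distrib_left)
      also have "\<dots> = (\<Sum>i<n. integral {x..} (?K (V i z)))"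
        by (rule Henstock_Kurzweil_Integration.integral_sum)
          (use kernel_integrable[OF z _ _ x] V[OF z] Vb[OF z] in \<open>fastforce simp: absolutely_integrable_on_def\<close>)+
      also have "\<dots> = (\<Sum>i<n. V (Suc i) z x)" by (simp add: VS T_def)
      finally show ?thesis
        unfolding sum.lessThan_Suc_shift by (simp add: V_def)
    qed
    have "(\<lambda>n. integral {x..} (?K (\<lambda>y. \<Sum>i<n. V i z y))) \<longlonglongrightarrow> integral {x..} (?K (u z))"
    proof (rule dominated_convergence(2)[where h = "\<lambda>y. \<rho> y * (M * exp (m X))"])
      have b: "norm (\<Sum>i<n. V i z y) \<le> M * exp (m X)" if "X \<le> y" for n y
      proof -
        have "norm (\<Sum>i<n. V i z y) \<le> (\<Sum>i<n. M / fact i * m X ^ i)"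
          by (rule sum_norm_le) (use Vb z that in auto)
        also have "\<dots> \<le> M * exp (m X)"
          unfolding sums_unique[OF e]
          by (rule sum_le_suminf[OF sums_summable[OF e]]) (use M m_nonneg[of X] in auto)
        finally show ?thesis .
      qed
      have c: "continuous_on {X..} (\<lambda>y. \<Sum>i<n. V i z y)" for n
        using V[OF z] by (intro continuous_intros) auto
      show "?K (\<lambda>y. \<Sum>i<n. V i z y) integrable_on {x..}" for n
        using kernel_integrable[OF z c b x] by (simp add: absolutely_integrable_on_def)
      show "(\<lambda>y. \<rho> y * (M * exp (m X))) integrable_on {x..}"
        by (intro integrable_on_mult_left absolutely_integrable_on_atLeast_subset(3)[OF \<rho>(1) x])
      show "norm (?K (\<lambda>y. \<Sum>i<n. V i z y) y) \<le> \<rho> y * (M * exp (m X))" if "y \<in> {x..}" for n y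
        unfolding norm_mult[of _ "\<Sum>i<n. V i z y"] using that x z b[of y n] \<rho>(2)[of y]
        by (intro mult_mono kernel_le) auto
      show "(\<lambda>n. ?K (\<lambda>y. \<Sum>i<n. V i z y) y) \<longlonglongrightarrow> ?K (u z) y" if "y \<in> {x..}" for y
        unfolding u_def using that x z by (intro tendsto_mult tendsto_const summable_LIMSEQ sm) auto
    qed
    then have "(\<lambda>n. \<Sum>i<Suc n. V i z x) \<longlonglongrightarrow> u0 z x + T z (u z) x"
      unfolding lin T_def by (intro tendsto_add tendsto_const)
    moreover have "(\<lambda>n. \<Sum>i<Suc n. V i z x) \<longlonglongrightarrow> u z x"
      unfolding u_def by (rule LIMSEQ_Suc[OF summable_LIMSEQ[OF sm[OF z x]]])
    ultimately show ?thesis using LIMSEQ_unique by blast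
  qed
  show ?thesis by (rule that[of u]) (use uc ub ue ur in auto)
qed

end

section \<open>The WKB exponent\<close>

text \<open>On the closed upper half-plane \<^const>\<open>csqrt\<close> agrees with a function that is continuous
  everywhere; this gives continuity up to the cut and measurability.\<close>

definition usqrt :: "complex \<Rightarrow> complex" where
  "usqrt w = Complex (sqrt ((cmod w + Re w) / 2)) (sqrt ((cmod w - Re w) / 2))"

lemma csqrt_eq_usqrt: "0 \<le> Im w \<Longrightarrow> csqrt w = usqrt w"
  by (simp add: usqrt_def complex_eq_iff)

lemma continuous_on_usqrt: "continuous_on A usqrt"
  unfolding usqrt_def Complex_eq by (intro continuous_intros) auto

lemma interior_upper_half_plane: "interior {z. 0 \<le> Im z} = {z. 0 < Im z}"
  using interior_halfspace_ge[of \<i> 0] by (simp add: inner_complex_def)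

lemma interior_lower_half_plane: "interior {z. Im z \<le> 0} = {z. Im z < 0}"
  using interior_halfspace_le[of \<i> 0] by (simp add: inner_complex_def)

lemma cutdom_nonzero: "z \<in> cutdom s \<Longrightarrow> z \<noteq> 0"
  by (auto simp: cutdom_def)

lemma interior_cutdom_subset:
  assumes "D \<subseteq> cutdom s"
  shows "interior D \<subseteq> (if s then {z. 0 < Im z} else {z. Im z < 0})"
proof (cases s)
  case True
  then have "D \<subseteq> {z. 0 \<le> Im z}" using assms by (auto simp: cutdom_def)
  from interior_mono[OF this] show ?thesis using True by (simp add: interior_upper_half_plane)
next
  case False
  then have "D \<subseteq> {z. Im z \<le> 0}" using assms by (auto simp: cutdom_def)
  from interior_mono[OF this] show ?thesis using False by (simp add: interior_lower_half_plane)
qed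

locale coefficients =
  fixes p q dp dq :: "real \<Rightarrow> real" and x0 p0 :: real
  assumes p_pos: "0 \<le> x \<Longrightarrow> p x > 0"
    and dp_L1: "dp absolutely_integrable_on {0..}"
    and p_has_integral: "0 \<le> x \<Longrightarrow> (dp has_integral (p x - p 0)) {0..x}"
    and p_lim: "(p \<longlongrightarrow> p0) at_top" and p0_pos: "p0 > 0"
    and x0_nonneg: "0 \<le> x0"
    and q_L1: "q absolutely_integrable_on {0..x0}"
    and dq_L1: "dq absolutely_integrable_on {x0..}"
    and q_has_integral: "x0 \<le> x \<Longrightarrow> (dq has_integral (q x - q x0)) {x0..x}"
begin

lemma p_ac: "ac_deriv 0 p dp"
  by (rule ac_derivI)
    (auto intro: p_has_integral absolutely_integrable_on_atLeast_subset(2)[OF dp_L1])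

lemma q_ac: "ac_deriv x0 q dq"
  by (rule ac_derivI)
    (auto intro: q_has_integral absolutely_integrable_on_atLeast_subset(2)[OF dq_L1])

lemma p_cont: "continuous_on {0..} p"
  by (rule ac_deriv_continuous[OF p_ac])

lemma q_cont: "continuous_on {x0..} q"
  by (rule ac_deriv_continuous[OF q_ac])

lemma p_bounds: obtains l L where "0 < l" "\<And>x. 0 \<le> x \<Longrightarrow> l \<le> p x" "\<And>x. 0 \<le> x \<Longrightarrow> p x \<le> L"
proof -
  have "\<forall>\<^sub>F x in at_top. p0/2 < p x" "\<forall>\<^sub>F x in at_top. p x < 2 * p0"
    using p0_pos by (intro order_tendstoD[OF p_lim]; simp)+
  then have "\<forall>\<^sub>F x in at_top. p0/2 < p x \<and> p x < 2 * p0" by (rule eventually_conj)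
  then obtain N where N: "\<And>x. N \<le> x \<Longrightarrow> p0/2 < p x \<and> p x < 2 * p0"
    by (auto simp: eventually_at_top_linorder)
  define b where "b = max N 0"
  have c: "continuous_on {0..b} p" using p_cont by (rule continuous_on_subset) auto
  have ne: "{0..b} \<noteq> {}" by (simp add: b_def)
  obtain s where s: "s \<in> {0..b}" "\<And>y. y \<in> {0..b} \<Longrightarrow> p s \<le> p y"
    using continuous_attains_inf[OF compact_Icc ne c] by blast
  obtain t where t: "t \<in> {0..b}" "\<And>y. y \<in> {0..b} \<Longrightarrow> p y \<le> p t"
    using continuous_attains_sup[OF compact_Icc ne c] by blast
  show ?thesis
  proof (rule that[of "min (p s) (p0/2)" "max (p t) (2*p0)"])
    show "0 < min (p s) (p0/2)" using p_pos[of s] s p0_pos by auto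
    fix x :: real assume x: "0 \<le> x"
    show "min (p s) (p0/2) \<le> p x"
      using s(2)[of x] N[of x] x by (cases "x \<le> b") (force simp: b_def min_le_iff_disj)+
    show "p x \<le> max (p t) (2*p0)"
      using t(2)[of x] N[of x] x by (cases "x \<le> b") (force simp: b_def le_max_iff_disj)+
  qed
qed

lemma q_abs: "0 \<le> a \<Longrightarrow> q absolutely_integrable_on {a..b}"
proof -
  assume a: "0 \<le> a"
  have "q absolutely_integrable_on {x0..max b x0}"
    by (rule absolutely_integrable_continuous_real) (rule continuous_on_subset[OF q_cont], auto)
  then have "q absolutely_integrable_on {0..x0} \<union> {x0..max b x0}"
    using q_L1 by (intro set_integrable_Un) auto
  then show ?thesis
    by (rule absolutely_integrable_on_subinterval) (use a in auto)
qed

section \<open>The branch of omega: sign, continuity, regularity, domination\<close>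

abbreviation om :: "bool \<Rightarrow> complex \<Rightarrow> real \<Rightarrow> complex" where
  "om s z x \<equiv> omega p q s x z"

lemma om_square: "(om s z x)\<^sup>2 = (of_real (q x) - z) / of_real (p x)"
proof (cases s)
  case True
  then show ?thesis
    by (simp add: omega_def power_mult_distrib minus_divide_left)
next
  case False
  have "(om s z x)\<^sup>2 = cnj ((- \<i> * csqrt ((cnj z - of_real (q x)) / of_real (p x)))\<^sup>2)"
    using False by (simp add: omega_def)
  also have "\<dots> = (of_real (q x) - z) / of_real (p x)"
    unfolding power_mult_distrib power2_csqrt by (simp add: minus_divide_left)
  finally show ?thesis .
qed

lemma om_cmod_square: "0 \<le> x \<Longrightarrow> (cmod (om s z x))\<^sup>2 = cmod (of_real (q x) - z) / p x"
  using arg_cong[OF om_square[of s x z], of cmod] p_pos[of x] by (simp add: norm_power norm_divide)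

lemma om_eq_usqrt:
  assumes "z \<in> cutdom s" "0 \<le> x"
  shows "om s z x = (if s then - \<i> * usqrt ((z - of_real (q x)) / of_real (p x))
      else cnj (- \<i> * usqrt ((cnj z - of_real (q x)) / of_real (p x))))"
proof -
  have "csqrt ((w - of_real (q x)) / of_real (p x)) = usqrt ((w - of_real (q x)) / of_real (p x))"
    if "0 \<le> Im w" for w
    using that p_pos[OF assms(2)] by (intro csqrt_eq_usqrt) simp
  from this[of z] this[of "cnj z"] show ?thesis
    using assms(1) by (auto simp: omega_def cutdom_def)
qed

text \<open>The real part of \<open>- \<i> * w\<close> is the imaginary part of \<open>w\<close>,
  and \<open>usqrt\<close> takes values in the closed upper half-plane. Equality can occur on the
  cut.\<close>

lemma om_Re_nonneg:
  assumes "z \<in> cutdom s" "0 \<le> x"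
  shows "0 \<le> Re (om s z x)"
proof -
  have "0 \<le> Im (usqrt w)" for w
    by (simp add: usqrt_def complex_Re_le_cmod)
  then show ?thesis
    unfolding om_eq_usqrt[OF assms] by simp
qed

lemma om_cont:
  assumes "z \<in> cutdom s"
  shows "continuous_on {x0..} (om s z)"
proof -
  have p: "continuous_on {x0..} p" using p_cont by (rule continuous_on_subset) (use x0_nonneg in auto)
  have nz: "\<forall>x\<in>{x0..}. complex_of_real (p x) \<noteq> 0" using p_pos x0_nonneg by (metis atLeast_iff less_irrefl of_real_eq_0_iff order_trans)
  have "continuous_on {x0..} (\<lambda>x. if s then - \<i> * usqrt ((z - of_real (q x)) / of_real (p x))
      else cnj (- \<i> * usqrt ((cnj z - of_real (q x)) / of_real (p x))))"
    using nz
    by (cases s) (auto intro!: continuous_intros continuous_on_compose2[OF continuous_on_usqrt[of UNIV]] q_cont p)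
  then show ?thesis
    by (rule continuous_on_eq) (use om_eq_usqrt[OF assms] x0_nonneg in auto)
qed

text \<open>Continuity on all of \<open>D\<close>, real points included, comes from
  \<open>usqrt\<close>. Holomorphy concerns only the open half-plane, where the argument of
  \<open>csqrt\<close> stays off the branch cut. The lower sheet is the reflection of the upper one,
  hence the conjugations.\<close>

lemma om_regular:
  assumes D: "D \<subseteq> cutdom s" and x: "0 \<le> x"
  shows "regular_on D (\<lambda>z. om s z x)"
  unfolding regular_on_def
proof
  have "continuous_on D (\<lambda>z. if s then - \<i> * usqrt ((z - of_real (q x)) / of_real (p x))
      else cnj (- \<i> * usqrt ((cnj z - of_real (q x)) / of_real (p x))))"
    using p_pos[OF x]
    by (cases s) (auto intro!: continuous_intros continuous_on_compose2[OF continuous_on_usqrt[of UNIV]])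
  then show "continuous_on D (\<lambda>z. om s z x)"
    by (rule continuous_on_eq) (use om_eq_usqrt D x in auto)
  have up: "(\<lambda>z. - \<i> * csqrt ((z - of_real (q x)) / of_real (p x))) holomorphic_on {z. 0 < Im z}"
    using p_pos[OF x] by (intro holomorphic_intros) (auto elim!: nonpos_Reals_cases simp: complex_eq_iff)
  have "(\<lambda>z. om s z x) holomorphic_on (if s then {z. 0 < Im z} else {z. Im z < 0})"
  proof (cases s)
    case True
    then show ?thesis using up by (simp add: omega_def)
  next
    case False
    have "cnj ` {z. Im z < 0} \<subseteq> {z. 0 < Im z}" by auto
    then have "cnj \<circ> (\<lambda>z. - \<i> * csqrt ((z - of_real (q x)) / of_real (p x))) \<circ> cnj holomorphic_on {z. Im z < 0}"
      by (intro holomorphic_on_compose_cnj_cnj holomorphic_on_subset[OF up]) (auto simp: open_halfspace_Im_lt)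
    then show ?thesis using False by (simp add: omega_def o_def)
  qed
  then show "(\<lambda>z. om s z x) holomorphic_on interior D"
    using interior_cutdom_subset[OF D] by (rule holomorphic_on_subset)
qed

text \<open>The inequality t \<le> 1 + t^2 trades the square root for a bound affine in |q|, which
  is locally integrable even where q is merely integrable.\<close>

lemma om_bound:
  assumes l: "0 < l" "l \<le> p x" and x: "0 \<le> x" and z: "cmod z \<le> R"
  shows "cmod (om s z x) \<le> 1 + (\<bar>q x\<bar> + R) / l"
proof -
  have "(cmod (om s z x))\<^sup>2 \<le> (\<bar>q x\<bar> + R) / l"
    unfolding om_cmod_square[OF x]
    using norm_triangle_ineq4[of "of_real (q x)" z] z l norm_ge_zero[of z]
    by (intro frac_le) (simp_all del: norm_ge_zero)
  moreover have "cmod (om s z x) \<le> 1 + (cmod (om s z x))\<^sup>2"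
    using sum_power2_ge_zero[of "cmod (om s z x) - 1/2" 0] by (simp add: power2_eq_square algebra_simps)
  ultimately show ?thesis by linarith
qed

lemma om_dominated:
  obtains M where "\<And>x. 0 \<le> x \<Longrightarrow> 0 \<le> M x" "\<And>a b. 0 \<le> a \<Longrightarrow> M integrable_on {a..b}"
    "\<And>z x. cmod z \<le> R \<Longrightarrow> 0 \<le> x \<Longrightarrow> cmod (om s z x) \<le> M x"
proof -
  obtain l L where l: "0 < l" "\<And>x. 0 \<le> x \<Longrightarrow> l \<le> p x" using p_bounds by metis
  show ?thesis
  proof (rule that[of "\<lambda>x. 1 + (\<bar>q x\<bar> + \<bar>R\<bar>) / l"])
    show "0 \<le> 1 + (\<bar>q x\<bar> + \<bar>R\<bar>) / l" for x using l by simp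
    show "(\<lambda>x. 1 + (\<bar>q x\<bar> + \<bar>R\<bar>) / l) integrable_on {a..b}" if "0 \<le> a" for a b
      using q_abs[OF that, of b]
      by (intro integrable_add integrable_on_divide integrable_const_ivl) (auto simp: absolutely_integrable_on_def)
    show "cmod (om s z x) \<le> 1 + (\<bar>q x\<bar> + \<bar>R\<bar>) / l" if "cmod z \<le> R" "0 \<le> x" for z x
      using om_bound[OF l(1) l(2)[OF that(2)] that(2), of z "\<bar>R\<bar>"] that by simp
  qed
qed

lemma om_abs:
  assumes z: "z \<in> cutdom s" and a: "0 \<le> a"
  shows "om s z absolutely_integrable_on {a..b}"
proof -
  obtain M where M: "\<And>a b. 0 \<le> a \<Longrightarrow> M integrable_on {a..b}"
    "\<And>x. 0 \<le> x \<Longrightarrow> cmod (om s z x) \<le> M x"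
    using om_dominated[of "cmod z" s] by (metis order_refl)
  have pm: "p \<in> borel_measurable (lebesgue_on {a..b})"
    using continuous_on_subset[OF p_cont, of "{a..b}"] a by (auto intro: continuous_imp_measurable_on_sets_lebesgue)
  have qm: "q \<in> borel_measurable (lebesgue_on {a..b})"
    using q_abs[OF a] by (auto intro: absolutely_integrable_imp_borel_measurable)
  have us: "(\<lambda>x. usqrt (f x)) \<in> borel_measurable (lebesgue_on {a..b})"
    if "f \<in> borel_measurable (lebesgue_on {a..b})" for f
    using measurable_compose[OF that borel_measurable_continuous_onI[OF continuous_on_usqrt]] .
  have cn: "(\<lambda>x. cnj (f x)) \<in> borel_measurable (lebesgue_on {a..b})"
    if "f \<in> borel_measurable (lebesgue_on {a..b})" for f
    using measurable_compose[OF that borel_measurable_continuous_onI[OF continuous_on_cnj[OF continuous_on_id]]] .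
  have of: "(\<lambda>x. complex_of_real (f x)) \<in> borel_measurable (lebesgue_on {a..b})"
    if "f \<in> borel_measurable (lebesgue_on {a..b})" for f
    using measurable_compose[OF that borel_measurable_continuous_onI[OF continuous_on_of_real[OF continuous_on_id]]] .
  have "(\<lambda>x. if s then - \<i> * usqrt ((z - of_real (q x)) / of_real (p x))
      else cnj (- \<i> * usqrt ((cnj z - of_real (q x)) / of_real (p x)))) \<in> borel_measurable (lebesgue_on {a..b})"
    by (cases s) (simp_all only: if_True if_False, (intro cn borel_measurable_times borel_measurable_const us
        borel_measurable_divide borel_measurable_diff of pm qm)+)
  moreover have "om s z x = (if s then - \<i> * usqrt ((z - of_real (q x)) / of_real (p x))
      else cnj (- \<i> * usqrt ((cnj z - of_real (q x)) / of_real (p x))))" if "x \<in> {a..b}" for x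
    using om_eq_usqrt[OF z] a that by simp
  ultimately have "om s z \<in> borel_measurable (lebesgue_on {a..b})"
    by (subst measurable_cong) auto
  then show ?thesis
    by (rule measurable_bounded_by_integrable_imp_absolutely_integrable[where g=M]) (use M a in auto)
qed

section \<open>The exponent Omega and the factor a\<close>

abbreviation Om :: "bool \<Rightarrow> complex \<Rightarrow> real \<Rightarrow> complex" where
  "Om s z x \<equiv> Omega p q s x z"

abbreviation aa :: "bool \<Rightarrow> complex \<Rightarrow> real \<Rightarrow> complex" where
  "aa s z x \<equiv> jost_a p q s x z"

lemma Om_ac:
  assumes z: "z \<in> cutdom s"
  shows "ac_deriv 0 (Om s z) (om s z)"
proof (rule ac_derivI)
  fix b :: real assume b: "0 \<le> b"
  show 1: "om s z absolutely_integrable_on {0..b}" by (rule om_abs[OF z]) simp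
  then show "(om s z has_integral Om s z b - Om s z 0) {0..b}"
    by (auto simp: Omega_def absolutely_integrable_on_def intro: integrable_integral)
qed

lemma Om_regular:
  assumes D: "D \<subseteq> cutdom s" "bounded D" and x: "0 \<le> x"
  shows "regular_on D (\<lambda>z. Om s z x)"
  unfolding Omega_def
proof -
  obtain R where R: "\<And>z. z \<in> D \<Longrightarrow> cmod z \<le> R" using D(2) by (auto simp: bounded_iff)
  obtain M where M: "\<And>a b. 0 \<le> a \<Longrightarrow> M integrable_on {a..b}"
    "\<And>z x. cmod z \<le> R \<Longrightarrow> 0 \<le> x \<Longrightarrow> cmod (om s z x) \<le> M x"
    using om_dominated[of R s] by metis
  show "regular_on D (\<lambda>z. integral {0..x} (om s z))"
  proof (rule regular_on_integral[where M=M])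
    show "om s z integrable_on {0..x}" if "z \<in> D" for z
      using om_abs[of z s 0 x] that D by (auto simp: absolutely_integrable_on_def)
  qed (use M R D om_regular in auto)
qed

lemma aa_nonzero: "aa s z x \<noteq> 0"
  by (simp add: jost_a_def)

lemma aa_regular:
  assumes "D \<subseteq> cutdom s" "bounded D" "0 \<le> x"
  shows "regular_on D (\<lambda>z. aa s z x)"
  unfolding jost_a_def by (intro regular_on_exp regular_on_minus Om_regular assms)

text \<open>The real part of Omega is nondecreasing. This is the decay that holds uniformly up to
  the cut: it bounds |a(y) / a(t)| by 1 for t \<le> y.\<close>

lemma aa_antimono:
  assumes z: "z \<in> cutdom s" and x: "0 \<le> x" "x \<le> y"
  shows "cmod (aa s z y) \<le> cmod (aa s z x)"
proof -
  have "((\<lambda>t. Re (om s z t)) has_integral Re (Om s z y - Om s z x)) {x..y}"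
    using has_integral_linear[OF ac_deriv_has_integral[OF Om_ac[OF z] x] bounded_linear_Re] by (simp add: o_def)
  then have "0 \<le> Re (Om s z y - Om s z x)"
    by (rule has_integral_nonneg) (use om_Re_nonneg[OF z] x in auto)
  then show ?thesis by (simp add: jost_a_def)
qed

lemma aa_le_1:
  assumes "z \<in> cutdom s" "0 \<le> x"
  shows "cmod (aa s z x) \<le> 1"
  using aa_antimono[OF assms(1) _ assms(2)] by (simp add: jost_a_def Omega_def)

lemma aa_deriv:
  assumes z: "z \<in> cutdom s" and x: "x0 \<le> x"
  shows "(aa s z has_vector_derivative - om s z x * aa s z x) (at x within {x0..})"
proof -
  have "(Om s z has_vector_derivative om s z x) (at x within {x0..})"
    by (rule ac_deriv_imp_vector_derivative[OF ac_deriv_mono[OF Om_ac[OF z] x0_nonneg] om_cont[OF z] x])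
  then have "((\<lambda>x. - Om s z x) has_vector_derivative - om s z x) (at x within {x0..})"
    by (rule has_vector_derivative_minus)
  moreover have "(exp has_field_derivative exp (- Om s z x)) (at (- Om s z x))"
    by (rule DERIV_exp)
  ultimately have "(exp \<circ> (\<lambda>x. - Om s z x) has_vector_derivative - om s z x * exp (- Om s z x)) (at x within {x0..})"
    by (rule field_vector_diff_chain_within[OF _ has_field_derivative_at_within])
  then show ?thesis by (simp add: jost_a_def o_def)
qed

lemma aa_cont: "z \<in> cutdom s \<Longrightarrow> continuous_on {0..} (aa s z)"
  unfolding jost_a_def by (intro continuous_intros ac_deriv_continuous[OF Om_ac])

lemma aa_ac:
  assumes z: "z \<in> cutdom s"
  shows "ac_deriv x0 (aa s z) (\<lambda>x. - om s z x * aa s z x)"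
  by (rule ac_deriv_C1[OF aa_deriv[OF z]])
    (use x0_nonneg in \<open>auto intro!: continuous_intros om_cont[OF z] continuous_on_subset[OF aa_cont[OF z]]\<close>)

end

section \<open>The Jost kernel\<close>

lemma compact_cmod_bounds:
  assumes "compact D" "0 \<notin> D"
  obtains \<delta> R :: real where "0 < \<delta>" "\<And>z. z \<in> D \<Longrightarrow> \<delta> \<le> cmod z" "\<And>z. z \<in> D \<Longrightarrow> cmod z \<le> R"
proof -
  obtain \<delta> where "0 < \<delta>" "\<And>z. z \<in> D \<Longrightarrow> \<delta> \<le> cmod z"
    using separate_point_closed[OF compact_imp_closed[OF assms(1)] assms(2)] by auto
  moreover obtain R where "\<And>z. z \<in> D \<Longrightarrow> cmod z \<le> R"
    using compact_imp_bounded[OF assms(1)] by (auto simp: bounded_iff)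
  ultimately show ?thesis using that by blast
qed

text \<open>A compact piece of one sheet with a common starting point. The instance
  \<open>{z}\<close> with X = x1(z) is the setting of the integral equation in the statement; larger
  \<open>D\<close> give uniformity and regularity in z.\<close>

locale jost_domain = coefficients +
  fixes s :: bool and D :: "complex set" and X :: real
  assumes D_sub: "D \<subseteq> cutdom s" and D_compact: "compact D" and X_ge: "x0 \<le> X"
    and q_small: "z \<in> D \<Longrightarrow> X \<le> x \<Longrightarrow> \<bar>q x\<bar> \<le> cmod z / 2"
begin

lemma X_nonneg: "0 \<le> X"
  using X_ge x0_nonneg by simp

lemma D_cut: "z \<in> D \<Longrightarrow> z \<in> cutdom s"
  using D_sub by blast

abbreviation rr :: "complex \<Rightarrow> real \<Rightarrow> complex" where
  "rr z x \<equiv> rfun p q dp dq s x z"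

abbreviation hh :: "complex \<Rightarrow> real \<Rightarrow> complex" where
  "hh z x \<equiv> of_real (p x) * om s z x"

lemma qz_bounds:
  assumes "z \<in> D" "X \<le> x"
  shows "cmod z / 2 \<le> cmod (of_real (q x) - z)" "cmod (of_real (q x) - z) \<le> 3 * cmod z / 2"
  using q_small[OF assms] norm_triangle_ineq4[of "of_real (q x)" z] norm_triangle_ineq3[of z "of_real (q x)"]
  by (simp_all add: norm_minus_commute)

lemma hh_square: "X \<le> x \<Longrightarrow> (hh z x)\<^sup>2 = of_real (p x) * (of_real (q x) - z)"
  unfolding power_mult_distrib om_square using p_pos[of x] X_nonneg by (simp add: power2_eq_square)

lemma hh_nonzero:
  assumes "z \<in> D" "X \<le> x"
  shows "hh z x \<noteq> 0"
proof -
  have "cmod (of_real (q x) - z) > 0"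
    using qz_bounds(1)[OF assms] cutdom_nonzero[OF D_cut[OF assms(1)]] by (smt (verit) half_gt_zero zero_less_norm_iff)
  then have "(hh z x)\<^sup>2 \<noteq> 0"
    unfolding hh_square[OF assms(2)] using p_pos[of x] X_nonneg assms(2) by auto
  then show ?thesis by simp
qed

lemma om_nonzero: "z \<in> D \<Longrightarrow> X \<le> x \<Longrightarrow> om s z x \<noteq> 0"
  using hh_nonzero[of z x] by simp

text \<open>The square p (q - z) is absolutely continuous by the product rule, and \<open>hh\<close>
  is a continuous nonvanishing root of it. This justifies reading the explicit formula for r as the
  derivative of p omega.\<close>

lemma hh_ac:
  assumes z: "z \<in> D"
  shows "ac_deriv X (hh z) (rr z)"
proof -
  have pX: "ac_deriv X (\<lambda>x. complex_of_real (p x)) (\<lambda>x. of_real (dp x))"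
    by (rule ac_deriv_of_real[OF ac_deriv_mono[OF p_ac X_nonneg]])
  have qX: "ac_deriv X (\<lambda>x. complex_of_real (q x) - z) (\<lambda>x. of_real (dq x) - 0)"
    by (intro ac_deriv_diff ac_deriv_of_real[OF ac_deriv_mono[OF q_ac X_ge]] ac_deriv_const)
  have "ac_deriv X (\<lambda>x. (hh z x)\<^sup>2)
      (\<lambda>x. of_real (dp x) * (of_real (q x) - z) + of_real (p x) * of_real (dq x))"
    by (rule ac_deriv_cong[OF ac_deriv_mult[OF pX qX]]) (use hh_square in auto)
  moreover have "continuous_on {X..} (hh z)"
    using X_ge by (intro continuous_on_mult ac_deriv_continuous[OF pX]
        continuous_on_subset[OF om_cont[OF D_cut[OF z]]]) auto
  ultimately have "ac_deriv X (hh z)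
     (\<lambda>x. inverse (2 * hh z x) * (of_real (dp x) * (of_real (q x) - z) + of_real (p x) * of_real (dq x)))"
    by (rule ac_deriv_sqrt) (rule hh_nonzero[OF z])
  then show ?thesis
    by (rule ac_deriv_cong) (auto simp: rfun_def field_simps)
qed

abbreviation sg :: "real \<Rightarrow> real" where
  "sg y \<equiv> \<bar>dp y\<bar> + \<bar>dq y\<bar>"

lemma sg_abs: "sg absolutely_integrable_on {X..}"
  using absolutely_integrable_on_atLeast_subset(1)[OF dp_L1 X_nonneg]
    absolutely_integrable_on_atLeast_subset(1)[OF dq_L1 X_ge]
  by (intro set_integral_add set_integrable_abs)

lemma rr_abs_bound:
  obtains C where "0 \<le> C" "\<And>z x. z \<in> D \<Longrightarrow> X \<le> x \<Longrightarrow> cmod (rr z x) \<le> C * sg x"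
    "\<And>z x. z \<in> D \<Longrightarrow> X \<le> x \<Longrightarrow> cmod (inverse (hh z x)) \<le> C"
proof -
  obtain \<delta> R where d: "0 < \<delta>" "\<And>z. z \<in> D \<Longrightarrow> \<delta> \<le> cmod z" "\<And>z. z \<in> D \<Longrightarrow> cmod z \<le> R"
    using compact_cmod_bounds[OF D_compact] D_sub cutdom_nonzero by blast
  obtain l L where l: "0 < l" "\<And>x. 0 \<le> x \<Longrightarrow> l \<le> p x" "\<And>x. 0 \<le> x \<Longrightarrow> p x \<le> L"
    using p_bounds by metis
  \<comment> \<open>Lower bound for |p omega|: its square is p |q - z|, where p \<ge> l and |q - z|
    \<ge> |z| / 2 \<ge> \<delta> / 2.\<close>
  define \<eta> where "\<eta> = sqrt (l * (\<delta> / 2))"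
  have \<eta>: "0 < \<eta>" using l d by (simp add: \<eta>_def)
  have hb: "\<eta> \<le> cmod (hh z x)" if "z \<in> D" "X \<le> x" for z x
  proof -
    have x: "0 \<le> x" using that X_nonneg by simp
    have "(cmod (hh z x))\<^sup>2 = p x * cmod (of_real (q x) - z)"
      using arg_cong[OF hh_square[OF that(2), of z], of cmod] p_pos[OF x] by (simp add: norm_power norm_mult)
    moreover have "l * (\<delta>/2) \<le> p x * cmod (of_real (q x) - z)"
      using l(1) l(2)[OF x] d(1) d(2)[OF that(1)] qz_bounds(1)[OF that]
      by (intro mult_mono) auto
    ultimately show ?thesis
      unfolding \<eta>_def by (intro real_le_lsqrt) auto
  qed
  \<comment> \<open>The first entry bounds 1 / (p omega). In the second, p \<le> L and |q - z| \<le>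
    3 |z| / 2 control the numerator of r, and 2 \<eta> bounds its denominator from below.\<close>
  define C where "C = max (1/\<eta>) ((\<bar>L\<bar> + 3 * \<bar>R\<bar> / 2) / (2*\<eta>))"
  show ?thesis
  proof (rule that[of C])
    show "0 \<le> C" using \<eta> by (simp add: C_def le_max_iff_disj)
    fix z x assume zx: "z \<in> D" "X \<le> x"
    have x: "0 \<le> x" using zx X_nonneg by simp
    have "cmod (inverse (hh z x)) \<le> 1/\<eta>"
      unfolding norm_inverse divide_inverse mult_1_left using hb[OF zx] \<eta> by (intro le_imp_inverse_le)
    then show "cmod (inverse (hh z x)) \<le> C" by (simp add: C_def)
    have "cmod (rr z x) = cmod (of_real (dp x) * (of_real (q x) - z) + of_real (p x) * of_real (dq x)) / (2 * cmod (hh z x))"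
      by (simp add: rfun_def norm_divide norm_mult)
    also have "\<dots> \<le> (\<bar>L\<bar> + 3 * \<bar>R\<bar> / 2) * sg x / (2*\<eta>)"
    proof (intro frac_le mult_left_mono hb zx)
      have "cmod (of_real (dp x) * (of_real (q x) - z) + of_real (p x) * of_real (dq x))
        \<le> \<bar>dp x\<bar> * cmod (of_real (q x) - z) + \<bar>p x\<bar> * \<bar>dq x\<bar>"
        using norm_triangle_ineq[of "of_real (dp x) * (of_real (q x) - z)" "of_real (p x) * of_real (dq x)"]
        by (simp add: norm_mult)
      also have "\<dots> \<le> \<bar>dp x\<bar> * (\<bar>L\<bar> + 3 * \<bar>R\<bar> / 2) + (\<bar>L\<bar> + 3 * \<bar>R\<bar> / 2) * \<bar>dq x\<bar>"
        using qz_bounds(2)[OF zx] d(3)[OF zx(1)] l(3)[OF x] p_pos[OF x]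
        by (intro add_mono mult_left_mono mult_right_mono) auto
      also have "\<dots> = (\<bar>L\<bar> + 3 * \<bar>R\<bar> / 2) * sg x"
        by (simp add: algebra_simps)
      finally show "cmod (of_real (dp x) * (of_real (q x) - z) + of_real (p x) * of_real (dq x))
        \<le> (\<bar>L\<bar> + 3 * \<bar>R\<bar> / 2) * sg x" .
    qed (use \<eta> in auto)
    also have "\<dots> = (\<bar>L\<bar> + 3 * \<bar>R\<bar> / 2) / (2*\<eta>) * sg x" by simp
    also have "\<dots> \<le> C * sg x"
      by (rule mult_right_mono) (auto simp: C_def)
    finally show "cmod (rr z x) \<le> C * sg x" .
  qed
qed

definition Sj' :: "complex \<Rightarrow> real \<Rightarrow> complex" where
  "Sj' z t = inverse (of_real (p t) * (aa s z t)\<^sup>2)"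

text \<open>A primitive of 1 / (p a^2) normalised at \<open>X\<close>. Only its differences enter
  the kernel: G(x,y) = a(y)^2 (S(y) - S(x)) brings the Jost equation into Volterra form.\<close>

definition Sj :: "complex \<Rightarrow> real \<Rightarrow> complex" where
  "Sj z x = integral {X..x} (Sj' z)"

definition gj :: "complex \<Rightarrow> real \<Rightarrow> complex" where
  "gj z y = (aa s z y)\<^sup>2 * rr z y"

lemma Sj'_cont: 
  assumes "z \<in> D"
  shows "continuous_on {X..} (Sj' z)"
proof -
  have "\<forall>x\<in>{X..}. complex_of_real (p x) * (aa s z x)\<^sup>2 \<noteq> 0"
    using p_pos X_nonneg aa_nonzero by (metis atLeast_iff less_irrefl mult_eq_0_iff of_real_eq_0_iff order_trans power_not_zero)
  then show ?thesis
    unfolding Sj'_def using X_nonneg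
    by (intro continuous_intros continuous_on_subset[OF p_cont] continuous_on_subset[OF aa_cont[OF D_cut[OF assms]]]) auto
qed

lemma Sj_ac:
  assumes "z \<in> D"
  shows "ac_deriv X (Sj z) (Sj' z)"
proof (rule ac_derivI)
  fix b assume "X \<le> b"
  show 1: "Sj' z absolutely_integrable_on {X..b}"
    by (rule absolutely_integrable_continuous_real) (rule continuous_on_subset[OF Sj'_cont[OF assms]], auto)
  then show "(Sj' z has_integral Sj z b - Sj z X) {X..b}"
    by (auto simp: Sj_def absolutely_integrable_on_def intro: integrable_integral)
qed

lemma kernel_eq:
  assumes "z \<in> D" "X \<le> x" "x \<le> y"
  shows "(Sj z y - Sj z x) * gj z y = Gfun p q s x y z * rr z y"
proof -
  have "Sj z y - Sj z x = integral {x..y} (Sj' z)"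
    using ac_deriv_integral[OF Sj_ac[OF assms(1)] assms(2,3)] by simp
  then show ?thesis
    unfolding Gfun_def gj_def by (simp add: Sj'_def[abs_def])
qed

text \<open>Integration by parts against the oscillating factor: since \<open>(a\<^sup>-\<^sup>2)' = 2 \<omega> a\<^sup>-\<^sup>2\<close>, the integral
  of \<open>1 / (p a\<^sup>2)\<close> gains the factor \<open>1 / (2 p \<omega>)\<close>, and the remainder carries \<open>r\<close>.\<close>

lemma Gfun_bounded:
  obtains C where "0 \<le> C" "\<And>z x y. z \<in> D \<Longrightarrow> X \<le> x \<Longrightarrow> x \<le> y \<Longrightarrow> cmod (Gfun p q s x y z) \<le> C"
proof -
  obtain C where C: "0 \<le> C" "\<And>z x. z \<in> D \<Longrightarrow> X \<le> x \<Longrightarrow> cmod (rr z x) \<le> C * sg x"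
    "\<And>z x. z \<in> D \<Longrightarrow> X \<le> x \<Longrightarrow> cmod (inverse (hh z x)) \<le> C"
    using rr_abs_bound by blast
  have sg0: "0 \<le> integral {X..} sg"
    by (rule integral_tail_nonneg[OF sg_abs]) auto
  show ?thesis
  \<comment> \<open>Each boundary term of the integration by parts is at most \<open>C\<close>; in
    the remainder 1 / (p omega)^2 contributes C^2 and r contributes \<open>C * sg\<close>. The sum
    of these bounds controls 2 G, whence the constant for G.\<close>
  proof (rule that[of "C + C^3 * integral {X..} sg"])
    show "0 \<le> C + C^3 * integral {X..} sg" using C sg0 by simp
    fix z x y assume z: "z \<in> D" and x: "X \<le> x" and y: "x \<le> y"
    let ?a = "aa s z"
    let ?b = "\<lambda>t. inverse ((?a t)\<^sup>2)"
    have aX: "ac_deriv X ?a (\<lambda>x. - om s z x * ?a x)"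
      by (rule ac_deriv_mono[OF aa_ac[OF D_cut[OF z]] X_ge])
    have "ac_deriv X (\<lambda>x. ?a x * ?a x) (\<lambda>x. - om s z x * ?a x * ?a x + ?a x * (- om s z x * ?a x))"
      by (rule ac_deriv_mult[OF aX aX])
    from ac_deriv_cong[OF ac_deriv_inverse[OF this]]
    have b: "ac_deriv X ?b (\<lambda>x. 2 * om s z x * ?b x)"
      using aa_nonzero by (simp add: power2_eq_square field_simps)
    have "ac_deriv X (\<lambda>x. ?b x * inverse (hh z x)) (\<lambda>x. 2 * om s z x * ?b x * inverse (hh z x)
        + ?b x * (- inverse ((hh z x)\<^sup>2) * rr z x))"
      by (rule ac_deriv_mult[OF b ac_deriv_inverse[OF hh_ac[OF z] hh_nonzero[OF z]]])
    then have "ac_deriv X (\<lambda>x. ?b x * inverse (hh z x)) (\<lambda>x. 2 * Sj' z x - ?b x * (inverse ((hh z x)\<^sup>2) * rr z x))"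
    proof (rule ac_deriv_cong)
      fix x assume "X \<le> x"
      then show "2 * om s z x * ?b x * inverse (hh z x) + ?b x * (- inverse ((hh z x)\<^sup>2) * rr z x)
        = 2 * Sj' z x - ?b x * (inverse ((hh z x)\<^sup>2) * rr z x)"
        using om_nonzero[OF z, of x] by (simp add: Sj'_def)
    qed simp
    from ac_deriv_has_integral[OF this x y]
    have I: "((\<lambda>t. 2 * Sj' z t - ?b t * (inverse ((hh z t)\<^sup>2) * rr z t)) has_integral
        ?b y * inverse (hh z y) - ?b x * inverse (hh z x)) {x..y}" .
    have "(Sj' z has_integral Sj z y - Sj z x) {x..y}"
      by (rule ac_deriv_has_integral[OF Sj_ac[OF z] x y])
    from has_integral_diff[OF has_integral_mult_right[OF this, of 2] I]
    have J: "((\<lambda>t. ?b t * (inverse ((hh z t)\<^sup>2) * rr z t)) has_integral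
        2 * (Sj z y - Sj z x) - (?b y * inverse (hh z y) - ?b x * inverse (hh z x))) {x..y}" by simp
    from has_integral_mult_right[OF this, of "(?a y)\<^sup>2"]
    have J2: "((\<lambda>t. (?a y)\<^sup>2 * (?b t * (inverse ((hh z t)\<^sup>2) * rr z t))) has_integral
        (?a y)\<^sup>2 * (2 * (Sj z y - Sj z x) - (?b y * inverse (hh z y) - ?b x * inverse (hh z x)))) {x..y}" .
    have ab: "cmod ((?a y)\<^sup>2 * ?b t) \<le> 1" if "X \<le> t" "t \<le> y" for t
    proof -
      have "cmod (?a y) \<le> cmod (?a t)"
        by (rule aa_antimono[OF D_cut[OF z]]) (use that X_nonneg in auto)
      then have "cmod (?a y)^2 \<le> cmod (?a t)^2" by (rule power_mono) simp
      then show ?thesis using aa_nonzero[of s t z]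
        unfolding norm_mult norm_inverse norm_power by (simp add: field_simps)
    qed
    have "cmod ((?a y)\<^sup>2 * (2 * (Sj z y - Sj z x) - (?b y * inverse (hh z y) - ?b x * inverse (hh z x))))
      \<le> integral {x..y} (\<lambda>t. C^3 * sg t)"
      unfolding integral_unique[OF J2, symmetric]
    proof (rule Henstock_Kurzweil_Integration.integral_norm_bound_integral)
      show "(\<lambda>t. (?a y)\<^sup>2 * (?b t * (inverse ((hh z t)\<^sup>2) * rr z t))) integrable_on {x..y}"
        using J2 by blast
      show "(\<lambda>t. C^3 * sg t) integrable_on {x..y}"
        using absolutely_integrable_on_atLeast_subset(4)[OF sg_abs x] by (rule integrable_on_mult_right)
      fix t assume t: "t \<in> {x..y}"
      have "cmod ((?a y)\<^sup>2 * (?b t * (inverse ((hh z t)\<^sup>2) * rr z t)))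
        = cmod ((?a y)\<^sup>2 * ?b t) * ((cmod (inverse (hh z t)))^2 * cmod (rr z t))"
        by (simp only: norm_mult norm_power norm_inverse power_inverse mult.assoc)
      also have "\<dots> \<le> 1 * (C^2 * (C * sg t))"
        using t x z by (intro mult_mono power_mono ab C(2) C(3)) auto
      finally show "cmod ((?a y)\<^sup>2 * (?b t * (inverse ((hh z t)\<^sup>2) * rr z t))) \<le> C^3 * sg t"
        by (simp add: power3_eq_cube power2_eq_square mult_ac)
    qed
    also have "\<dots> = C^3 * integral {x..y} sg" by simp
    also have "\<dots> \<le> C^3 * integral {X..} sg"
    proof (rule mult_left_mono)
      show "integral {x..y} sg \<le> integral {X..} sg"
        by (rule integral_subset_le)
          (use x absolutely_integrable_on_atLeast_subset(3,4)[OF sg_abs] in auto)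
    qed (use C in simp)
    finally have 1: "cmod ((?a y)\<^sup>2 * (2 * (Sj z y - Sj z x) - (?b y * inverse (hh z y) - ?b x * inverse (hh z x))))
      \<le> C^3 * integral {X..} sg" .
    have 2: "cmod ((?a y)\<^sup>2 * ?b t * inverse (hh z t)) \<le> C" if "X \<le> t" "t \<le> y" for t
      using mult_mono[OF ab[OF that] C(3)[OF z that(1)]] by (simp add: norm_mult del: inverse_mult_distrib)
    have G: "Gfun p q s x y z = (?a y)\<^sup>2 * (Sj z y - Sj z x)"
      using ac_deriv_integral[OF Sj_ac[OF z] x y] by (simp add: Gfun_def Sj'_def[abs_def])
    have G2: "2 * Gfun p q s x y z = (?a y)\<^sup>2 * (2 * (Sj z y - Sj z x) - (?b y * inverse (hh z y) - ?b x * inverse (hh z x)))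
       + (?a y)\<^sup>2 * ?b y * inverse (hh z y) - (?a y)\<^sup>2 * ?b x * inverse (hh z x)"
      unfolding G by (simp only: algebra_simps)
    have "cmod (2 * Gfun p q s x y z) \<le> C^3 * integral {X..} sg + C + C"
      unfolding G2
      by (rule norm_triangle_le_diff, rule add_mono, rule norm_triangle_le, rule add_mono)
        (use 1 2[of y] 2[of x] x y in auto)
    then have "2 * cmod (Gfun p q s x y z) \<le> C^3 * integral {X..} sg + C + C"
      unfolding norm_mult norm_numeral .
    moreover have "0 \<le> C^3 * integral {X..} sg"
      by (intro mult_nonneg_nonneg zero_le_power C(1) sg0)
    ultimately show "cmod (Gfun p q s x y z) \<le> C + C^3 * integral {X..} sg"
      by linarith
  qed
qed

lemma rr_measurable:
  assumes "z \<in> D"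
  shows "rr z \<in> borel_measurable (lebesgue_on {X..})"
proof -
  have of: "(\<lambda>x. complex_of_real (f x)) \<in> borel_measurable (lebesgue_on {X..})"
    if "f \<in> borel_measurable (lebesgue_on {X..})" for f
    using measurable_compose[OF that borel_measurable_continuous_onI[OF continuous_on_of_real[OF continuous_on_id]]] .
  have 1: "p \<in> borel_measurable (lebesgue_on {X..})" "q \<in> borel_measurable (lebesgue_on {X..})"
    "om s z \<in> borel_measurable (lebesgue_on {X..})"
    using X_nonneg X_ge continuous_on_subset[OF p_cont] continuous_on_subset[OF q_cont]
      continuous_on_subset[OF om_cont[OF D_cut[OF assms]]]
    by (auto intro!: continuous_imp_measurable_on_sets_lebesgue)
  have 2: "dp \<in> borel_measurable (lebesgue_on {X..})" "dq \<in> borel_measurable (lebesgue_on {X..})"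
    using absolutely_integrable_on_atLeast_subset(1)[OF dp_L1 X_nonneg]
      absolutely_integrable_on_atLeast_subset(1)[OF dq_L1 X_ge]
    by (auto intro: absolutely_integrable_imp_borel_measurable)
  show ?thesis
    unfolding rfun_def
    by (intro borel_measurable_divide borel_measurable_add borel_measurable_times borel_measurable_diff
        borel_measurable_const of 1 2)
qed

text \<open>S' contains a^-2, so a majorant uniform over \<open>D\<close> requires a lower bound for
  |a|. At fixed \<open>x\<close> compactness of \<open>D\<close> supplies it, as a never
  vanishes.\<close>

lemma aa_bounded_below:
  assumes x: "0 \<le> x"
  obtains c where "0 < c" "\<And>z. z \<in> D \<Longrightarrow> c \<le> cmod (aa s z x)"
proof (cases "D = {}")
  case True
  then show ?thesis using that[of 1] by simp
next
  case False
  have "continuous_on D (\<lambda>z. cmod (aa s z x))"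
    using aa_regular[OF D_sub compact_imp_bounded[OF D_compact] x] by (auto simp: regular_on_def intro: continuous_intros)
  from continuous_attains_inf[OF D_compact False this] obtain w where
    "w \<in> D" "\<And>z. z \<in> D \<Longrightarrow> cmod (aa s w x) \<le> cmod (aa s z x)" by auto
  then show ?thesis using that[of "cmod (aa s w x)"] aa_nonzero by simp
qed

lemma Sj'_regular:
  assumes "X \<le> x"
  shows "regular_on D (\<lambda>z. Sj' z x)"
  unfolding Sj'_def
  using assms X_nonneg p_pos[of x] aa_nonzero
  by (intro regular_on_inverse regular_on_mult regular_on_const regular_on_power
      aa_regular[OF D_sub compact_imp_bounded[OF D_compact]]) auto

lemma Sj_regular:
  assumes x: "X \<le> x"
  shows "regular_on D (\<lambda>z. Sj z x)"
  unfolding Sj_def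
proof -
  obtain l L where l: "0 < l" "\<And>x. 0 \<le> x \<Longrightarrow> l \<le> p x" using p_bounds by metis
  obtain c where c: "0 < c" "\<And>z. z \<in> D \<Longrightarrow> c \<le> cmod (aa s z x)"
    using aa_bounded_below[of x] x X_nonneg by auto
  show "regular_on D (\<lambda>z. integral {X..x} (Sj' z))"
  proof (rule regular_on_integral[where M = "\<lambda>_. inverse (l * c\<^sup>2)"])
    show "Sj' z integrable_on {X..x}" if "z \<in> D" for z
      using ac_deriv_abs[OF Sj_ac[OF that]] by (simp add: absolutely_integrable_on_def)
    fix z y assume zy: "z \<in> D" "y \<in> {X..x}"
    have y: "0 \<le> y" using zy X_nonneg by simp
    \<comment> \<open>As |a| is nonincreasing in x, the lower bound at the right endpoint serves the
      whole interval.\<close>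
    have "c \<le> cmod (aa s z y)"
      using c(2)[OF zy(1)] aa_antimono[OF D_cut[OF zy(1)] y, of x] zy by auto
    then have "l * c\<^sup>2 \<le> p y * (cmod (aa s z y))\<^sup>2"
      using l(1) l(2)[OF y] c(1) by (intro mult_mono power_mono) auto
    then have "inverse (p y * (cmod (aa s z y))\<^sup>2) \<le> inverse (l * c\<^sup>2)"
      using l(1) c(1) by (intro le_imp_inverse_le) auto
    then show "cmod (Sj' z y) \<le> inverse (l * c\<^sup>2)"
      using p_pos[OF y] by (simp add: Sj'_def norm_mult norm_inverse norm_power)
  qed (use Sj'_regular in auto)
qed

lemma rr_regular:
  assumes "X \<le> x"
  shows "regular_on D (\<lambda>z. rr z x)"
proof -
  have "regular_on D (\<lambda>z. (of_real (dp x) * (of_real (q x) - z) + of_real (p x) * of_real (dq x))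
     * inverse (2 * of_real (p x) * om s z x))"
    using assms X_nonneg p_pos[of x] om_nonzero
    by (intro regular_on_mult regular_on_add regular_on_diff regular_on_const regular_on_ident
        regular_on_inverse om_regular[OF D_sub]) auto
  then show ?thesis unfolding rfun_def divide_inverse .
qed

lemma jost_volterra:
  obtains C where "0 \<le> C" "volterra X D Sj Sj' gj (\<lambda>y. C * sg y)"
proof -
  obtain C where C: "0 \<le> C" "\<And>z x. z \<in> D \<Longrightarrow> X \<le> x \<Longrightarrow> cmod (rr z x) \<le> C * sg x"
    "\<And>z x. z \<in> D \<Longrightarrow> X \<le> x \<Longrightarrow> cmod (inverse (hh z x)) \<le> C"
    using rr_abs_bound by blast
  obtain G where G: "0 \<le> G" "\<And>z x y. z \<in> D \<Longrightarrow> X \<le> x \<Longrightarrow> x \<le> y \<Longrightarrow> cmod (Gfun p q s x y z) \<le> G"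
    using Gfun_bounded by blast
  have g: "cmod (gj z y) \<le> C * sg y" if "z \<in> D" "X \<le> y" for z y
  proof -
    have "cmod (aa s z y) ^ 2 \<le> 1"
      using aa_le_1[OF D_cut[OF that(1)], of y] that X_nonneg by (simp add: power_le_one)
    from mult_mono[OF this C(2)[OF that]] show ?thesis by (simp add: gj_def norm_mult norm_power)
  qed
  have gint: "gj z absolutely_integrable_on {X..}" if "z \<in> D" for z
  proof (rule measurable_bounded_by_integrable_imp_absolutely_integrable)
    show "gj z \<in> borel_measurable (lebesgue_on {X..})"
      unfolding gj_def using X_nonneg
      by (intro borel_measurable_times borel_measurable_power rr_measurable[OF that]
          continuous_imp_measurable_on_sets_lebesgue continuous_on_subset[OF aa_cont[OF D_cut[OF that]]]) auto
    show "(\<lambda>y. C * sg y) integrable_on {X..}"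
      using absolutely_integrable_on_atLeast_subset(3)[OF sg_abs order_refl] by (rule integrable_on_mult_right)
  qed (use g that in auto)
  show ?thesis
  \<comment> \<open>The factor \<open>1 + G\<close> lets one density dominate both the kernel,
    through the bound \<open>G\<close> on \<open>Gfun\<close>, and \<open>gj\<close> alone.\<close>
  proof (rule that[of "(1 + G) * C"])
    show "0 \<le> (1 + G) * C" using C G by simp
    show "volterra X D Sj Sj' gj (\<lambda>y. (1 + G) * C * sg y)"
    proof
      show "(\<lambda>y. (1 + G) * C * sg y) absolutely_integrable_on {X..}"
        using absolutely_integrable_scaleR_left[OF sg_abs, of "(1 + G) * C"] by simp
      show "0 \<le> (1 + G) * C * sg y" for y using C G by simp
      show "cmod ((Sj z y - Sj z x) * gj z y) \<le> (1 + G) * C * sg y" if "z \<in> D" "X \<le> x" "x \<le> y" for z x y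
      proof -
        have "cmod (Gfun p q s x y z) * cmod (rr z y) \<le> (1 + G) * (C * sg y)"
          using G(1) G(2)[OF that] C(2)[OF that(1), of y] that by (intro mult_mono) auto
        then show ?thesis by (simp add: kernel_eq[OF that] norm_mult)
      qed
      show "cmod (gj z y) \<le> (1 + G) * C * sg y" if "z \<in> D" "X \<le> y" for z y
        using g[OF that] mult_right_mono[of 1 "1 + G" "C * sg y"] C(1) G(1) by (simp add: mult.assoc)
      show "regular_on D (\<lambda>z. gj z x)" if "X \<le> x" for x
        unfolding gj_def using that X_nonneg
        by (intro regular_on_mult regular_on_power rr_regular aa_regular[OF D_sub compact_imp_bounded[OF D_compact]]) auto
    qed (use Sj_ac Sj'_cont gint Sj_regular in auto)
  qed
qed

end

section \<open>Construction and uniqueness of the Jost solution\<close>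

lemma absolutely_integrable_cut:
  fixes f :: "real \<Rightarrow> 'a::euclidean_space"
  assumes "f absolutely_integrable_on {0..N}"
  shows "(\<lambda>y. if y < N then f y else 0) absolutely_integrable_on {0..}"
proof -
  have "set_integrable lebesgue {0..<N} f"
    using assms by (rule set_integrable_subset) auto
  then show ?thesis
    unfolding set_integrable_def
    by (rule Bochner_Integration.integrable_cong[THEN iffD1, rotated -1]) (auto simp: indicator_def)
qed

lemma regular_on_compact_bounded:
  assumes "regular_on D f" "compact D"
  obtains M where "\<And>z. z \<in> D \<Longrightarrow> cmod (f z) \<le> M"
proof -
  have "bounded (f ` D)"
    using assms by (auto simp: regular_on_def intro: compact_imp_bounded compact_continuous_image)
  then show ?thesis using that by (auto simp: bounded_iff)
qed

section \<open>The solution near infinity and its quasi-derivative\<close>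

context jost_domain
begin

text \<open>\<open>W\<close> is the quasi-derivative p (a u)'. It is the quantity that the equation
  differentiates, and its value at \<open>X\<close>, together with that of a u, determines the
  continuation to the left.\<close>

lemma half_line_solution:
  obtains u W C where
    "\<And>z x. z \<in> D \<Longrightarrow> X \<le> x \<Longrightarrow> cmod (u z x) \<le> C"
    "\<And>z x. z \<in> D \<Longrightarrow> X \<le> x \<Longrightarrow> (\<lambda>y. Gfun p q s x y z * rr z y * u z y) integrable_on {x..}"
    "\<And>z x. z \<in> D \<Longrightarrow> X \<le> x \<Longrightarrow> u z x = 1 + integral {x..} (\<lambda>y. Gfun p q s x y z * rr z y * u z y)"
    "\<And>z x. z \<in> D \<Longrightarrow> X \<le> x \<Longrightarrow> cmod (u z x - 1) \<le> C * epsf dp dq x"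
    "\<And>z x. z \<in> D \<Longrightarrow> X \<le> x \<Longrightarrow>
       ((\<lambda>x. aa s z x * u z x) has_vector_derivative inverse (of_real (p x)) * W z x) (at x within {X..})"
    "\<And>z. z \<in> D \<Longrightarrow> ac_deriv X (W z) (\<lambda>x. (of_real (q x) - z) * (aa s z x * u z x))"
    "\<And>x. X \<le> x \<Longrightarrow> regular_on D (\<lambda>z. u z x)"
    "\<And>x. X \<le> x \<Longrightarrow> regular_on D (\<lambda>z. W z x)"
proof -
  obtain c where c: "0 \<le> c" "volterra X D Sj Sj' gj (\<lambda>y. c * sg y)"
    using jost_volterra by blast
  interpret V: volterra X D Sj Sj' gj "\<lambda>y. c * sg y" by (rule c(2))
  obtain u where u: "\<And>z. z \<in> D \<Longrightarrow> continuous_on {X..} (u z)"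
    "\<And>z x. z \<in> D \<Longrightarrow> X \<le> x \<Longrightarrow> cmod (u z x) \<le> 1 * exp (V.m X)"
    "\<And>z x. z \<in> D \<Longrightarrow> X \<le> x \<Longrightarrow> u z x = 1 + V.T z (u z) x"
    "\<And>x. X \<le> x \<Longrightarrow> regular_on D (\<lambda>z. u z x)"
    by (rule V.solution_exists[of "\<lambda>_ _. 1" 1]) (auto intro: regular_on_const)
  define B where "B = (\<lambda>z x. integral {x..} (\<lambda>y. gj z y * u z y))"
  \<comment> \<open>From u' = - B / (p a^2) and a' = - omega a one gets p (a u)' = - B / a - p omega
    a u.\<close>
  define W where "W = (\<lambda>z x. - (inverse (aa s z x) * B z x) - hh z x * (aa s z x * u z x))"
  define e where "e = exp (V.m X)"
  have ub: "cmod (u z x) \<le> e" if "z \<in> D" "X \<le> x" for z x using u(2)[OF that] by (simp add: e_def)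
  have K: "(\<lambda>y. (Sj z y - Sj z x) * gj z y * u z y) integrable_on {x..}" if "z \<in> D" "X \<le> x" for z x
    using V.kernel_integrable[OF that(1) u(1)[OF that(1)] ub[OF that(1)] that(2)]
    by (simp add: absolutely_integrable_on_def)
  have KG: "(Sj z y - Sj z x) * gj z y * u z y = Gfun p q s x y z * rr z y * u z y"
    if "z \<in> D" "X \<le> x" "y \<in> {x..}" for z x y
    using kernel_eq[OF that(1,2), of y] that(3) by simp
  have TG: "V.T z (u z) x = integral {x..} (\<lambda>y. Gfun p q s x y z * rr z y * u z y)" if "z \<in> D" "X \<le> x" for z x
    unfolding V.T_def by (rule Henstock_Kurzweil_Integration.integral_cong) (use KG that in auto)
  \<comment> \<open>The asymptotics are the case n = 0 of the power bound: u - 1 = T u and m(x) = c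
    eps(x).\<close>
  have udiff: "cmod (u z x - 1) \<le> e * c * epsf dp dq x" if "z \<in> D" "X \<le> x" for z x
  proof -
    have "cmod (V.T z (u z) x) \<le> e * (V.m x ^ Suc 0 / real (Suc 0))"
      by (rule V.kernel_power_bound[OF that K[OF that]]) (use ub that in \<open>auto simp: e_def\<close>)
    then show ?thesis
      using u(3)[OF that] by (simp add: V.m_def epsf_def)
  qed
  define S where "S = (\<lambda>z x. - Sj' z x * B z x)"
  have ud: "(u z has_vector_derivative S z x) (at x within {X..})" if "z \<in> D" "X \<le> x" for z x
  proof -
    have "((\<lambda>x. 1 + V.T z (u z) x) has_vector_derivative S z x) (at x within {X..})"
      using has_vector_derivative_add[OF has_vector_derivative_const
          V.T_has_vector_derivative[OF that(1) u(1)[OF that(1)] ub[OF that(1)] that(2)]]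
      by (simp add: S_def B_def)
    then show ?thesis
      by (rule has_vector_derivative_transform[rotated 2]) (use u(3) that in auto)
  qed
  have Bac: "ac_deriv X (B z) (\<lambda>x. - (gj z x * u z x))" if "z \<in> D" for z
    unfolding B_def by (rule ac_deriv_tail[OF V.gv_integrable[OF that u(1)[OF that] ub[OF that] order_refl]])
  have uac: "ac_deriv X (u z) (S z)" if "z \<in> D" for z
    unfolding S_def by (rule ac_deriv_C1[OF ud[OF that, unfolded S_def]])
      (auto intro!: continuous_intros Sj'_cont that ac_deriv_continuous[OF Bac[OF that]])
  \<comment> \<open>In the derivative of \<open>W\<close> the two terms with r cancel, and so do the
    two terms omega B / a; what survives is p omega^2 a u = (q - z) a u, which is the differential
    equation.\<close>
  have alg: "p \<noteq> 0 \<Longrightarrow> a \<noteq> 0 \<Longrightarrow> w\<^sup>2 = Q / p \<Longrightarrow>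
      - (- inverse (a\<^sup>2) * (- w * a) * b + inverse a * - (a\<^sup>2 * r * v))
      - (r * (a * v) + p * w * (- w * a * v + a * (- inverse (p * a\<^sup>2) * b))) = Q * (a * v)"
    for p a w b r v Q :: complex
  proof -
    assume nz: "p \<noteq> 0" "a \<noteq> 0" and w: "w\<^sup>2 = Q / p"
    have "- (- inverse (a\<^sup>2) * (- w * a) * b + inverse a * - (a\<^sup>2 * r * v))
      - (r * (a * v) + p * w * (- w * a * v + a * (- inverse (p * a\<^sup>2) * b))) = p * w\<^sup>2 * (a * v)"
      using nz by (simp add: field_simps power2_eq_square)
    then show ?thesis using nz w by simp
  qed
  have Wac: "ac_deriv X (W z) (\<lambda>x. (of_real (q x) - z) * (aa s z x * u z x))" if z: "z \<in> D" for z
  proof -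
    have aX: "ac_deriv X (aa s z) (\<lambda>x. - om s z x * aa s z x)"
      by (rule ac_deriv_mono[OF aa_ac[OF D_cut[OF z]] X_ge])
    have "ac_deriv X (W z) (\<lambda>x.
       - (- inverse ((aa s z x)\<^sup>2) * (- om s z x * aa s z x) * B z x + inverse (aa s z x) * - (gj z x * u z x))
       - (rr z x * (aa s z x * u z x) + hh z x * (- om s z x * aa s z x * u z x + aa s z x * S z x)))"
      unfolding W_def
      by (intro ac_deriv_diff ac_deriv_minus ac_deriv_mult ac_deriv_inverse aX Bac uac hh_ac z aa_nonzero)
    then show ?thesis
    proof (rule ac_deriv_cong)
      fix x assume "X \<le> x"
      then have "complex_of_real (p x) \<noteq> 0" using p_pos[of x] X_nonneg by simp
      from alg[OF this aa_nonzero om_square, where b = "B z x" and r = "rr z x" and v = "u z x"]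
      show "- (- inverse ((aa s z x)\<^sup>2) * (- om s z x * aa s z x) * B z x + inverse (aa s z x) * - (gj z x * u z x))
         - (rr z x * (aa s z x * u z x) + hh z x * (- om s z x * aa s z x * u z x + aa s z x * S z x))
         = (of_real (q x) - z) * (aa s z x * u z x)"
        unfolding gj_def S_def Sj'_def .
    qed simp
  qed
  have thd: "((\<lambda>x. aa s z x * u z x) has_vector_derivative inverse (of_real (p x)) * W z x) (at x within {X..})"
    if z: "z \<in> D" and x: "X \<le> x" for z x
  proof -
    have "(aa s z has_vector_derivative - om s z x * aa s z x) (at x within {X..})"
      by (rule has_vector_derivative_within_subset[OF aa_deriv[OF D_cut[OF z]]]) (use x X_ge in auto)
    from has_vector_derivative_mult[OF this ud[OF z x]]
    have "((\<lambda>x. aa s z x * u z x) has_vector_derivative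
      aa s z x * S z x + - om s z x * aa s z x * u z x) (at x within {X..})" .
    moreover have "aa s z x * S z x + - om s z x * aa s z x * u z x = inverse (of_real (p x)) * W z x"
      using p_pos[of x] x X_nonneg aa_nonzero[of s x z]
      by (simp add: W_def S_def Sj'_def field_simps power2_eq_square)
    ultimately show ?thesis by simp
  qed
  have Breg: "regular_on D (\<lambda>z. B z x)" if "X \<le> x" for x
    unfolding B_def by (rule V.tail_regular[OF u(1) ub u(4) that])
  have Wreg: "regular_on D (\<lambda>z. W z x)" if "X \<le> x" for x
    unfolding W_def using that X_nonneg
    by (intro regular_on_diff regular_on_minus regular_on_mult regular_on_inverse regular_on_const
        aa_regular[OF D_sub compact_imp_bounded[OF D_compact]] om_regular[OF D_sub] Breg u(4) aa_nonzero) auto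
  show ?thesis
  \<comment> \<open>One constant for two estimates: \<open>e\<close> bounds u, and
    \<open>e * c\<close> is the factor in the bound for u - 1.\<close>
  proof (rule that[of u "max e (e * c)" W])
    fix z x assume zx: "z \<in> D" "X \<le> x"
    show "cmod (u z x) \<le> max e (e * c)" using ub[OF zx] by simp
    show "(\<lambda>y. Gfun p q s x y z * rr z y * u z y) integrable_on {x..}"
      by (rule integrable_eq[OF K[OF zx]]) (use KG zx in auto)
    show "u z x = 1 + integral {x..} (\<lambda>y. Gfun p q s x y z * rr z y * u z y)"
      using u(3)[OF zx] TG[OF zx] by simp
    have "0 \<le> epsf dp dq x"
      unfolding epsf_def by (rule integral_tail_nonneg[OF sg_abs _ zx(2)]) simp
    then have "e * c * epsf dp dq x \<le> max e (e * c) * epsf dp dq x"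
      by (intro mult_right_mono) auto
    then show "cmod (u z x - 1) \<le> max e (e * c) * epsf dp dq x"
      using udiff[OF zx] by simp
  qed (use thd Wac u(4) Wreg in auto)
qed

end

section \<open>Continuation back to the origin\<close>

context coefficients
begin

definition Sb' :: "complex \<Rightarrow> real \<Rightarrow> complex" where
  "Sb' z t = inverse (of_real (p t))"

definition Sb :: "complex \<Rightarrow> real \<Rightarrow> complex" where
  "Sb z x = integral {0..x} (Sb' z)"

text \<open>Cutting off at \<open>N\<close> makes the initial value problem on \<open>{0..N}\<close>
  an instance of the half-line theory: integrals over \<open>{x..}\<close> end at \<open>N\<close>,
  and vanish for x \<ge> N.\<close>

definition gb :: "real \<Rightarrow> complex \<Rightarrow> real \<Rightarrow> complex" where
  "gb N z y = (if y < N then of_real (q y) - z else 0)"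

lemma Sb'_cont: "continuous_on {0..} (Sb' z)"
proof -
  have "\<forall>x\<in>{0..}. complex_of_real (p x) \<noteq> 0"
    using p_pos by (metis atLeast_iff less_irrefl of_real_eq_0_iff)
  then show ?thesis
    unfolding Sb'_def by (intro continuous_intros p_cont)
qed

lemma Sb_ac: "ac_deriv 0 (Sb z) (Sb' z)"
proof (rule ac_derivI)
  fix b :: real assume "0 \<le> b"
  show 1: "Sb' z absolutely_integrable_on {0..b}"
    by (rule absolutely_integrable_continuous_real) (rule continuous_on_subset[OF Sb'_cont], auto)
  then show "(Sb' z has_integral Sb z b - Sb z 0) {0..b}"
    by (auto simp: Sb_def absolutely_integrable_on_def intro: integrable_integral)
qed

lemma Sb_deriv: "0 \<le> x \<Longrightarrow> (Sb z has_vector_derivative Sb' z x) (at x within {0..})"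
  by (rule ac_deriv_imp_vector_derivative[OF Sb_ac Sb'_cont])

lemma qz_abs:
  assumes "0 \<le> a"
  shows "(\<lambda>y. complex_of_real (q y) - z) absolutely_integrable_on {a..b}"
proof (rule set_integral_diff)
  show "(\<lambda>y. complex_of_real (q y)) absolutely_integrable_on {a..b}"
    using absolutely_integrable_linear[OF q_abs[OF assms] bounded_linear_of_real] by (simp add: o_def)
qed (auto intro: absolutely_integrable_continuous_real)

lemma backward_volterra:
  assumes D: "bounded D" and N: "0 \<le> N"
  obtains \<rho> where "volterra 0 D Sb Sb' (gb N) \<rho>"
proof -
  obtain R where R: "\<And>z. z \<in> D \<Longrightarrow> cmod z \<le> R" using D by (auto simp: bounded_iff)
  obtain l L where l: "0 < l" "\<And>x. 0 \<le> x \<Longrightarrow> l \<le> p x" using p_bounds by metis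
  \<comment> \<open>N / l bounds |S(y) - S(x)| for y < N because S' = 1 / p \<le> 1 / l; the summand
    1 lets the density dominate \<open>gb\<close> itself.\<close>
  define \<rho> where "\<rho> = (\<lambda>y. if y < N then (1 + N / l) * (\<bar>q y\<bar> + \<bar>R\<bar>) else 0)"
  have g: "cmod (gb N z y) \<le> \<bar>q y\<bar> + \<bar>R\<bar>" "cmod (gb N z y) \<le> \<rho> y" if "z \<in> D" for z y
  proof -
    show 1: "cmod (gb N z y) \<le> \<bar>q y\<bar> + \<bar>R\<bar>"
      using norm_triangle_ineq4[of "of_real (q y)" z] R[OF that] by (auto simp: gb_def)
    show "cmod (gb N z y) \<le> \<rho> y"
    proof (cases "y < N")
      case True
      have "1 * (\<bar>q y\<bar> + \<bar>R\<bar>) \<le> (1 + N / l) * (\<bar>q y\<bar> + \<bar>R\<bar>)"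
        using N l by (intro mult_right_mono) auto
      then show ?thesis using 1 True by (simp add: \<rho>_def)
    qed (simp add: gb_def \<rho>_def)
  qed
  have Sdiff: "cmod (Sb z y - Sb z x) \<le> N / l" if "0 \<le> x" "x \<le> y" "y < N" for z x y
  proof -
    have "cmod (integral {x..y} (Sb' z)) \<le> integral {x..y} (\<lambda>_. 1 / l)"
    proof (rule Henstock_Kurzweil_Integration.integral_norm_bound_integral)
      show "Sb' z integrable_on {x..y}"
        using ac_deriv_abs[OF Sb_ac that(1)] by (simp add: absolutely_integrable_on_def)
      fix t assume "t \<in> {x..y}"
      then have t: "0 \<le> t" using that by simp
      show "cmod (Sb' z t) \<le> 1 / l"
        using l(1) l(2)[OF t] by (simp add: Sb'_def norm_inverse divide_inverse le_imp_inverse_le)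
    qed auto
    also have "\<dots> = (y - x) / l" using that by simp
    also have "\<dots> \<le> N / l" using that l by (intro divide_right_mono) auto
    finally show ?thesis using ac_deriv_integral[OF Sb_ac that(1,2)] by simp
  qed
  have "volterra 0 D Sb Sb' (gb N) \<rho>"
  proof
    show "gb N z absolutely_integrable_on {0..}" for z
      unfolding gb_def by (rule absolutely_integrable_cut[OF qz_abs]) simp
    have "(\<lambda>y. (1 + N / l) * (\<bar>q y\<bar> + \<bar>R\<bar>)) absolutely_integrable_on {0..N}"
      using q_abs[of 0 N] absolutely_integrable_scaleR_left[where f = "\<lambda>y. \<bar>q y\<bar> + \<bar>R\<bar>" and S = "{0..N}" and c = "1 + N / l"]
      by (auto intro!: set_integral_add set_integrable_abs)
    then show "\<rho> absolutely_integrable_on {0..}"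
      unfolding \<rho>_def by (rule absolutely_integrable_cut)
    show "0 \<le> \<rho> y" for y using N l by (simp add: \<rho>_def)
    show "cmod ((Sb z y - Sb z x) * gb N z y) \<le> \<rho> y" if "z \<in> D" "0 \<le> x" "x \<le> y" for z x y
    proof (cases "y < N")
      case True
      have "cmod (Sb z y - Sb z x) * cmod (gb N z y) \<le> (1 + N / l) * (\<bar>q y\<bar> + \<bar>R\<bar>)"
        using Sdiff[OF that(2,3) True, of z] g(1)[OF that(1), of y] N l by (intro mult_mono) auto
      then show ?thesis using True by (simp add: \<rho>_def norm_mult)
    qed (simp add: gb_def \<rho>_def)
    show "regular_on D (\<lambda>z. Sb z x)" for x
      unfolding Sb_def Sb'_def by (rule regular_on_const)
    show "regular_on D (\<lambda>z. gb N z x)" for x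
      unfolding gb_def by (cases "x < N") (auto intro: regular_on_diff regular_on_const regular_on_ident)
  qed (use Sb_ac Sb'_cont g in auto)
  then show ?thesis by (rule that)
qed

text \<open>Integrating (p phi')' = (q - z) phi twice from \<open>N\<close> downwards gives phi(x) =
  c - w (S(N) - S(x)) + T phi(x), where c and w are the values of phi and p phi' at
  \<open>N\<close>. Accordingly p phi' = w - B with B the tail of g phi.\<close>

lemma backward_extension:
  fixes cN wN :: "complex \<Rightarrow> complex"
  assumes D: "compact D" and N: "0 \<le> N" and reg: "regular_on D cN" "regular_on D wN"
  obtains \<phi> W where
    "\<And>z. z \<in> D \<Longrightarrow> \<phi> z N = cN z" "\<And>z. z \<in> D \<Longrightarrow> W z N = wN z"
    "\<And>z x. z \<in> D \<Longrightarrow> x \<in> {0..N} \<Longrightarrow>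
       (\<phi> z has_vector_derivative inverse (of_real (p x)) * W z x) (at x within {0..N})"
    "\<And>z x. z \<in> D \<Longrightarrow> x \<in> {0..N} \<Longrightarrow>
       ((\<lambda>t. (of_real (q t) - z) * \<phi> z t) has_integral W z x - W z 0) {0..x}"
    "\<And>x. 0 \<le> x \<Longrightarrow> regular_on D (\<lambda>z. \<phi> z x)"
proof -
  obtain \<rho> where "volterra 0 D Sb Sb' (gb N) \<rho>"
    using backward_volterra[OF compact_imp_bounded[OF D] N] by blast
  then interpret V: volterra 0 D Sb Sb' "gb N" \<rho> .
  \<comment> \<open>\<open>min x N\<close> freezes the free term beyond \<open>N\<close>; otherwise
    it need not be bounded on \<open>{0..}\<close>, as \<open>solution_exists\<close>
    demands.\<close>
  define u0 where "u0 = (\<lambda>z x. cN z - wN z * (Sb z N - Sb z (min x N)))"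
  have Sc: "continuous_on {0..} (Sb z)" for z by (rule ac_deriv_continuous[OF Sb_ac])
  have Smin: "continuous_on {0..} (\<lambda>x. Sb z (min x N))" for z
    by (rule continuous_on_compose2[OF Sc]) (use N in \<open>auto intro!: continuous_intros\<close>)
  have Sz: "Sb z = Sb 0" for z by (simp add: Sb_def Sb'_def[abs_def] fun_eq_iff)
  obtain M1 where M1: "\<And>z. z \<in> D \<Longrightarrow> cmod (cN z) \<le> M1"
    using regular_on_compact_bounded[OF reg(1) D] by blast
  obtain M2 where M2: "\<And>z. z \<in> D \<Longrightarrow> cmod (wN z) \<le> M2"
    using regular_on_compact_bounded[OF reg(2) D] by blast
  obtain M3 where M3: "\<And>x. x \<in> {0..N} \<Longrightarrow> cmod (Sb 0 N - Sb 0 x) \<le> M3"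
  proof -
    have "continuous_on {0..N} (\<lambda>x. Sb 0 N - Sb 0 x)"
      by (intro continuous_intros continuous_on_subset[OF Sc]) auto
    from compact_imp_bounded[OF compact_continuous_image[OF this compact_Icc]] show ?thesis
      using that unfolding bounded_iff by blast
  qed
  have u0b: "cmod (u0 z x) \<le> \<bar>M1\<bar> + \<bar>M2\<bar> * \<bar>M3\<bar>" if "z \<in> D" "0 \<le> x" for z x
  proof -
    have "cmod (wN z) * cmod (Sb z N - Sb z (min x N)) \<le> \<bar>M2\<bar> * \<bar>M3\<bar>"
      using M2[OF that(1)] M3[of "min x N"] that N Sz[of z] by (intro mult_mono) auto
    then show ?thesis
      using norm_triangle_ineq4[of "cN z" "wN z * (Sb z N - Sb z (min x N))"] M1[OF that(1)]
      by (simp add: u0_def norm_mult)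
  qed
  obtain \<phi> where \<phi>: "\<And>z. z \<in> D \<Longrightarrow> continuous_on {0..} (\<phi> z)"
    "\<And>z x. z \<in> D \<Longrightarrow> 0 \<le> x \<Longrightarrow> cmod (\<phi> z x) \<le> (\<bar>M1\<bar> + \<bar>M2\<bar> * \<bar>M3\<bar>) * exp (V.m 0)"
    "\<And>z x. z \<in> D \<Longrightarrow> 0 \<le> x \<Longrightarrow> \<phi> z x = u0 z x + V.T z (\<phi> z) x"
    "\<And>x. 0 \<le> x \<Longrightarrow> regular_on D (\<lambda>z. \<phi> z x)"
  proof (rule V.solution_exists[of u0 "\<bar>M1\<bar> + \<bar>M2\<bar> * \<bar>M3\<bar>"])
    show "continuous_on {0..} (u0 z)" for z
      unfolding u0_def by (intro continuous_intros Smin)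
    show "regular_on D (\<lambda>z. u0 z x)" if "0 \<le> x" for x
      unfolding u0_def using that N
      by (intro regular_on_diff regular_on_mult reg V.S_regular) auto
  qed (use u0b in auto)
  define B where "B = (\<lambda>z x. integral {x..} (\<lambda>y. gb N z y * \<phi> z y))"
  have BN: "B z N = 0" for z
    unfolding B_def by (rule integral_unique[OF has_integral_is_0]) (auto simp: gb_def)
  have TN: "V.T z (\<phi> z) N = 0" for z
    unfolding V.T_def by (rule integral_unique[OF has_integral_is_0]) (auto simp: gb_def)
  show ?thesis
  proof (rule that[of \<phi> "\<lambda>z x. wN z - B z x"])
    show "\<phi> z N = cN z" if "z \<in> D" for z
      using \<phi>(3)[OF that N] TN[of z] by (simp add: u0_def)
    show "wN z - B z N = wN z" for z by (simp add: BN)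
    fix z x assume z: "z \<in> D" and x: "x \<in> {0..N}"
    have T': "(V.T z (\<phi> z) has_vector_derivative - Sb' z x * B z x) (at x within {0..})"
      unfolding B_def by (rule V.T_has_vector_derivative[OF z \<phi>(1)[OF z] \<phi>(2)[OF z]]) (use x in auto)
    have "((\<lambda>x. cN z - wN z * (Sb z N - Sb z x) + V.T z (\<phi> z) x) has_vector_derivative
       0 - wN z * (0 - Sb' z x) + - Sb' z x * B z x) (at x within {0..N})"
      using x by (intro has_vector_derivative_add has_vector_derivative_diff has_vector_derivative_const
          has_vector_derivative_mult_right has_vector_derivative_within_subset[OF T']
          has_vector_derivative_within_subset[OF Sb_deriv]) auto
    moreover have "0 - wN z * (0 - Sb' z x) + - Sb' z x * B z x = inverse (of_real (p x)) * (wN z - B z x)"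
      by (simp add: Sb'_def algebra_simps)
    ultimately have "((\<lambda>x. cN z - wN z * (Sb z N - Sb z x) + V.T z (\<phi> z) x) has_vector_derivative
       inverse (of_real (p x)) * (wN z - B z x)) (at x within {0..N})" by simp
    then show "(\<phi> z has_vector_derivative inverse (of_real (p x)) * (wN z - B z x)) (at x within {0..N})"
      by (rule has_vector_derivative_transform[rotated 2])
        (use x \<phi>(3)[OF z] in \<open>auto simp: u0_def\<close>)
    have "ac_deriv 0 (B z) (\<lambda>x. - (gb N z x * \<phi> z x))"
      unfolding B_def by (rule ac_deriv_tail[OF V.gv_integrable[OF z \<phi>(1)[OF z] \<phi>(2)[OF z] order_refl]])
    from ac_deriv_has_integral[OF ac_deriv_minus[OF this], of 0 x]
    have "((\<lambda>t. gb N z t * \<phi> z t) has_integral (wN z - B z x) - (wN z - B z 0)) {0..x}"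
      using x by simp
    then show "((\<lambda>t. (of_real (q t) - z) * \<phi> z t) has_integral (wN z - B z x) - (wN z - B z 0)) {0..x}"
      \<comment> \<open>The strict inequality in \<open>gb\<close> makes the two integrands differ
        at most at the single point \<open>N\<close>.\<close>
      by (rule has_integral_spike_finite[of "{N}", rotated 2]) (use x in \<open>auto simp: gb_def\<close>)
  qed (use \<phi>(4) in auto)
qed

end

section \<open>Gluing at X, and uniqueness for the integral equation\<close>

context jost_domain
begin

text \<open>The half-line solution and its continuation share value and quasi-derivative at
  \<open>X\<close>. Dividing by p(X), the one-sided derivatives agree there, and the integrated
  equations of the two pieces add up.\<close>

theorem jost_solution:
  obtains \<theta> u C where
    "\<And>z. z \<in> D \<Longrightarrow> sl_solution p q z (\<theta> z)"
    "\<And>z x. z \<in> D \<Longrightarrow> X \<le> x \<Longrightarrow> cmod (u z x) \<le> C"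
    "\<And>z x. z \<in> D \<Longrightarrow> X \<le> x \<Longrightarrow> (\<lambda>y. Gfun p q s x y z * rr z y * u z y) integrable_on {x..}"
    "\<And>z x. z \<in> D \<Longrightarrow> X \<le> x \<Longrightarrow> u z x = 1 + integral {x..} (\<lambda>y. Gfun p q s x y z * rr z y * u z y)"
    "\<And>z x. z \<in> D \<Longrightarrow> X \<le> x \<Longrightarrow> \<theta> z x = aa s z x * u z x"
    "\<And>z x. z \<in> D \<Longrightarrow> X \<le> x \<Longrightarrow> cmod (u z x - 1) \<le> C * epsf dp dq x"
    "\<And>x. 0 \<le> x \<Longrightarrow> regular_on D (\<lambda>z. \<theta> z x)"
proof -
  obtain u W C where u:
    "\<And>z x. z \<in> D \<Longrightarrow> X \<le> x \<Longrightarrow> cmod (u z x) \<le> C"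
    "\<And>z x. z \<in> D \<Longrightarrow> X \<le> x \<Longrightarrow> (\<lambda>y. Gfun p q s x y z * rr z y * u z y) integrable_on {x..}"
    "\<And>z x. z \<in> D \<Longrightarrow> X \<le> x \<Longrightarrow> u z x = 1 + integral {x..} (\<lambda>y. Gfun p q s x y z * rr z y * u z y)"
    "\<And>z x. z \<in> D \<Longrightarrow> X \<le> x \<Longrightarrow> cmod (u z x - 1) \<le> C * epsf dp dq x"
    "\<And>z x. z \<in> D \<Longrightarrow> X \<le> x \<Longrightarrow>
       ((\<lambda>x. aa s z x * u z x) has_vector_derivative inverse (of_real (p x)) * W z x) (at x within {X..})"
    "\<And>z. z \<in> D \<Longrightarrow> ac_deriv X (W z) (\<lambda>x. (of_real (q x) - z) * (aa s z x * u z x))"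
    "\<And>x. X \<le> x \<Longrightarrow> regular_on D (\<lambda>z. u z x)"
    "\<And>x. X \<le> x \<Longrightarrow> regular_on D (\<lambda>z. W z x)"
    by (rule half_line_solution) blast
  have aur: "regular_on D (\<lambda>z. aa s z x * u z x)" if "X \<le> x" for x
    using that X_nonneg
    by (intro regular_on_mult aa_regular[OF D_sub compact_imp_bounded[OF D_compact]] u(7)) auto
  obtain \<phi> V where \<phi>:
    "\<And>z. z \<in> D \<Longrightarrow> \<phi> z X = aa s z X * u z X" "\<And>z. z \<in> D \<Longrightarrow> V z X = W z X"
    "\<And>z x. z \<in> D \<Longrightarrow> x \<in> {0..X} \<Longrightarrow>
       (\<phi> z has_vector_derivative inverse (of_real (p x)) * V z x) (at x within {0..X})"
    "\<And>z x. z \<in> D \<Longrightarrow> x \<in> {0..X} \<Longrightarrow>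
       ((\<lambda>t. (of_real (q t) - z) * \<phi> z t) has_integral V z x - V z 0) {0..x}"
    "\<And>x. 0 \<le> x \<Longrightarrow> regular_on D (\<lambda>z. \<phi> z x)"
    by (rule backward_extension[OF D_compact X_nonneg aur[OF order_refl] u(8)[OF order_refl]]) blast
  define \<theta> where "\<theta> = (\<lambda>z x. if x \<in> {0..X} then \<phi> z x else aa s z x * u z x)"
  define P where "P = (\<lambda>z x. if x \<in> {0..X} then V z x else W z x)"
  have \<theta>u: "\<theta> z x = aa s z x * u z x" if "z \<in> D" "X \<le> x" for z x
    using \<phi>(1)[OF that(1)] that X_nonneg by (cases "x = X") (auto simp: \<theta>_def)
  have P0: "P z x = W z x" if "z \<in> D" "X \<le> x" for z x
    using \<phi>(2)[OF that(1)] that X_nonneg by (cases "x = X") (auto simp: P_def)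
  have sl: "sl_solution p q z (\<theta> z)" if z: "z \<in> D" for z
    unfolding sl_solution_def
  proof (intro exI[of _ "\<lambda>x. inverse (of_real (p x)) * P z x"] conjI allI impI)
    fix x :: real assume x: "0 \<le> x"
    have cl: "closure {0..X} \<inter> closure {X..} = {X}" using X_nonneg by auto
    have "((\<lambda>x. if x \<in> {0..X} then \<phi> z x else aa s z x * u z x) has_vector_derivative
      (if x \<in> {0..X} then inverse (of_real (p x)) * V z x else inverse (of_real (p x)) * W z x)) (at x within {0..})"
    proof (rule has_vector_derivative_If_within_closures[where T = "{X..}"])
      show "x \<in> {0..X} \<union> {X..}" "{0..} = {0..X} \<union> {X..}" using x X_nonneg by auto
      show "(\<phi> z has_vector_derivative inverse (of_real (p x)) * V z x) (at x within {0..X} \<union> (closure {0..X} \<inter> closure {X..}))"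
        if "x \<in> {0..X} \<union> (closure {0..X} \<inter> closure {X..})"
      proof -
        have "{0..X} \<union> {X} = {0..X}" using X_nonneg by auto
        then show ?thesis using that \<phi>(3)[OF z, of x] unfolding cl by simp
      qed
      show "((\<lambda>x. aa s z x * u z x) has_vector_derivative inverse (of_real (p x)) * W z x)
          (at x within {X..} \<union> (closure {0..X} \<inter> closure {X..}))"
        if "x \<in> {X..} \<union> (closure {0..X} \<inter> closure {X..})"
      proof -
        have "{X..} \<union> {X} = {X..}" by auto
        then show ?thesis using that u(5)[OF z, of x] unfolding cl by simp
      qed
    next
      assume "x \<in> closure {0..X}" "x \<in> closure {X..}"
      then have "x = X" by simp
      then show "\<phi> z x = aa s z x * u z x" 
        "inverse (of_real (p x)) * V z x = inverse (of_real (p x)) * W z x"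
        using \<phi>(1,2)[OF z] by auto
    qed
    then show "(\<theta> z has_vector_derivative inverse (of_real (p x)) * P z x) (at x within {0..})"
      unfolding \<theta>_def P_def by (cases "x \<in> {0..X}") auto
    have "((\<lambda>t. (of_real (q t) - z) * \<theta> z t) has_integral P z x - P z 0) {0..x}"
    proof (cases "x \<le> X")
      case True
      then have "((\<lambda>t. (of_real (q t) - z) * \<phi> z t) has_integral P z x - P z 0) {0..x}"
        using \<phi>(4)[OF z, of x] x X_nonneg by (simp add: P_def)
      then show ?thesis
        by (rule has_integral_eq[rotated]) (use True in \<open>auto simp: \<theta>_def\<close>)
    next
      case False
      have "((\<lambda>t. (of_real (q t) - z) * \<phi> z t) has_integral V z X - V z 0) {0..X}"
        using \<phi>(4)[OF z, of X] X_nonneg by simp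
      then have 1: "((\<lambda>t. (of_real (q t) - z) * \<theta> z t) has_integral V z X - V z 0) {0..X}"
        by (rule has_integral_eq[rotated]) (auto simp: \<theta>_def)
      have "((\<lambda>t. (of_real (q t) - z) * (aa s z t * u z t)) has_integral W z x - W z X) {X..x}"
        using ac_deriv_has_integral[OF u(6)[OF z]] False by simp
      then have 2: "((\<lambda>t. (of_real (q t) - z) * \<theta> z t) has_integral W z x - W z X) {X..x}"
        by (rule has_integral_eq[rotated]) (use \<theta>u z in auto)
      from has_integral_combine[OF X_nonneg _ 1 2] False
      show ?thesis using \<phi>(2)[OF z] P0[OF z, of x] X_nonneg by (simp add: P_def)
    qed
    moreover have "of_real (p x) * (inverse (of_real (p x)) * P z x) = P z x"
      "of_real (p 0) * (inverse (of_real (p 0)) * P z 0) = P z 0"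
      using p_pos[OF x] p_pos[of 0] by (simp_all add: field_simps)
    ultimately show "((\<lambda>t. (of_real (q t) - z) * \<theta> z t) has_integral
       of_real (p x) * (inverse (of_real (p x)) * P z x) - of_real (p 0) * (inverse (of_real (p 0)) * P z 0)) {0..x}"
      by (simp only:)
  qed
  have \<theta>r: "regular_on D (\<lambda>z. \<theta> z x)" if "0 \<le> x" for x
    unfolding \<theta>_def using \<phi>(5)[OF that] aur[of x] by (cases "x \<in> {0..X}") (use that in auto)
  show ?thesis
    by (rule that[of \<theta> u C]) (fact sl u(1-4) \<theta>u \<theta>r)+
qed

text \<open>The difference of two bounded solutions is a bounded solution of the homogeneous
  Volterra equation.\<close>

lemma jost_integral_unique:
  assumes z: "z \<in> D"
    and u: "bounded (u ` {X..})" "\<And>x. X \<le> x \<Longrightarrow> (\<lambda>y. Gfun p q s x y z * rr z y * u y) integrable_on {x..}"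
      "\<And>x. X \<le> x \<Longrightarrow> u x = 1 + integral {x..} (\<lambda>y. Gfun p q s x y z * rr z y * u y)"
    and v: "bounded (v ` {X..})" "\<And>x. X \<le> x \<Longrightarrow> (\<lambda>y. Gfun p q s x y z * rr z y * v y) integrable_on {x..}"
      "\<And>x. X \<le> x \<Longrightarrow> v x = 1 + integral {x..} (\<lambda>y. Gfun p q s x y z * rr z y * v y)"
    and x: "X \<le> x"
  shows "u x = v x"
proof -
  obtain c where c: "0 \<le> c" "volterra X D Sj Sj' gj (\<lambda>y. c * sg y)"
    using jost_volterra by blast
  interpret V: volterra X D Sj Sj' gj "\<lambda>y. c * sg y" by (rule c(2))
  have K: "(\<lambda>y. (Sj z y - Sj z x) * gj z y * (u y - v y)) integrable_on {x..}"
    "integral {x..} (\<lambda>y. (Sj z y - Sj z x) * gj z y * (u y - v y)) = u x - v x" if x: "X \<le> x" for x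
  proof -
    have "((\<lambda>y. Gfun p q s x y z * rr z y * u y - Gfun p q s x y z * rr z y * v y) has_integral
       integral {x..} (\<lambda>y. Gfun p q s x y z * rr z y * u y) - integral {x..} (\<lambda>y. Gfun p q s x y z * rr z y * v y)) {x..}"
      by (intro has_integral_diff integrable_integral u(2) v(2) x)
    then have "((\<lambda>y. Gfun p q s x y z * rr z y * u y - Gfun p q s x y z * rr z y * v y) has_integral u x - v x) {x..}"
      using u(3)[OF x] v(3)[OF x] by simp
    then have "((\<lambda>y. (Sj z y - Sj z x) * gj z y * (u y - v y)) has_integral u x - v x) {x..}"
      by (rule has_integral_eq[rotated]) (use kernel_eq[OF z x] in \<open>auto simp: right_diff_distrib\<close>)
    then show "(\<lambda>y. (Sj z y - Sj z x) * gj z y * (u y - v y)) integrable_on {x..}"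
      "integral {x..} (\<lambda>y. (Sj z y - Sj z x) * gj z y * (u y - v y)) = u x - v x"
      by (auto simp: integral_unique)
  qed
  have "bounded ((\<lambda>x. u x - v x) ` {X..})"
    using u(1) v(1) by (rule bounded_minus_comp)
  from V.bounded_solution_unique[OF z K(1) _ this x] K(2)
  have "u x - v x = 0" by (simp add: V.T_def)
  then show ?thesis by simp
qed

end

section \<open>Uniqueness for the differential equation\<close>

context coefficients
begin

text \<open>A solution vanishing near infinity solves the homogeneous backward Volterra equation.\<close>

lemma sl_solution_unique:
  assumes 1: "sl_solution p q z \<theta>1" and 2: "sl_solution p q z \<theta>2" and Y: "0 \<le> Y"
    and eq: "\<And>x. Y \<le> x \<Longrightarrow> \<theta>1 x = \<theta>2 x" and x: "0 \<le> x"
  shows "\<theta>1 x = \<theta>2 x"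
proof -
  obtain f1 where f1: "\<And>x. 0 \<le> x \<Longrightarrow> (\<theta>1 has_vector_derivative f1 x) (at x within {0..})"
    "\<And>x. 0 \<le> x \<Longrightarrow> ((\<lambda>t. (of_real (q t) - z) * \<theta>1 t) has_integral (of_real (p x) * f1 x - of_real (p 0) * f1 0)) {0..x}"
    using 1 unfolding sl_solution_def by blast
  obtain f2 where f2: "\<And>x. 0 \<le> x \<Longrightarrow> (\<theta>2 has_vector_derivative f2 x) (at x within {0..})"
    "\<And>x. 0 \<le> x \<Longrightarrow> ((\<lambda>t. (of_real (q t) - z) * \<theta>2 t) has_integral (of_real (p x) * f2 x - of_real (p 0) * f2 0)) {0..x}"
    using 2 unfolding sl_solution_def by blast
  define d where "d = (\<lambda>x. \<theta>1 x - \<theta>2 x)"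
  define d' where "d' = (\<lambda>x. f1 x - f2 x)"
  define w where "w = (\<lambda>x. of_real (p x) * d' x)"
  \<comment> \<open>The margin puts \<open>N\<close> in the interior of the region where the
    difference vanishes, so its two-sided derivative at \<open>N\<close> is 0.\<close>
  define N where "N = Y + 1"
  have N: "0 \<le> N" "Y < N" using Y by (auto simp: N_def)
  have dd: "(d has_vector_derivative d' x) (at x within {0..})" if "0 \<le> x" for x
    unfolding d_def d'_def using f1(1)[OF that] f2(1)[OF that] by (rule has_vector_derivative_diff)
  have dc: "continuous_on {0..} d"
    unfolding continuous_on_eq_continuous_within using dd has_vector_derivative_continuous by (metis atLeast_iff)
  have d0: "d x = 0" if "Y \<le> x" for x using eq[OF that] by (simp add: d_def)
  have wac: "ac_deriv 0 w (\<lambda>t. (of_real (q t) - z) * d t)"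
  proof (rule ac_derivI)
    fix b :: real assume b: "0 \<le> b"
    have "(\<lambda>t. d t * (of_real (q t) - z)) absolutely_integrable_on {0..b}"
      by (rule absolutely_integrable_mult_continuous[OF _ qz_abs])
        (use continuous_on_subset[OF dc] in auto)
    then show "(\<lambda>t. (of_real (q t) - z) * d t) absolutely_integrable_on {0..b}"
      by (simp add: mult.commute)
    have "((\<lambda>t. (of_real (q t) - z) * \<theta>1 t - (of_real (q t) - z) * \<theta>2 t) has_integral
       (of_real (p b) * f1 b - of_real (p 0) * f1 0) - (of_real (p b) * f2 b - of_real (p 0) * f2 0)) {0..b}"
      by (intro has_integral_diff f1(2) f2(2) b)
    then show "((\<lambda>t. (of_real (q t) - z) * d t) has_integral w b - w 0) {0..b}"
      by (simp add: w_def d_def d'_def algebra_simps)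
  qed
  have wN: "w N = 0"
  proof -
    have "at N within {0..} = at N" using N Y by (intro at_within_interior) (simp add: interior_real_atLeast)
    then have "(d has_vector_derivative d' N) (at N)" using dd[OF N(1)] by simp
    moreover have "(d has_vector_derivative 0) (at N)"
      by (rule has_vector_derivative_transform_within_open[OF has_vector_derivative_const[of 0] open_greaterThan[of Y]])
        (use d0 N in auto)
    ultimately have "d' N = 0" by (rule vector_derivative_unique_at)
    then show ?thesis by (simp add: w_def)
  qed
  have "bounded {z}" by simp
  from backward_volterra[OF this N(1)] obtain \<rho> where "volterra 0 {z} Sb Sb' (gb N) \<rho>" by blast
  then interpret V: volterra 0 "{z}" Sb Sb' "gb N" \<rho> .
  have z: "z \<in> {z}" by simp
  have bd: "bounded (d ` {0..})"
  proof -
    have "bounded (d ` {0..Y})"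
      by (intro compact_imp_bounded compact_continuous_image continuous_on_subset[OF dc]) auto
    then have "bounded (insert 0 (d ` {0..Y}))" by simp
    moreover have "d y \<in> insert 0 (d ` {0..Y})" if "0 \<le> y" for y
      using d0[of y] that by (cases "y \<le> Y") auto
    ultimately show ?thesis by (elim bounded_subset) blast
  qed
  then obtain C where C: "\<And>y. 0 \<le> y \<Longrightarrow> cmod (d y) \<le> C" by (auto simp: bounded_iff)
  define B where "B = (\<lambda>x. integral {x..} (\<lambda>y. gb N z y * d y))"
  \<comment> \<open>Past \<open>N\<close> the difference vanishes, so the cutoff changes
    nothing.\<close>
  have gd: "gb N z y * d y = (of_real (q y) - z) * d y" for y
    using d0[of y] N by (cases "y < N") (auto simp: gb_def)
  have Bac: "ac_deriv 0 B (\<lambda>x. - (gb N z x * d x))"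
    unfolding B_def by (rule ac_deriv_tail[OF V.gv_integrable[OF z dc C order_refl]])
  have BN: "B N = 0"
    unfolding B_def by (rule integral_unique[OF has_integral_is_0]) (auto simp: gb_def)
  have TN: "V.T z d x = 0" if "N \<le> x" for x
    unfolding V.T_def by (rule integral_unique[OF has_integral_is_0]) (use that in \<open>auto simp: gb_def\<close>)
  \<comment> \<open>\<open>B\<close> and \<open>- w\<close> have the same density and both vanish at
    \<open>N\<close>.\<close>
  have Bw: "B x = - w x" if "0 \<le> x" "x \<le> N" for x
  proof -
    have "B N - B x = integral {x..N} (\<lambda>x. - ((of_real (q x) - z) * d x))"
      using ac_deriv_integral[OF Bac that] by (simp add: gd)
    also have "\<dots> = - (w N - w x)"
      using ac_deriv_integral[OF wac that] by simp
    finally have "- B x = w x" using BN wN by simp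
    then show ?thesis by (metis minus_minus)
  qed
  \<comment> \<open>On \<open>{0..N}\<close>, d' = w / p = - S' B is also the derivative of T d, and
    both d and T d vanish at \<open>N\<close>.\<close>
  have dT: "d x = V.T z d x" if x: "0 \<le> x" for x
  proof (cases "x \<le> N")
    case True
    have "integral {x..N} (\<lambda>x. - Sb' z x * B x) = V.T z d N - V.T z d x"
      using ac_deriv_integral[OF V.T_ac_deriv[OF z dc C] x True] by (simp add: B_def)
    moreover have "integral {x..N} d' = d N - d x"
      using has_vector_derivative_within_subset[OF dd, of _ "{x..N}"] x True
      by (intro integral_unique fundamental_theorem_of_calculus) auto
    moreover have "integral {x..N} (\<lambda>x. - Sb' z x * B x) = integral {x..N} d'"
    proof (rule Henstock_Kurzweil_Integration.integral_cong)
      fix t assume "t \<in> {x..N}"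
      then have "0 \<le> t" "t \<le> N" using x by auto
      then show "- Sb' z t * B t = d' t"
        using p_pos[of t] by (simp add: Bw Sb'_def w_def)
    qed
    ultimately show ?thesis using TN[of N] d0[of N] N by simp
  next
    case False
    then show ?thesis using TN[of x] d0[of x] N by simp
  qed
  have "d x = 0"
  proof (rule V.bounded_solution_unique[OF z _ dT bd x])
    show "(\<lambda>y. (Sb z y - Sb z x) * gb N z y * d y) integrable_on {x..}" if "0 \<le> x" for x
      using V.kernel_integrable[OF z dc C that] by (simp add: absolutely_integrable_on_def)
  qed auto
  then show ?thesis by (simp add: d_def)
qed

end

section \<open>Independence of the starting point\<close>

context jost_domain
begin

text \<open>From the larger of the two starting points on, \<open>u\<close> and \<open>v\<close>
  solve the same integral equation; uniqueness for the differential equation carries the equality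
  back to 0. This transfers results proved with a common \<open>X\<close> to solutions normalised at
  x1(z), however irregularly x1 depends on z.\<close>

lemma jost_solution_unique:
  assumes z: "z \<in> D"
    and f: "sl_solution p q z f" "bounded (u ` {Y..})"
      "\<And>x. Y \<le> x \<Longrightarrow> (\<lambda>y. Gfun p q s x y z * rr z y * u y) integrable_on {x..}"
      "\<And>x. Y \<le> x \<Longrightarrow> u x = 1 + integral {x..} (\<lambda>y. Gfun p q s x y z * rr z y * u y)"
      "\<And>x. Y \<le> x \<Longrightarrow> f x = aa s z x * u x"
    and g: "sl_solution p q z g" "bounded (v ` {X..})"
      "\<And>x. X \<le> x \<Longrightarrow> (\<lambda>y. Gfun p q s x y z * rr z y * v y) integrable_on {x..}"
      "\<And>x. X \<le> x \<Longrightarrow> v x = 1 + integral {x..} (\<lambda>y. Gfun p q s x y z * rr z y * v y)"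
      "\<And>x. X \<le> x \<Longrightarrow> g x = aa s z x * v x"
    and x: "0 \<le> x"
  shows "f x = g x"
proof (rule sl_solution_unique[OF f(1) g(1) _ _ x])
  define M where "M = max X Y"
  interpret J: jost_domain p q dp dq x0 p0 s "{z}" M
    by unfold_locales (use z D_cut X_ge q_small[OF z] in \<open>auto simp: M_def\<close>)
  show "0 \<le> M" by (rule J.X_nonneg)
  fix y assume y: "M \<le> y"
  have "u y = v y"
  proof (rule J.jost_integral_unique[OF _ _ _ _ _ _ _ y])
    show "bounded (u ` {M..})" using f(2) by (rule bounded_subset) (auto simp: M_def)
    show "bounded (v ` {M..})" using g(2) by (rule bounded_subset) (auto simp: M_def)
  qed (use f(3,4) g(3,4) in \<open>auto simp: M_def\<close>)
  then show "f y = g y"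
    using f(5)[of y] g(5)[of y] y by (simp add: M_def)
qed

end

theorem theorem2p8:
  fixes p q dp dq :: "real \<Rightarrow> real" and x0 p0 :: real and x1 :: "complex \<Rightarrow> real"
  assumes p_pos: "\<forall>x\<ge>0. p x > 0"
    and dp_L1: "dp absolutely_integrable_on {0..}"
    and p_ac: "\<forall>x\<ge>0. (dp has_integral (p x - p 0)) {0..x}"
    and p_lim: "(p \<longlongrightarrow> p0) at_top" and p0_pos: "p0 > 0"
    and x0_nonneg: "0 \<le> x0"
    and q_L1: "q absolutely_integrable_on {0..x0}"
    and dq_L1: "dq absolutely_integrable_on {x0..}"
    and q_ac: "\<forall>x\<ge>x0. (dq has_integral (q x - q x0)) {x0..x}"
    and q_lim: "(q \<longlongrightarrow> 0) at_top"
    and x1_def: "\<forall>z. z \<noteq> 0 \<longrightarrow> x0 \<le> x1 z \<and> (\<forall>x\<ge>x1 z. \<bar>q x\<bar> \<le> cmod z / 2)"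
  shows "(\<exists>\<theta>. jost_family p q dp dq x1 \<theta>) \<and>
         (\<forall>\<theta>. jost_family p q dp dq x1 \<theta> \<longrightarrow>
            (\<forall>s K. compact K \<and> K \<subseteq> cutdom s \<longrightarrow>
               (\<exists>C X. \<forall>z\<in>K. \<forall>x\<ge>X.
                  cmod (\<theta> s x z - jost_a p q s x z) \<le> C * epsf dp dq x * cmod (jost_a p q s x z))) \<and>
            (\<forall>x\<ge>0. (\<lambda>z. \<theta> True x z) holomorphic_on {z. 0 < Im z} \<and>
                    (\<lambda>z. \<theta> False x z) holomorphic_on {z. Im z < 0}) \<and>
            (\<forall>s. \<forall>x\<ge>0. continuous_on (cutdom s) (\<lambda>z. \<theta> s x z)))"
proof -
  interpret coefficients p q dp dq x0 p0
    by unfold_locales (use assms in auto)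
  have dom: "jost_domain p q dp dq x0 p0 s D X"
    if "D \<subseteq> cutdom s" "compact D" "x0 \<le> X" "\<And>z x. z \<in> D \<Longrightarrow> X \<le> x \<Longrightarrow> \<bar>q x\<bar> \<le> cmod z / 2" for s D X
    by unfold_locales (use that in auto)
  \<comment> \<open>On a compact set missing 0, |z| is bounded below; as q tends to 0, one starting
    point serves all of \<open>D\<close>.\<close>
  have large: "\<exists>X. jost_domain p q dp dq x0 p0 s D X" if D: "D \<subseteq> cutdom s" "compact D" for s D
  proof -
    obtain \<delta> R where d: "0 < \<delta>" "\<And>z. z \<in> D \<Longrightarrow> \<delta> \<le> cmod z" "\<And>z. z \<in> D \<Longrightarrow> cmod z \<le> R"
      using compact_cmod_bounds[OF D(2)] D(1) cutdom_nonzero by blast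
    have "\<forall>\<^sub>F x in at_top. dist (q x) 0 < \<delta> / 2"
      using tendstoD[OF q_lim, of "\<delta> / 2"] d(1) by simp
    then obtain M where M: "\<And>x. M \<le> x \<Longrightarrow> \<bar>q x\<bar> < \<delta> / 2"
      by (auto simp: eventually_at_top_linorder)
    have "jost_domain p q dp dq x0 p0 s D (max M x0)"
    proof (rule dom[OF D])
      fix z x assume "z \<in> D" "max M x0 \<le> x"
      then show "\<bar>q x\<bar> \<le> cmod z / 2" using M[of x] d(2)[of z] by simp
    qed simp
    then show ?thesis by blast
  qed
  \<comment> \<open>\<open>jost_family\<close> imposes its conditions separately for each sheet and
    each z; isolating them reduces existence to one function at a time.\<close>
  define Q where "Q = (\<lambda>s z f. sl_solution p q z f \<and>
        (\<exists>u. bounded (u ` {x1 z..}) \<and>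
           (\<forall>x\<ge>x1 z. (\<lambda>y. Gfun p q s x y z * rfun p q dp dq s y z * u y) integrable_on {x..} \<and>
              u x = 1 + integral {x..} (\<lambda>y. Gfun p q s x y z * rfun p q dp dq s y z * u y)) \<and>
           (\<forall>x\<ge>x1 z. f x = jost_a p q s x z * u x)))"
  have fam: "jost_family p q dp dq x1 \<theta> \<longleftrightarrow> (\<forall>s z. z \<in> cutdom s \<longrightarrow> Q s z (\<lambda>x. \<theta> s x z))" for \<theta>
    by (simp add: jost_family_def Q_def)
  have ex: "\<exists>f. Q s z f" if z: "z \<in> cutdom s" for s z
  proof -
    have "x0 \<le> x1 z" "\<And>x. x1 z \<le> x \<Longrightarrow> \<bar>q x\<bar> \<le> cmod z / 2"
      using x1_def cutdom_nonzero[OF z] by auto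
    then interpret J: jost_domain p q dp dq x0 p0 s "{z}" "x1 z"
      using z by (intro dom) auto
    show ?thesis
    proof (rule J.jost_solution)
      fix \<theta> u C
      assume J: "\<And>w. w \<in> {z} \<Longrightarrow> sl_solution p q w (\<theta> w)"
        "\<And>w x. w \<in> {z} \<Longrightarrow> x1 z \<le> x \<Longrightarrow> cmod (u w x) \<le> C"
        "\<And>w x. w \<in> {z} \<Longrightarrow> x1 z \<le> x \<Longrightarrow>
          (\<lambda>y. Gfun p q s x y w * rfun p q dp dq s y w * u w y) integrable_on {x..}"
        "\<And>w x. w \<in> {z} \<Longrightarrow> x1 z \<le> x \<Longrightarrow>
          u w x = 1 + integral {x..} (\<lambda>y. Gfun p q s x y w * rfun p q dp dq s y w * u w y)"
        "\<And>w x. w \<in> {z} \<Longrightarrow> x1 z \<le> x \<Longrightarrow> \<theta> w x = jost_a p q s x w * u w x"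
      have "bounded (u z ` {x1 z..})" using J(2) by (auto simp: bounded_iff)
      then have "Q s z (\<theta> z)"
        unfolding Q_def using J(1,3,4,5) by blast
      then show ?thesis by blast
    qed
  qed
  \<comment> \<open>The choice is independent for each z. Analyticity and continuity are recovered
    afterwards, since every family coincides with the regular solutions constructed on compact
    pieces.\<close>
  have "jost_family p q dp dq x1 (\<lambda>s x z. (SOME f. Q s z f) x)"
    unfolding fam
  proof (intro allI impI)
    fix s z assume "z \<in> cutdom s"
    from someI_ex[OF ex[OF this]] show "Q s z (\<lambda>x. (SOME f. Q s z f) x)" .
  qed
  moreover
  {
    fix \<theta> assume th: "jost_family p q dp dq x1 \<theta>"
    \<comment> \<open>On compact \<open>D\<close> a family agrees, by uniqueness, with the solution
      built from a common \<open>X\<close>, and so inherits its uniform asymptotics and its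
      regularity.\<close>
    have canonical: "\<exists>X C. (\<forall>z\<in>D. \<forall>x\<ge>X.
          cmod (\<theta> s x z - jost_a p q s x z) \<le> C * epsf dp dq x * cmod (jost_a p q s x z)) \<and>
        (\<forall>x\<ge>0. regular_on D (\<lambda>z. \<theta> s x z))" if D: "D \<subseteq> cutdom s" "compact D" for s D
    proof -
      obtain X where "jost_domain p q dp dq x0 p0 s D X" using large[OF D] by blast
      then interpret J: jost_domain p q dp dq x0 p0 s D X .
      obtain \<psi> u C where J: "\<And>z. z \<in> D \<Longrightarrow> sl_solution p q z (\<psi> z)"
        "\<And>z x. z \<in> D \<Longrightarrow> X \<le> x \<Longrightarrow> cmod (u z x) \<le> C"
        "\<And>z x. z \<in> D \<Longrightarrow> X \<le> x \<Longrightarrow>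
          (\<lambda>y. Gfun p q s x y z * rfun p q dp dq s y z * u z y) integrable_on {x..}"
        "\<And>z x. z \<in> D \<Longrightarrow> X \<le> x \<Longrightarrow>
          u z x = 1 + integral {x..} (\<lambda>y. Gfun p q s x y z * rfun p q dp dq s y z * u z y)"
        "\<And>z x. z \<in> D \<Longrightarrow> X \<le> x \<Longrightarrow> \<psi> z x = jost_a p q s x z * u z x"
        "\<And>z x. z \<in> D \<Longrightarrow> X \<le> x \<Longrightarrow> cmod (u z x - 1) \<le> C * epsf dp dq x"
        "\<And>x. 0 \<le> x \<Longrightarrow> regular_on D (\<lambda>z. \<psi> z x)"
        by (rule J.jost_solution) blast
      have eq: "\<theta> s x z = \<psi> z x" if z: "z \<in> D" and x: "0 \<le> x" for x z
      proof -
        have "Q s z (\<lambda>x. \<theta> s x z)" using th fam D z by blast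
        then obtain v where v: "sl_solution p q z (\<lambda>x. \<theta> s x z)" "bounded (v ` {x1 z..})"
          "\<And>x. x1 z \<le> x \<Longrightarrow> (\<lambda>y. Gfun p q s x y z * rfun p q dp dq s y z * v y) integrable_on {x..}"
          "\<And>x. x1 z \<le> x \<Longrightarrow> v x = 1 + integral {x..} (\<lambda>y. Gfun p q s x y z * rfun p q dp dq s y z * v y)"
          "\<And>x. x1 z \<le> x \<Longrightarrow> \<theta> s x z = jost_a p q s x z * v x"
          unfolding Q_def by blast
        have "bounded (u z ` {X..})" using J(2)[OF z] by (auto simp: bounded_iff)
        from J.jost_solution_unique[OF z v J(1)[OF z] this J(3,4,5)[OF z] x] show ?thesis .
      qed
      have "cmod (\<theta> s x z - jost_a p q s x z) \<le> C * epsf dp dq x * cmod (jost_a p q s x z)"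
        if z: "z \<in> D" and x: "X \<le> x" for x z
      proof -
        have "\<theta> s x z - jost_a p q s x z = (u z x - 1) * jost_a p q s x z"
          using eq[OF z, of x] J(5)[OF z x] x J.X_nonneg by (simp add: algebra_simps)
        then show ?thesis
          using mult_right_mono[OF J(6)[OF z x] norm_ge_zero] by (simp add: norm_mult)
      qed
      moreover have "regular_on D (\<lambda>z. \<theta> s x z)" if "0 \<le> x" for x
        by (rule regular_on_cong[OF J(7)[OF that]]) (use eq that in auto)
      ultimately show ?thesis by blast
    qed
    \<comment> \<open>The closed disc of radius |z0| / 2 around \<open>z0\<close> misses 0. Its
      intersection with the closed half-plane is compact and a neighbourhood of \<open>z0\<close>
      relative to the sheet, so continuity and holomorphy reduce to compact pieces.\<close>
    have nbhd: "\<exists>D W. D \<subseteq> cutdom s \<and> open W \<and> z0 \<in> W \<and> cutdom s \<inter> W \<subseteq> D \<and>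
        (\<forall>x\<ge>0. regular_on D (\<lambda>z. \<theta> s x z))" if z0: "z0 \<in> cutdom s" for s z0
    proof -
      define r where "r = cmod z0 / 2"
      have r: "0 < r" using cutdom_nonzero[OF z0] by (simp add: r_def)
      have n0: "0 \<notin> cball z0 r" using r by (simp add: r_def)
      define H where "H = (if s then {z. 0 \<le> Im z} else {z. Im z \<le> 0})"
      have "closed H" by (simp add: H_def closed_halfspace_Im_ge closed_halfspace_Im_le)
      then have "compact (H \<inter> cball z0 r)" by (simp add: closed_Int_compact)
      moreover have sub: "H \<inter> cball z0 r \<subseteq> cutdom s"
        using n0 by (auto simp: H_def cutdom_def)
      moreover have "cutdom s \<inter> ball z0 r \<subseteq> H \<inter> cball z0 r"
        by (auto simp: H_def cutdom_def)
      ultimately show ?thesis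
        using canonical[of "H \<inter> cball z0 r" s] r
        by (intro exI[of _ "H \<inter> cball z0 r"] exI[of _ "ball z0 r"]) auto
    qed
    have cont: "continuous_on (cutdom s) (\<lambda>z. \<theta> s x z)" if x: "0 \<le> x" for s x
      unfolding continuous_on_eq_continuous_within
    proof
      fix z0 assume z0: "z0 \<in> cutdom s"
      obtain D W where D: "D \<subseteq> cutdom s" "open W" "z0 \<in> W" "cutdom s \<inter> W \<subseteq> D"
        "regular_on D (\<lambda>z. \<theta> s x z)" using nbhd[OF z0] x by blast
      have "continuous (at z0 within D) (\<lambda>z. \<theta> s x z)"
        using D z0 by (auto simp: regular_on_def continuous_on_eq_continuous_within)
      moreover have "at z0 within D = at z0 within cutdom s"
        by (rule at_within_nhd[OF D(3,2)]) (use D in auto)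
      ultimately show "continuous (at z0 within cutdom s) (\<lambda>z. \<theta> s x z)" by simp
    qed
    have holo: "(\<lambda>z. \<theta> s x z) holomorphic_on U" if x: "0 \<le> x" and U: "open U" "U \<subseteq> cutdom s" for s x U
    proof (rule holomorphic_onI)
      fix z0 assume z0: "z0 \<in> U"
      obtain D W where D: "D \<subseteq> cutdom s" "open W" "z0 \<in> W" "cutdom s \<inter> W \<subseteq> D"
        "regular_on D (\<lambda>z. \<theta> s x z)" using nbhd[of z0 s] z0 U x by blast
      \<comment> \<open>Regularity yields holomorphy on the interior of \<open>D\<close> only; as
        \<open>U\<close> is open, the relative neighbourhood contains an open one.\<close>
      have "U \<inter> W \<subseteq> interior D"
        by (rule interior_maximal) (use D U in auto)
      then have "z0 \<in> interior D" using z0 D by blast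
      then have "(\<lambda>z. \<theta> s x z) field_differentiable at z0"
        using D(5) by (auto simp: regular_on_def intro: holomorphic_on_imp_differentiable_at)
      then show "(\<lambda>z. \<theta> s x z) field_differentiable at z0 within U"
        by (rule field_differentiable_at_within)
    qed
    have up: "{z. 0 < Im z} \<subseteq> cutdom True" "{z. Im z < 0} \<subseteq> cutdom False"
      by (auto simp: cutdom_def)
    have "(\<forall>s K. compact K \<and> K \<subseteq> cutdom s \<longrightarrow>
               (\<exists>C X. \<forall>z\<in>K. \<forall>x\<ge>X.
                  cmod (\<theta> s x z - jost_a p q s x z) \<le> C * epsf dp dq x * cmod (jost_a p q s x z))) \<and>
            (\<forall>x\<ge>0. (\<lambda>z. \<theta> True x z) holomorphic_on {z. 0 < Im z} \<and>
                    (\<lambda>z. \<theta> False x z) holomorphic_on {z. Im z < 0}) \<and>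
            (\<forall>s. \<forall>x\<ge>0. continuous_on (cutdom s) (\<lambda>z. \<theta> s x z))"
      using canonical cont holo[OF _ open_halfspace_Im_gt up(1)] holo[OF _ open_halfspace_Im_lt up(2)]
      by meson
  }
  ultimately show ?thesis by blast
qed

end
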